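(* Let $A=(a_\alpha)_{\alpha\in I_4^4}$ be a $4$-dimensional polystochastic matrix of order $4$. Then $\operatorname{per} A>0$.
   Context: For integers $d,n\ge 1$ let $I_n^d=\{(\alpha_1,\dots,\alpha_d):\alpha_i\in\{0,\dots,n-1\}\}$. A $d$-dimensional matrix of order $n$ is an array $A=(a_\alpha)_{\alpha\in I_n^d}$ of real numbers. A line of $A$ is a set of $n$ indices obtained by fixing $d-1$ of the coordinates and letting the remaining coordinate range over $\{0,\dots,n-1\}$. $A$ is polystochastic if $a_\alpha\ge 0$ for all $\alpha$ and $\sum_{\alpha\in l}a_\alpha=1$ for every line $l$. A diagonal of $A$ is a set $\{\alpha^1,\dots,\alpha^n\}$ of $n$ indices such that any two distinct indices $\alpha^i,\alpha^j$ differ in every coordinate. Writing $D(A)$ for the set of all diagonals, the permanent is $\operatorname{per}A=\sum_{p\in D(A)}\prod_{\alpha\in p}a_\alpha$. (Since $A$ is nonnegative, $\operatorname{per}A>0$ is equivalent to the existence of a diagonal all of whose entries are positive.) *)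

theory Defs
  imports Complex_Main
begin

text \<open>Indices of a d-dimensional matrix of order n: lists of length d with entries in 0..n-1.
  A matrix is a real-valued function on such lists (values outside the index set are irrelevant).\<close>

definition index_set :: "nat \<Rightarrow> nat \<Rightarrow> nat list set" where
  "index_set d n = {\<alpha>. length \<alpha> = d \<and> (\<forall>i<d. \<alpha> ! i < n)}"

definition lines :: "nat \<Rightarrow> nat \<Rightarrow> nat list set set" where
  "lines d n = {{\<alpha>[i := k] | k. k < n} | \<alpha> i. \<alpha> \<in> index_set d n \<and> i < d}"

definition polystochastic :: "nat \<Rightarrow> nat \<Rightarrow> (nat list \<Rightarrow> real) \<Rightarrow> bool" where
  "polystochastic d n A \<longleftrightarrow>
     (\<forall>\<alpha>\<in>index_set d n. A \<alpha> \<ge> 0) \<and> (\<forall>l\<in>lines d n. (\<Sum>\<alpha>\<in>l. A \<alpha>) = 1)"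

definition diagonals :: "nat \<Rightarrow> nat \<Rightarrow> nat list set set" where
  "diagonals d n = {p. p \<subseteq> index_set d n \<and> card p = n \<and>
      (\<forall>\<beta>\<in>p. \<forall>\<gamma>\<in>p. \<beta> \<noteq> \<gamma> \<longrightarrow> (\<forall>i<d. \<beta> ! i \<noteq> \<gamma> ! i))}"

definition per :: "nat \<Rightarrow> nat \<Rightarrow> (nat list \<Rightarrow> real) \<Rightarrow> real" where
  "per d n A = (\<Sum>p\<in>diagonals d n. \<Prod>\<alpha>\<in>p. A \<alpha>)"

end

theory Submission
  imports Defs "HOL-Library.FuncSet"
begin

text \<open>
  Split the four values of each coordinate into two pairs. Of the 16 boxes with these pairs as sides,
  the even ones all have the same weight t and the odd ones have weight 8 - t, and opposite boxes
  have equal parity because the dimension is even. If t = 4 for all splittings, then the matrix is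
  constant. Otherwise take a box of maximal weight t > 4, and rename values so that all its sides
  are {N0, N1}. Positive diagonals of two opposite boxes would combine to a positive diagonal of the
  matrix, so of any two opposite boxes of weight t at least one has none. Up to symmetry, three fixed
  boxes of weight t therefore have no positive diagonal: of any two antipodal cells in one of them, one
  is zero. Every zero pattern arising in this way contradicts the linear constraints (line sums 1,
  maximality of t, t > 4). Up to symmetry, 26 Farkas certificates suffice to see this.
\<close>

section \<open>Weights of boxes\<close>

text \<open>The threshold 4 is half of 8: a box with three two-element sides and one full side
  consists of 2^3 lines, so replacing one side by its complement turns weight t into 8 - t. The
  obstacle is combinatorial. A box with two-element sides has eight antipodal pairs, so three boxes
  without positive diagonals leave 24 binary choices of a zero. Once the zeros are chosen every
  condition is linear, but 2^24 linear programs are too many to treat one by one. Two devices reduce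
  them: a certificate assumes only a few zeros and so refutes every pattern containing these, and
  refuted patterns are reused under the relabellings that keep the three boxes. Fixing the three
  boxes loses nothing. From three pairs of opposite boxes one bad box each is picked; any two picked
  boxes have different sides in exactly two coordinates, and all eight outcomes are relabellings of
  one another. Maximality of the chosen box is taken over all splittings because this supplies the
  certificates with further linear inequalities.\<close>

datatype v = N0 | N1 | N2 | N3

type_synonym 'a quad = "'a \<times> 'a \<times> 'a \<times> 'a"

text \<open>Quadruples are the executable form of functions on \<open>v\<close>: the checkers
  compute with them, while weights and symmetries are treated on functions.\<close>

fun sel :: "'a quad \<Rightarrow> v \<Rightarrow> 'a" where
  "sel (a, b, c, d) N0 = a"
| "sel (a, b, c, d) N1 = b"
| "sel (a, b, c, d) N2 = c"
| "sel (a, b, c, d) N3 = d"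

fun high :: "v \<Rightarrow> bool" where
  "high N0 = False" | "high N1 = False" | "high N2 = True" | "high N3 = True"

lemma UNIV_v: "UNIV = {N0, N1, N2, N3}"
  by (auto intro: v.exhaust)

instance v :: finite
  by standard (simp add: UNIV_v)

lemma all_v: "(\<forall>i. P i) \<longleftrightarrow> P N0 \<and> P N1 \<and> P N2 \<and> P N3"
  by (metis v.exhaust)

lemma card_v: "card (UNIV :: v set) = 4"
  by (simp add: UNIV_v)

lemma sel_eta: "sel (\<alpha> N0, \<alpha> N1, \<alpha> N2, \<alpha> N3) = \<alpha>"
  by (simp add: fun_eq_iff all_v)

text \<open>One four-element type serves for coordinates and for values because dimension and order
  are both 4. An index is then an arbitrary function on \<open>v\<close>, with no side condition,
  and the line through \<alpha> in direction \<open>i\<close> consists of its updates at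
  \<open>i\<close>.\<close>

definition stoch :: "((v \<Rightarrow> v) \<Rightarrow> real) \<Rightarrow> bool" where
  "stoch f \<longleftrightarrow> (\<forall>\<alpha>. 0 \<le> f \<alpha>) \<and> (\<forall>\<alpha> i. (\<Sum>x\<in>UNIV. f (\<alpha>(i := x))) = 1)"

definition weight :: "((v \<Rightarrow> v) \<Rightarrow> real) \<Rightarrow> (v \<Rightarrow> v set) \<Rightarrow> real" where
  "weight f Y = sum f (PiE UNIV Y)"

section \<open>Renaming coordinates and values\<close>

definition reindex :: "(v \<Rightarrow> v) \<Rightarrow> (v \<Rightarrow> v \<Rightarrow> v) \<Rightarrow> (v \<Rightarrow> v) \<Rightarrow> v \<Rightarrow> v" where
  "reindex p q \<alpha> = (\<lambda>i. q i (\<alpha> (p i)))"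

lemma reindex_inj:
  assumes "bij p" "\<And>i. bij (q i)"
  shows "inj (reindex p q)"
proof (rule injI)
  fix \<alpha> \<beta> assume eq: "reindex p q \<alpha> = reindex p q \<beta>"
  show "\<alpha> = \<beta>"
  proof
    fix j
    obtain i where "j = p i" using assms(1) by (metis bij_pointE)
    moreover have "q i (\<alpha> (p i)) = q i (\<beta> (p i))" using eq by (simp add: reindex_def fun_eq_iff)
    ultimately show "\<alpha> j = \<beta> j" using assms(2)[of i] by (simp add: bij_def inj_eq)
  qed
qed

lemma reindex_image:
  assumes "bij p" "\<And>i. bij (q i)"
  shows "reindex p q ` PiE UNIV Y = PiE UNIV (\<lambda>i. q i ` Y (p i))"
proof
  show "reindex p q ` PiE UNIV Y \<subseteq> PiE UNIV (\<lambda>i. q i ` Y (p i))"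
    by (auto simp: reindex_def)
  show "PiE UNIV (\<lambda>i. q i ` Y (p i)) \<subseteq> reindex p q ` PiE UNIV Y"
  proof
    fix \<beta> assume \<beta>: "\<beta> \<in> PiE UNIV (\<lambda>i. q i ` Y (p i))"
    \<comment> \<open>Coordinate \<open>j\<close> is read off at position \<open>inv p j\<close>,
      where \<open>reindex\<close> puts it, after undoing the renaming of values there.\<close>
    define \<alpha> where "\<alpha> j = inv (q (inv p j)) (\<beta> (inv p j))" for j
    have "reindex p q \<alpha> = \<beta>"
      using assms by (simp add: reindex_def \<alpha>_def fun_eq_iff bij_is_inj inv_f_f bij_is_surj surj_f_inv_f)
    moreover have "\<alpha> j \<in> Y j" for j
    proof -
      have "\<beta> (inv p j) \<in> q (inv p j) ` Y (p (inv p j))" using \<beta> by blast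
      then obtain y where "y \<in> Y (p (inv p j))" "\<beta> (inv p j) = q (inv p j) y" by blast
      then show ?thesis
        using assms by (simp add: \<alpha>_def bij_is_inj inv_f_f bij_is_surj surj_f_inv_f)
    qed
    ultimately show "\<beta> \<in> reindex p q ` PiE UNIV Y" by (metis PiE_UNIV_domain Pi_I imageI)
  qed
qed

lemma weight_reindex:
  assumes "bij p" "\<And>i. bij (q i)"
  shows "weight (f \<circ> reindex p q) Y = weight f (\<lambda>i. q i ` Y (p i))"
  using sum.reindex[where A = "PiE UNIV Y" and g = f, OF inj_on_subset[OF reindex_inj[OF assms] subset_UNIV]]
  by (simp add: weight_def reindex_image[OF assms])

text \<open>A line in direction \<open>i\<close> is carried to a line in the direction
  \<open>j\<close> with \<open>p j = i\<close>, and \<open>q j\<close> merely permutes its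
  cells.\<close>

lemma stoch_reindex:
  assumes "bij p" "\<And>i. bij (q i)" "stoch f"
  shows "stoch (f \<circ> reindex p q)"
proof -
  have "(\<Sum>x\<in>UNIV. f (reindex p q (\<alpha>(i := x)))) = 1" for \<alpha> i
  proof -
    obtain j where j: "p j = i" using assms(1) by (metis bij_pointE)
    have upd: "reindex p q (\<alpha>(i := x)) = (reindex p q \<alpha>)(j := q j x)" for x
      using j bij_is_inj[OF assms(1)] by (auto simp: reindex_def fun_eq_iff inj_eq)
    have "(\<Sum>x\<in>UNIV. f ((reindex p q \<alpha>)(j := q j x))) = (\<Sum>y\<in>UNIV. f ((reindex p q \<alpha>)(j := y)))"
      by (rule sum.reindex_bij_betw[OF assms(2)])
    then show ?thesis using assms(3) by (simp add: upd stoch_def)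
  qed
  then show ?thesis using assms(3) by (simp add: stoch_def)
qed

section \<open>Line sums and complementary sides\<close>

lemma weight_union:
  assumes "S \<inter> T = {}"
  shows "weight f (Y(i := S \<union> T)) = weight f (Y(i := S)) + weight f (Y(i := T))"
proof -
  have "PiE UNIV (Y(i := S \<union> T)) = PiE UNIV (Y(i := S)) \<union> PiE UNIV (Y(i := T))"
    by (auto simp: PiE_iff split: if_splits)
  moreover have "PiE UNIV (Y(i := S)) \<inter> PiE UNIV (Y(i := T)) = {}"
    using assms by (auto simp: PiE_iff) (metis disjoint_iff fun_upd_same)
  ultimately show ?thesis by (simp add: weight_def sum.union_disjoint)
qed

text \<open>The box is a disjoint union of lines in direction \<open>i\<close>. Each contributes 1,
  and the lines are counted by the choices in the other coordinates.\<close>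

lemma weight_full:
  assumes "stoch f"
  shows "weight f (Y(i := UNIV)) = (\<Prod>j\<in>-{i}. real (card (Y j)))"
proof -
  \<comment> \<open>Freezing coordinate \<open>i\<close> at the arbitrary value \<open>N0\<close>
    picks one representative cell from each line.\<close>
  let ?P = "PiE UNIV (Y(i := {N0}))"
  have inj: "inj_on (\<lambda>(\<beta>, x). \<beta>(i := x)) (?P \<times> UNIV)"
  proof (rule inj_onI, clarify)
    fix \<beta> \<gamma> :: "v \<Rightarrow> v" and x y
    assume a: "\<beta> \<in> ?P" "\<gamma> \<in> ?P" "\<beta>(i := x) = \<gamma>(i := y)"
    have "\<beta> i = N0" "\<gamma> i = N0" using a(1,2) by (auto simp: PiE_iff dest: spec[of _ i])
    then have "\<beta> = \<gamma>" using a(3) by (metis fun_upd_triv fun_upd_upd)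
    then show "\<beta> = \<gamma> \<and> x = y" using a(3) by (metis fun_upd_same)
  qed
  have img: "(\<lambda>(\<beta>, x). \<beta>(i := x)) ` (?P \<times> UNIV) = PiE UNIV (Y(i := UNIV))"
  proof
    show "(\<lambda>(\<beta>, x). \<beta>(i := x)) ` (?P \<times> UNIV) \<subseteq> PiE UNIV (Y(i := UNIV))"
      by (auto simp: PiE_iff split: if_splits)
    show "PiE UNIV (Y(i := UNIV)) \<subseteq> (\<lambda>(\<beta>, x). \<beta>(i := x)) ` (?P \<times> UNIV)"
    proof
      fix \<alpha> assume "\<alpha> \<in> PiE UNIV (Y(i := UNIV))"
      then have "\<alpha>(i := N0) \<in> ?P" by (auto simp: PiE_iff split: if_splits)
      then show "\<alpha> \<in> (\<lambda>(\<beta>, x). \<beta>(i := x)) ` (?P \<times> UNIV)"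
        by (intro image_eqI[of _ _ "(\<alpha>(i := N0), \<alpha> i)"]) auto
    qed
  qed
  have "weight f (Y(i := UNIV)) = (\<Sum>(\<beta>, x)\<in>?P \<times> UNIV. f (\<beta>(i := x)))"
    unfolding weight_def img[symmetric] by (subst sum.reindex[OF inj]) (simp add: case_prod_unfold comp_def)
  also have "\<dots> = (\<Sum>\<beta>\<in>?P. \<Sum>x\<in>UNIV. f (\<beta>(i := x)))"
    by (simp add: sum.cartesian_product)
  also have "\<dots> = real (card ?P)" using assms by (simp add: stoch_def)
  also have "card ?P = (\<Prod>j\<in>UNIV. card ((Y(i := {N0})) j))" by (rule card_PiE) simp
  also have "\<dots> = card ((Y(i := {N0})) i) * (\<Prod>j\<in>-{i}. card ((Y(i := {N0})) j))"
    by (subst prod.remove[of _ i]) (simp_all add: Compl_eq_Diff_UNIV)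
  also have "\<dots> = 1 * (\<Prod>j\<in>-{i}. card (Y j))"
    by (intro arg_cong2[where f = "(*)"] prod.cong) auto
  finally show ?thesis by (simp del: fun_upd_apply)
qed

text \<open>Together the two boxes have a full side in direction \<open>i\<close>, hence consist of
  2 * 2 * 2 lines.\<close>

lemma weight_complement_cube:
  assumes "stoch f" "\<And>j. card (Y j) = 2"
  shows "weight f (Y(i := - Y i)) = 8 - weight f Y"
proof -
  have "weight f (Y(i := Y i \<union> - Y i)) = weight f Y + weight f (Y(i := - Y i))"
    by (subst weight_union) auto
  moreover have "weight f (Y(i := Y i \<union> - Y i)) = 8"
    using weight_full[OF assms(1), of Y i] assms(2) card_v by (simp add: Compl_eq_Diff_UNIV card_Diff_singleton)
  ultimately show ?thesis by simp
qed

text \<open>These are the sixteen boxes of the standard splitting; opposite boxes have complementary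
  patterns \<open>e\<close>, and \<open>block (\<lambda>_. False)\<close> is the distinguished box
  with all sides {N0, N1}.\<close>

definition block :: "(v \<Rightarrow> bool) \<Rightarrow> v \<Rightarrow> v set" where
  "block e i = {x. high x = e i}"

lemma high_sets: "{x. high x} = {N2, N3}" "{x. \<not> high x} = {N0, N1}"
  by (auto elim: high.elims)

lemma card_block: "card (block e i) = 2"
  by (cases "e i") (simp_all add: block_def high_sets)

lemma weight_block_flip:
  assumes "stoch f"
  shows "weight f (block (e(i := \<not> e i))) = 8 - weight f (block e)"
proof -
  have "block (e(i := \<not> e i)) = (block e)(i := - block e i)"
    by (auto simp: block_def fun_eq_iff)
  then show ?thesis using weight_complement_cube[OF assms, of "block e"] card_block by simp
qed

text \<open>The condition on \<open>e\<close> says that an even number of coordinates are high. Two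
  flips send a weight t to 8 - (8 - t) = t, and every even pattern arises from the all-low one by
  flipping coordinates in pairs.\<close>

lemma weight_block_even:
  assumes "stoch f" "(e N0 = e N1) = (e N2 = e N3)"
  shows "weight f (block e) = weight f (block (\<lambda>_. False))"
proof -
  have flip2: "weight f (block (e(i := \<not> e i, j := \<not> e j))) = weight f (block e)" if "i \<noteq> j" for e i j
    using weight_block_flip[OF assms(1), of "e(i := \<not> e i)" j] weight_block_flip[OF assms(1), of e i] that
    by simp
  \<comment> \<open>Parity determines the fourth bit from the other three, which leaves eight
    patterns.\<close>
  obtain a b c where e: "e = (\<lambda>_. False)(N0 := a, N1 := b, N2 := c, N3 := (a = b) = c)"
    using assms(2) by (intro that[of "e N0" "e N1" "e N2"]) (auto simp: fun_eq_iff all_v)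
  show ?thesis
    using flip2[of N0 N1 "\<lambda>_. False"] flip2[of N0 N2 "\<lambda>_. False"] flip2[of N0 N3 "\<lambda>_. False"]
      flip2[of N1 N2 "\<lambda>_. False"] flip2[of N1 N3 "\<lambda>_. False"] flip2[of N2 N3 "\<lambda>_. False"]
      flip2[of N2 N3 "(\<lambda>_. False)(N0 := True, N1 := True)"]
    by (cases a; cases b; cases c) (simp_all add: e fun_upd_idem)
qed

section \<open>Symmetries\<close>

fun flip :: "v \<Rightarrow> v" where
  "flip N0 = N1" | "flip N1 = N0" | "flip N2 = N3" | "flip N3 = N2"

text \<open>A permutation of the values that respects the blocks {N0, N1} and {N2, N3} is given by its values
  at N0 and N2.\<close>

fun vperm :: "v \<times> v \<Rightarrow> v \<Rightarrow> v" where
  "vperm (a, b) N0 = a"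
| "vperm (a, b) N1 = flip a"
| "vperm (a, b) N2 = b"
| "vperm (a, b) N3 = flip b"

text \<open>The executable counterpart on quadruples of \<open>relabel\<close>;
  \<open>sel_act\<close> identifies the two.\<close>

definition act :: "v quad \<Rightarrow> (v \<times> v) quad \<Rightarrow> v quad \<Rightarrow> v quad" where
  "act p q t = (vperm (sel q N0) (sel t (sel p N0)), vperm (sel q N1) (sel t (sel p N1)),
                vperm (sel q N2) (sel t (sel p N2)), vperm (sel q N3) (sel t (sel p N3)))"

text \<open>The last condition says that an even number of coordinates exchange the two blocks, so that
  the weight of the box with all sides {N0, N1} is preserved.\<close>

fun valid_sym :: "v quad \<Rightarrow> (v \<times> v) quad \<Rightarrow> bool" where
  "valid_sym (p0, p1, p2, p3) ((a0, b0), (a1, b1), (a2, b2), (a3, b3)) \<longleftrightarrow>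
     distinct [p0, p1, p2, p3] \<and>
     high a0 \<noteq> high b0 \<and> high a1 \<noteq> high b1 \<and> high a2 \<noteq> high b2 \<and> high a3 \<noteq> high b3 \<and>
     (high a0 = high a1) = (high a2 = high a3)"

text \<open>The normalised nonconstant case. The distinguished box is maximal among the boxes of all
  splittings, not only of its own, and it exceeds the balanced value 4 = 8 / 2.\<close>

definition heavy :: "((v \<Rightarrow> v) \<Rightarrow> real) \<Rightarrow> bool" where
  "heavy f \<longleftrightarrow> stoch f \<and>
     (\<forall>Y. (\<forall>i. card (Y i) = 2) \<longrightarrow> weight f Y \<le> weight f (block (\<lambda>_. False))) \<and>
     4 < weight f (block (\<lambda>_. False))"

abbreviation relabel :: "v quad \<Rightarrow> (v \<times> v) quad \<Rightarrow> (v \<Rightarrow> v) \<Rightarrow> v \<Rightarrow> v" where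
  "relabel p q \<equiv> reindex (sel p) (\<lambda>i. vperm (sel q i))"

lemma sel_act: "sel (act p q t) = relabel p q (sel t)"
  by (simp add: act_def reindex_def fun_eq_iff all_v)

lemma bij_vI: "inj (g :: v \<Rightarrow> v) \<Longrightarrow> bij g"
  by (simp add: bij_def finite_UNIV_inj_surj)

lemma bij_vperm: "high a \<noteq> high b \<Longrightarrow> bij (vperm (a, b))"
  by (rule bij_vI) (cases a; cases b; simp add: inj_def all_v)

lemma high_vperm: "high a \<noteq> high b \<Longrightarrow> high (vperm (a, b) x) = (high x \<noteq> high a)"
  by (cases x; cases a; cases b; simp)

lemma flip_flip: "flip (flip x) = x"
  by (cases x) simp_all

text \<open>This is the gain from permutations that respect the two blocks: antipodal pairs inside a
  box go to antipodal pairs inside a box.\<close>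

lemma vperm_flip: "vperm ab (flip x) = flip (vperm ab x)"
  by (cases ab; cases x) (simp_all add: flip_flip)

lemma valid_symD:
  assumes "valid_sym p q"
  shows "bij (sel p)" "\<And>i. high (fst (sel q i)) \<noteq> high (snd (sel q i))"
    "(high (fst (sel q N0)) = high (fst (sel q N1))) = (high (fst (sel q N2)) = high (fst (sel q N3)))"
proof -
  obtain p0 p1 p2 p3 where p: "p = (p0, p1, p2, p3)" by (cases p) auto
  obtain a0 b0 a1 b1 a2 b2 a3 b3 where q: "q = ((a0, b0), (a1, b1), (a2, b2), (a3, b3))"
    by (cases q) auto
  have "inj (sel p)"
    using assms by (auto simp: p q inj_def all_v)
  then show "bij (sel p)" by (rule bij_vI)
  have "\<forall>i. high (fst (sel q i)) \<noteq> high (snd (sel q i))"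
    using assms by (simp add: p q all_v)
  then show "\<And>i. high (fst (sel q i)) \<noteq> high (snd (sel q i))" by blast
  show "(high (fst (sel q N0)) = high (fst (sel q N1))) = (high (fst (sel q N2)) = high (fst (sel q N3)))"
    using assms unfolding p q valid_sym.simps sel.simps fst_conv by blast
qed

text \<open>Boxes with two-element sides go to boxes with two-element sides, so the upper bound
  persists. The distinguished box goes to a box of even parity, by the last condition of
  \<open>valid_sym\<close>, and such a box has the same weight.\<close>

lemma heavy_relabel:
  assumes "valid_sym p q" "heavy f"
  shows "heavy (f \<circ> relabel p q)"
proof -
  note v = valid_symD[OF assms(1)]
  have bij: "bij (vperm (sel q i))" for i
    using bij_vperm[OF v(2)[of i]] by simp
  have f: "stoch f" using assms(2) by (simp add: heavy_def)
  \<comment> \<open>This is the block pattern of the image of the distinguished box.\<close>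
  let ?e = "\<lambda>i. high (fst (sel q i))"
  have "vperm (sel q i) ` block (\<lambda>_. False) (sel p i) = block ?e i" for i
  proof -
    have "vperm (sel q i) ` {x. \<not> high x} \<subseteq> {x. high x = ?e i}"
      using high_vperm[OF v(2)[of i]] by auto
    moreover have "card (vperm (sel q i) ` {x. \<not> high x}) = card {x. high x = ?e i}"
      using card_image[OF inj_on_subset[OF bij_is_inj[OF bij[of i]] subset_UNIV], of "{x. \<not> high x}"]
        card_block[of ?e i] card_block[of "\<lambda>_. False" i] unfolding block_def by simp
    ultimately show ?thesis by (simp add: block_def card_subset_eq)
  qed
  then have base: "weight (f \<circ> relabel p q) (block (\<lambda>_. False)) = weight f (block (\<lambda>_. False))"
    using weight_block_even[OF f v(3)] by (simp add: weight_reindex[OF v(1) bij])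
  have "weight (f \<circ> relabel p q) Y \<le> weight f (block (\<lambda>_. False))" if "\<forall>i. card (Y i) = 2" for Y
  proof -
    have "\<forall>i. card (vperm (sel q i) ` Y (sel p i)) = 2"
      using that by (simp add: card_image inj_on_subset[OF bij_is_inj[OF bij]])
    then show ?thesis using assms(2) by (simp add: weight_reindex[OF v(1) bij] heavy_def)
  qed
  then show ?thesis
    using assms(2) stoch_reindex[OF v(1) bij f] by (simp add: heavy_def base)
qed

section \<open>Farkas certificates\<close>

type_synonym entry = "int \<times> v list quad"

text \<open>An entry stands for an integer multiple of the indicator function of a box. Selecting the entries
  coordinate by coordinate keeps the evaluation of all 256 coefficients cheap.\<close>

definition select :: "v \<Rightarrow> (int \<times> v list \<times> 'b) list \<Rightarrow> (int \<times> 'b) list" where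
  "select x es = map (\<lambda>(y, s, r). (y, r)) (filter (\<lambda>(y, s, r). x \<in> set s) es)"

definition vals :: "v list" where "vals = [N0, N1, N2, N3]"

text \<open>Matrix entries are nonnegative and will be assumed to vanish on \<open>zs\<close>, so
  this makes the whole linear combination nonpositive.\<close>

definition nonpos_off :: "v quad list \<Rightarrow> entry list \<Rightarrow> bool" where
  "nonpos_off zs es \<longleftrightarrow>
     list_all (\<lambda>a. list_all (\<lambda>b. list_all (\<lambda>c. list_all (\<lambda>d.
       sum_list (map fst (filter (\<lambda>(y, s). d \<in> set s) (select c (select b (select a es))))) \<le> 0
         \<or> (a, b, c, d) \<in> set zs) vals) vals) vals) vals"

text \<open>The first \<open>v\<close> is the direction. The cell only locates the line; its
  component in that direction is replaced by all values.\<close>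

fun line_entry :: "int \<times> v \<times> v quad \<Rightarrow> entry" where
  "line_entry (y, N0, a, b, c, d) = (y, vals, [b], [c], [d])"
| "line_entry (y, N1, a, b, c, d) = (y, [a], vals, [c], [d])"
| "line_entry (y, N2, a, b, c, d) = (y, [a], [b], vals, [d])"
| "line_entry (y, N3, a, b, c, d) = (y, [a], [b], [c], vals)"

fun two :: "v list \<Rightarrow> bool" where
  "two [a, b] \<longleftrightarrow> a \<noteq> b"
| "two _ \<longleftrightarrow> False"

text \<open>A certificate lists the zeros it assumes, a multiple of the inequality 4 < W, where W is the weight
  of the box with all sides {N0, N1}, multiples of line sums, and multiples of the inequalities
  saying that other boxes weigh at most W.\<close>

type_synonym cert = "v quad list \<times> int \<times> (int \<times> v \<times> v quad) list \<times> entry list"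

text \<open>The combination evaluated here is (k + sum of the m) W + (sum of the line multipliers) -
  (sum of the m times the weights of the boxes in \<open>cs\<close>). By maximality it is at least k
  W plus the line multipliers, hence at least \<open>w\<close>, and more than \<open>w\<close> if 0
  < k; this is why \<open>w = 0\<close> is accepted for positive \<open>k\<close>. Line multipliers
  may have either sign because lines give equations. Example: if the eight cells of the
  distinguished box with last coordinate \<open>N0\<close> are zero, four lines cover its other
  cells, so W \<le> 4.\<close>

fun cert_ok :: "cert \<Rightarrow> bool" where
  "cert_ok (zs, k, ls, cs) \<longleftrightarrow>
     (let w = sum_list (map fst ls) + 4 * k; low = [N0, N1]
      in 0 \<le> k \<and> (0 < w \<or> w = 0 \<and> 0 < k) \<and>
        list_all (\<lambda>(m, s0, s1, s2, s3). 0 \<le> m \<and> two s0 \<and> two s1 \<and> two s2 \<and> two s3) cs \<and>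
        nonpos_off zs ((k + sum_list (map fst cs), low, low, low, low)
          # map line_entry ls @ map (\<lambda>(m, s). (- m, s)) cs))"

definition coeff :: "entry list \<Rightarrow> (v \<Rightarrow> v) \<Rightarrow> int" where
  "coeff es \<alpha> = sum_list (map fst (filter (\<lambda>(y, s). \<forall>i. \<alpha> i \<in> set (sel s i)) es))"

lemma weight_alt: "weight f Y = (\<Sum>\<alpha>\<in>UNIV. if \<forall>i. \<alpha> i \<in> Y i then f \<alpha> else 0)"
proof -
  have "PiE UNIV Y = {\<alpha>\<in>UNIV. \<forall>i. \<alpha> i \<in> Y i}" by auto
  then show ?thesis unfolding weight_def by (simp only: sum.inter_filter[OF finite])
qed

text \<open>Double counting: each cell collects the multipliers of the boxes that contain
  it.\<close>

lemma sum_coeff: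
  fixes f :: "(v \<Rightarrow> v) \<Rightarrow> real"
  shows "(\<Sum>(y, s)\<leftarrow>es. real_of_int y * weight f (\<lambda>i. set (sel s i))) = (\<Sum>\<alpha>\<in>UNIV. coeff es \<alpha> * f \<alpha>)"
proof (induction es)
  case Nil
  then show ?case by (simp add: coeff_def)
next
  case (Cons e es)
  obtain y s where e: "e = (y, s)" by (cases e)
  have "coeff (e # es) \<alpha> * f \<alpha> =
      y * (if \<forall>i. \<alpha> i \<in> set (sel s i) then f \<alpha> else 0) + coeff es \<alpha> * f \<alpha>" for \<alpha>
    by (simp add: coeff_def e algebra_simps)
  then show ?case
    using Cons.IH by (simp add: e weight_alt sum.distrib sum_distrib_left)
qed

text \<open>Four successive filters amount to membership in the box, so the number computed by the
  checker is the true coefficient of the cell.\<close>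

lemma coeff_select:
  "sum_list (map fst (filter (\<lambda>(y, s). d \<in> set s) (select c (select b (select a es))))) =
     coeff es (sel (a, b, c, d))"
proof (induction es)
  case (Cons e es)
  obtain y s0 s1 s2 s3 where "e = (y, s0, s1, s2, s3)" by (cases e) auto
  then show ?case using Cons.IH by (simp add: coeff_def select_def all_v)
qed (simp add: coeff_def select_def)

lemma nonpos_off_coeff:
  assumes "nonpos_off zs es"
  shows "coeff es (sel t) \<le> 0 \<or> t \<in> set zs"
proof -
  obtain a b c d where t: "t = (a, b, c, d)" by (cases t) auto
  have mem: "x \<in> set vals" for x by (cases x) (simp_all add: vals_def)
  show ?thesis
    using assms mem[of a] mem[of b] mem[of c] mem[of d]
    unfolding nonpos_off_def coeff_select list_all_iff t by auto
qed

lemma set_vals: "set vals = UNIV"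
  by (simp add: vals_def UNIV_v)

lemma weight_line_entry:
  assumes "stoch f"
  shows "weight f (\<lambda>j. set (sel (snd (line_entry (y, i, t))) j)) = 1"
proof -
  obtain a b c d where t: "t = (a, b, c, d)" by (cases t) auto
  have "(\<lambda>j. set (sel (snd (line_entry (y, i, t))) j)) = (\<lambda>j. {sel t j})(i := UNIV)"
    by (cases i) (simp_all add: fun_eq_iff all_v t set_vals)
  then show ?thesis using weight_full[OF assms, of "\<lambda>j. {sel t j}" i] by simp
qed

lemma fst_line_entry: "fst (line_entry (y, i, t)) = y"
  by (cases t; cases i) simp_all

lemma two_card: "two s \<Longrightarrow> card (set s) = 2"
  by (cases s rule: two.cases) auto

text \<open>Farkas argument: if all entries on \<open>zs\<close> vanished, the sum \<open>E\<close>
  would be at most 0 when collected cell by cell, but positive when collected box by box.\<close>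

lemma cert_ok_sound:
  assumes "cert_ok (zs, k, ls, cs)" "heavy f"
  shows "\<exists>t\<in>set zs. f (sel t) \<noteq> 0"
proof (rule ccontr)
  assume "\<not> ?thesis"
  then have zero: "f (sel t) = 0" if "t \<in> set zs" for t using that by blast
  \<comment> \<open>Here \<open>w\<close> holds only the line multipliers; the \<open>w\<close>
    inside \<open>cert_ok\<close> also contains the summand \<open>4 * k\<close>.\<close>
  define w where "w = sum_list (map fst ls)"
  define W where "W = weight f (block (\<lambda>_. False))"
  define es where "es = (k + sum_list (map fst cs), [N0, N1], [N0, N1], [N0, N1], [N0, N1])
          # map line_entry ls @ map (\<lambda>(m, s). (- m, s)) cs"
  define E where "E = (\<Sum>(y, s)\<leftarrow>es. real_of_int y * weight f (\<lambda>i. set (sel s i)))"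
  have ok: "0 \<le> k" "0 < w + 4 * k \<or> w + 4 * k = 0 \<and> 0 < k" "nonpos_off zs es"
    and cs: "\<And>m s0 s1 s2 s3. (m, s0, s1, s2, s3) \<in> set cs \<Longrightarrow> 0 \<le> m \<and> two s0 \<and> two s1 \<and> two s2 \<and> two s3"
    using assms(1) unfolding cert_ok.simps Let_def w_def[symmetric] es_def[symmetric]
    by (blast, blast, blast, auto simp: list_all_iff)
  have f: "stoch f" and W: "4 < W" and max: "\<And>Y. (\<And>i. card (Y i) = 2) \<Longrightarrow> weight f Y \<le> W"
    using assms(2) by (auto simp: heavy_def W_def)
  have "coeff es \<alpha> * f \<alpha> \<le> 0" for \<alpha>
  proof -
    have "coeff es \<alpha> \<le> 0 \<or> f \<alpha> = 0"
      using nonpos_off_coeff[OF ok(3), of "(\<alpha> N0, \<alpha> N1, \<alpha> N2, \<alpha> N3)"]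
        zero[of "(\<alpha> N0, \<alpha> N1, \<alpha> N2, \<alpha> N3)"] by (auto simp: sel_eta)
    then show ?thesis using f by (auto simp: stoch_def mult_nonpos_nonneg)
  qed
  then have "E \<le> 0" unfolding E_def sum_coeff by (simp add: sum_nonpos)
  have lines: "(\<Sum>(y, s)\<leftarrow>map line_entry ls. real_of_int y * weight f (\<lambda>i. set (sel s i))) = w"
    unfolding w_def
  proof (induction ls)
    case (Cons l ls)
    obtain y i t where l: "l = (y, i, t)" by (cases l)
    show ?case
      using Cons.IH weight_line_entry[OF f, of y i t] fst_line_entry[of y i t]
      by (simp add: l case_prod_unfold)
  qed simp
  have cubes: "(\<Sum>(y, s)\<leftarrow>map (\<lambda>(m, s). (- m, s)) cs. real_of_int y * weight f (\<lambda>i. set (sel s i)))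
      \<ge> - real_of_int (sum_list (map fst cs)) * W"
    using cs
  proof (induction cs)
    case (Cons c cs)
    obtain m s0 s1 s2 s3 where c: "c = (m, s0, s1, s2, s3)" by (cases c) auto
    have m: "0 \<le> m" "two s0" "two s1" "two s2" "two s3" using Cons.prems[of m s0 s1 s2 s3] by (auto simp: c)
    have "\<forall>i. card (set (sel (s0, s1, s2, s3) i)) = 2" using m by (simp add: all_v two_card)
    then have "weight f (\<lambda>i. set (sel (s0, s1, s2, s3) i)) \<le> W" by (intro max) blast
    then have "real_of_int m * weight f (\<lambda>i. set (sel (s0, s1, s2, s3) i)) \<le> real_of_int m * W"
      using m by (intro mult_left_mono) auto
    moreover have "(\<Sum>(y, s)\<leftarrow>map (\<lambda>(m, s). (- m, s)) cs. real_of_int y * weight f (\<lambda>i. set (sel s i)))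
      \<ge> - real_of_int (sum_list (map fst cs)) * W"
      by (rule Cons.IH) (rule Cons.prems, simp)
    ultimately show ?case by (simp add: c algebra_simps)
  qed simp
  have base: "weight f (\<lambda>i. set (sel ([N0, N1], [N0, N1], [N0, N1], [N0, N1]) i)) = W"
  proof -
    have "(\<lambda>i. set (sel ([N0, N1], [N0, N1], [N0, N1], [N0, N1]) i)) = block (\<lambda>_. False)"
      by (simp add: fun_eq_iff all_v block_def high_sets)
    then show ?thesis by (simp add: W_def)
  qed
  have "E \<ge> k * W + w"
    using lines cubes by (simp add: E_def es_def base algebra_simps)
  \<comment> \<open>The strict version settles the case \<open>w + 4 * k = 0\<close>, where the weak
    bounds alone give no contradiction.\<close>
  moreover have "k * W \<ge> k * 4" "0 < k \<Longrightarrow> k * W > k * 4"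
    using W ok(1) by (simp_all add: mult_left_mono)
  ultimately have "real_of_int (w + 4 * k) \<le> 0" "0 < k \<Longrightarrow> real_of_int (w + 4 * k) < 0"
    using \<open>E \<le> 0\<close> by (simp, smt (verit) of_int_add of_int_mult of_int_numeral)
  then show False using ok(2) by linarith
qed

section \<open>Case distinctions over zero patterns\<close>

text \<open>The three boxes: side {N0, N1} everywhere, except for the coordinates 0 and 1 of the second box and
  0 and 2 of the third one, whose side is {N2, N3}.\<close>

fun bad_cell :: "v quad \<Rightarrow> bool" where
  "bad_cell (a, b, c, d) \<longleftrightarrow> \<not> high d \<and> (if high a then high b \<noteq> high c else \<not> high b \<and> \<not> high c)"

text \<open>One cell from each of the three boxes is tested; \<open>bad_cell_act\<close> extends the
  result to all their cells.\<close>

definition keeps_bad :: "v quad \<Rightarrow> (v \<times> v) quad \<Rightarrow> bool" where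
  "keeps_bad p q \<longleftrightarrow> bad_cell (act p q (N0, N0, N0, N0)) \<and>
     bad_cell (act p q (N2, N2, N0, N0)) \<and> bad_cell (act p q (N2, N0, N2, N0))"

text \<open>The antipode inside the same box of the standard splitting, since \<open>flip\<close>
  exchanges the two values within a block.\<close>

fun flip4 :: "v quad \<Rightarrow> v quad" where
  "flip4 (a, b, c, d) = (flip a, flip b, flip c, flip d)"

text \<open>Leaves refer to the zeros of a certificate, or of an earlier case distinction, up to a symmetry;
  a split assumes that a cell or its antipode in the same box is zero.\<close>

datatype tree =
    Cut nat "v quad" "(v \<times> v) quad"
  | Ref nat "v quad" "(v \<times> v) quad"
  | Split "v quad" tree tree

text \<open>A certificate refutes its zeros for every heavy function, so any valid symmetry may move
  it. An earlier case distinction relies on the three boxes having no positive diagonal, so there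
  the symmetry must also map these boxes among themselves. In both leaves the current pattern may
  contain more zeros than are required.\<close>

fun check :: "v quad list list \<Rightarrow> v quad list list \<Rightarrow> tree \<Rightarrow> v quad list \<Rightarrow> bool" where
  "check cs rs (Cut k p q) zs \<longleftrightarrow>
     k < length cs \<and> valid_sym p q \<and> list_all (\<lambda>t. act p q t \<in> set zs) (cs ! k)"
| "check cs rs (Ref k p q) zs \<longleftrightarrow>
     k < length rs \<and> valid_sym p q \<and> keeps_bad p q \<and> list_all (\<lambda>t. act p q t \<in> set zs) (rs ! k)"
| "check cs rs (Split t l r) zs \<longleftrightarrow>
     bad_cell t \<and> check cs rs l (t # zs) \<and> check cs rs r (flip4 t # zs)"

text \<open>The reference list grows as the derivation is read. Started from the empty list,
  \<open>Ref k\<close> means the item at position \<open>k\<close>, counted from 0, and can only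
  point backwards.\<close>

fun check_all :: "v quad list list \<Rightarrow> v quad list list \<Rightarrow> (v quad list \<times> tree) list \<Rightarrow> bool" where
  "check_all cs rs [] \<longleftrightarrow> True"
| "check_all cs rs ((zs, t) # ds) \<longleftrightarrow> check cs rs t zs \<and> check_all cs (rs @ [zs]) ds"

text \<open>A diagonal of a box with two-element sides is a pair of antipodal cells, so for
  nonnegative \<open>f\<close> this says that none of the three boxes has a positive
  diagonal.\<close>

definition bad3 :: "((v \<Rightarrow> v) \<Rightarrow> real) \<Rightarrow> bool" where
  "bad3 f \<longleftrightarrow> (\<forall>t. bad_cell t \<longrightarrow> f (sel t) = 0 \<or> f (sel (flip4 t)) = 0)"

text \<open>The parameter \<open>P\<close> distinguishes the two sources of refutations: it is
  constantly true for certificates and \<open>bad3\<close> for case distinctions.\<close>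

definition excluded :: "(((v \<Rightarrow> v) \<Rightarrow> real) \<Rightarrow> bool) \<Rightarrow> v quad list \<Rightarrow> bool" where
  "excluded P zs \<longleftrightarrow> (\<forall>f. heavy f \<longrightarrow> P f \<longrightarrow> (\<exists>t\<in>set zs. f (sel t) \<noteq> 0))"

lemma act_flip4: "act p q (flip4 t) = flip4 (act p q t)"
proof -
  have "sel (flip4 t) i = flip (sel t i)" for i by (cases t; cases i) simp_all
  then show ?thesis by (simp add: act_def vperm_flip)
qed

lemma bad_cell_act:
  assumes "valid_sym p q" "keeps_bad p q" "bad_cell t"
  shows "bad_cell (act p q t)"
proof -
  \<comment> \<open>Whether a cell is bad depends only on which coordinates are high, and a
    relabelling transforms this information coordinate by coordinate.\<close>
  have cong: "bad_cell (act p q t) = bad_cell (act p q r)" if "\<forall>i. high (sel t i) = high (sel r i)" for r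
    using that high_vperm[OF valid_symD(2)[OF assms(1)]] by (simp add: act_def)
  obtain a b c d where t: "t = (a, b, c, d)" by (cases t) auto
  consider "\<not> high a" "\<not> high b" "\<not> high c" "\<not> high d" | "high a" "high b" "\<not> high c" "\<not> high d"
    | "high a" "\<not> high b" "high c" "\<not> high d"
    using assms(3) by (auto simp: t split: if_splits)
  then show ?thesis
  proof cases
    case 1
    then show ?thesis using cong[of "(N0, N0, N0, N0)"] assms(2) by (simp add: keeps_bad_def all_v t)
  next
    case 2
    then show ?thesis using cong[of "(N2, N2, N0, N0)"] assms(2) by (simp add: keeps_bad_def all_v t)
  next
    case 3
    then show ?thesis using cong[of "(N2, N0, N2, N0)"] assms(2) by (simp add: keeps_bad_def all_v t)
  qed
qed

lemma bad3_relabel: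
  assumes "valid_sym p q" "keeps_bad p q" "bad3 f"
  shows "bad3 (f \<circ> relabel p q)"
  unfolding bad3_def
proof (intro allI impI)
  fix t assume "bad_cell t"
  then have "f (sel (act p q t)) = 0 \<or> f (sel (flip4 (act p q t))) = 0"
    using assms(3) bad_cell_act[OF assms(1,2)] unfolding bad3_def by blast
  then show "(f \<circ> relabel p q) (sel t) = 0 \<or> (f \<circ> relabel p q) (sel (flip4 t)) = 0"
    by (simp add: sel_act[symmetric] act_flip4)
qed

text \<open>Zeros of \<open>f\<close> at the moved cells are zeros of the pulled-back function at
  the cells of \<open>c\<close>, and the pulled-back function is again heavy and satisfies
  \<open>P\<close>.\<close>

lemma excluded_act:
  assumes "valid_sym p q" "excluded P c" "list_all (\<lambda>t. act p q t \<in> set zs) c"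
    and "\<And>f. Q f \<Longrightarrow> P (f \<circ> relabel p q)"
  shows "excluded Q zs"
  unfolding excluded_def
proof (intro allI impI)
  fix f assume "heavy f" "Q f"
  then obtain t where "t \<in> set c" "(f \<circ> relabel p q) (sel t) \<noteq> 0"
    using assms(2,4) heavy_relabel[OF assms(1)] unfolding excluded_def by blast
  then show "\<exists>t\<in>set zs. f (sel t) \<noteq> 0"
    using assms(3) by (auto simp: list_all_iff sel_act[symmetric])
qed

lemma check_sound:
  assumes "check cs rs tr zs" "\<And>c. c \<in> set cs \<Longrightarrow> excluded (\<lambda>_. True) c"
    "\<And>r. r \<in> set rs \<Longrightarrow> excluded bad3 r"
  shows "excluded bad3 zs"
  using assms(1)
proof (induction tr arbitrary: zs)
  case (Cut k p q)
  then show ?case using assms(2)[of "cs ! k"] by (auto intro!: excluded_act[of p q "\<lambda>_. True" "cs ! k"])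
next
  case (Ref k p q)
  then show ?case
    using assms(3)[of "rs ! k"] bad3_relabel[of p q] by (auto intro!: excluded_act[of p q bad3 "rs ! k"])
next
  case (Split t l r)
  \<comment> \<open>By \<open>bad3\<close> one of the two antipodal cells is zero, so a function
    vanishing on \<open>zs\<close> also vanishes on one of the two extended patterns.\<close>
  then have "excluded bad3 (t # zs)" "excluded bad3 (flip4 t # zs)" "bad_cell t" by auto
  then show ?case unfolding excluded_def bad3_def by (metis set_ConsD)
qed

text \<open>Induction along the derivation: every accepted pattern joins the facts available to the
  later ones.\<close>

lemma check_all_sound:
  assumes "check_all cs rs ds" "\<And>c. c \<in> set cs \<Longrightarrow> excluded (\<lambda>_. True) c"
    "\<And>r. r \<in> set rs \<Longrightarrow> excluded bad3 r" "zs \<in> set (map fst ds)"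
  shows "excluded bad3 zs"
  using assms(1,3,4)
proof (induction ds arbitrary: rs)
  case (Cons d ds)
  obtain ys t where d: "d = (ys, t)" by (cases d)
  have "excluded bad3 ys" using Cons.prems(1,2) assms(2) by (auto simp: d intro: check_sound)
  then show ?case
    using Cons.prems Cons.IH[of "rs @ [ys]"] by (auto simp: d)
qed simp

section \<open>Certificate data\<close>

text \<open>The certificates are sparse integral solutions of the dual linear programs.\<close>

definition certs :: "cert list" where
  "certs = [
    ([(N0,N1,N0,N1), (N0,N1,N1,N0), (N1,N1,N0,N1), (N1,N1,N1,N0), (N2,N0,N3,N0), (N2,N0,N3,N1),
    (N3,N0,N2,N1), (N3,N0,N3,N1)], 1, [(- 1,N0,N0,N0,N0,N0), (- 1,N0,N0,N0,N0,N1), (-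
    1,N0,N0,N0,N1,N0), (- 1,N0,N0,N0,N1,N1), (- 1,N0,N0,N1,N0,N0), (- 1,N0,N0,N1,N1,N1),
    (1,N2,N2,N0,N0,N0), (1,N2,N2,N0,N0,N1), (1,N2,N3,N0,N0,N1), (- 1,N3,N2,N0,N2,N0)], []),
    ([(N0,N1,N0,N1), (N0,N1,N1,N0), (N1,N1,N0,N1), (N1,N1,N1,N0), (N2,N3,N0,N0), (N2,N3,N0,N1),
    (N2,N3,N1,N1), (N3,N2,N0,N1), (N3,N3,N1,N1)], 0, [(- 3,N0,N0,N0,N0,N0), (- 2,N0,N0,N0,N0,N1),
    (- 5,N0,N0,N0,N1,N0), (- 4,N0,N0,N1,N0,N0), (- 1,N0,N0,N1,N1,N1), (2,N0,N0,N2,N0,N1), (-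
    1,N0,N0,N2,N1,N0), (2,N0,N0,N3,N0,N0), (3,N0,N0,N3,N0,N1), (5,N0,N0,N3,N1,N1), (-
    1,N1,N0,N0,N0,N0), (- 2,N1,N0,N0,N0,N1), (1,N1,N0,N0,N1,N0), (- 4,N1,N0,N0,N1,N1), (-
    1,N1,N1,N0,N0,N0), (- 2,N1,N1,N0,N0,N1), (1,N1,N1,N0,N1,N0), (- 4,N1,N1,N0,N1,N1),
    (4,N1,N2,N0,N0,N0), (1,N1,N2,N0,N1,N1), (1,N1,N3,N0,N0,N0), (1,N1,N3,N0,N1,N1),
    (2,N2,N2,N0,N0,N0), (1,N2,N2,N0,N0,N2), (1,N2,N2,N0,N0,N3), (1,N2,N2,N2,N0,N0), (-
    1,N2,N2,N2,N0,N1), (1,N2,N3,N0,N0,N0), (- 1,N2,N3,N0,N0,N1), (1,N2,N3,N2,N0,N0), (-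
    1,N2,N3,N2,N0,N1), (1,N3,N2,N0,N0,N0), (- 1,N3,N2,N0,N1,N0), (- 1,N3,N2,N2,N0,N0),
    (1,N3,N2,N2,N2,N0), (1,N3,N2,N2,N3,N0), (2,N3,N3,N0,N0,N0), (1,N3,N3,N0,N2,N0),
    (1,N3,N3,N0,N3,N0), (2,N3,N3,N2,N0,N0), (1,N3,N3,N2,N2,N0), (1,N3,N3,N2,N3,N0), (-
    3,N3,N3,N3,N0,N0)], [(1,[N2,N3],[N0,N2],[N0,N2],[N0,N2]), (1,[N2,N3],[N0,N2],[N0,N2],[N0,N3]),
    (1,[N2,N3],[N0,N2],[N0,N3],[N0,N2]), (1,[N2,N3],[N0,N2],[N0,N3],[N0,N3]),
    (1,[N0,N1],[N0,N3],[N0,N1],[N0,N1])]),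
    ([(N0,N1,N0,N1), (N1,N1,N0,N1), (N2,N2,N0,N0), (N2,N2,N1,N0), (N2,N2,N1,N1), (N2,N3,N0,N0),
    (N3,N0,N2,N1), (N3,N1,N3,N0)], 1, [(- 1,N0,N0,N0,N0,N0), (- 1,N0,N0,N0,N0,N1), (-
    1,N0,N0,N0,N1,N0), (- 1,N0,N0,N0,N1,N1), (- 1,N0,N0,N1,N0,N0), (- 1,N0,N0,N1,N1,N0), (-
    1,N0,N0,N1,N1,N1), (1,N1,N2,N0,N0,N0), (1,N1,N2,N0,N1,N0), (1,N1,N2,N0,N1,N1), (-
    1,N1,N3,N0,N2,N0), (1,N2,N3,N0,N0,N0), (1,N2,N3,N0,N0,N1), (1,N2,N3,N1,N0,N0), (-
    1,N3,N2,N3,N1,N0), (- 1,N3,N3,N0,N3,N0)], []),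
    ([(N2,N0,N3,N1), (N2,N1,N2,N0), (N2,N1,N3,N0), (N2,N3,N0,N1), (N3,N1,N2,N1), (N3,N1,N3,N0),
    (N3,N1,N3,N1), (N3,N2,N0,N0), (N3,N2,N0,N1), (N3,N3,N0,N1), (N3,N3,N1,N0), (N3,N3,N1,N1)], 0,
    [(- 14,N0,N0,N0,N0,N1), (- 10,N0,N0,N0,N1,N0), (- 18,N0,N0,N0,N1,N1), (18,N0,N0,N0,N2,N0), (-
    28,N0,N0,N1,N0,N0), (- 28,N0,N0,N1,N0,N1), (- 28,N0,N0,N1,N1,N0), (- 28,N0,N0,N1,N1,N1),
    (10,N0,N0,N2,N0,N0), (4,N0,N0,N2,N0,N1), (10,N0,N0,N2,N2,N0), (4,N0,N0,N2,N2,N1),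
    (10,N0,N0,N3,N0,N1), (10,N0,N0,N3,N1,N0), (10,N0,N0,N3,N1,N1), (6,N1,N2,N0,N0,N1),
    (14,N1,N3,N0,N0,N1), (10,N1,N3,N0,N1,N0), (14,N1,N3,N0,N1,N1), (- 18,N1,N3,N0,N2,N0), (-
    8,N2,N0,N0,N0,N0), (- 8,N2,N1,N0,N0,N0), (18,N2,N2,N0,N0,N1), (28,N2,N2,N1,N0,N0),
    (18,N2,N3,N1,N0,N0), (14,N2,N3,N1,N0,N1), (- 4,N2,N3,N2,N0,N1), (3,N3,N0,N0,N0,N0),
    (3,N3,N0,N0,N2,N0), (3,N3,N0,N2,N0,N0), (3,N3,N0,N2,N2,N0), (3,N3,N1,N0,N0,N0),
    (3,N3,N1,N0,N2,N0), (3,N3,N1,N2,N0,N0), (3,N3,N1,N2,N2,N0), (- 8,N3,N2,N0,N2,N0), (-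
    10,N3,N2,N3,N1,N0), (- 10,N3,N3,N2,N1,N0)], [(2,[N0,N1],[N0,N2],[N0,N2],[N0,N1]),
    (3,[N0,N1],[N0,N2],[N0,N2],[N0,N2]), (3,[N0,N1],[N0,N2],[N0,N2],[N0,N3]),
    (10,[N0,N1],[N0,N3],[N0,N1],[N0,N1]), (5,[N0,N2],[N0,N2],[N0,N2],[N0,N1]),
    (5,[N1,N2],[N0,N2],[N0,N2],[N0,N1])]),
    ([(N0,N0,N1,N1), (N0,N1,N1,N0), (N0,N1,N1,N1), (N1,N0,N1,N0), (N1,N0,N1,N1), (N1,N1,N0,N1),
    (N1,N1,N1,N0), (N2,N2,N0,N1), (N2,N2,N1,N1), (N2,N3,N0,N1), (N3,N2,N0,N0), (N3,N2,N1,N1),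
    (N3,N3,N1,N1)], 0, [(- 12,N0,N0,N0,N0,N1), (- 8,N0,N0,N0,N1,N0), (- 2,N0,N0,N0,N1,N1),
    (3,N0,N0,N0,N2,N0), (2,N0,N0,N0,N2,N1), (3,N0,N0,N0,N3,N0), (2,N0,N0,N0,N3,N1), (-
    14,N0,N0,N1,N0,N0), (- 18,N0,N0,N1,N0,N1), (- 7,N0,N0,N1,N1,N0), (- 7,N0,N0,N1,N1,N1),
    (15,N0,N0,N2,N0,N0), (6,N0,N0,N2,N0,N1), (14,N0,N0,N2,N1,N1), (4,N0,N0,N3,N0,N1),
    (7,N0,N0,N3,N1,N1), (- 8,N1,N0,N0,N0,N0), (- 4,N1,N0,N0,N0,N1), (- 7,N1,N0,N0,N1,N1), (-
    7,N1,N1,N0,N0,N0), (- 16,N1,N1,N0,N1,N1), (3,N1,N1,N0,N2,N0), (1,N1,N1,N0,N2,N1),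
    (3,N1,N1,N0,N3,N0), (1,N1,N1,N0,N3,N1), (18,N1,N2,N0,N0,N1), (7,N1,N2,N0,N1,N0),
    (13,N1,N3,N0,N0,N0), (6,N1,N3,N0,N1,N0), (8,N1,N3,N0,N1,N1), (- 10,N2,N0,N0,N0,N0), (-
    2,N2,N0,N0,N0,N1), (2,N2,N1,N0,N0,N0), (3,N2,N1,N0,N0,N1), (- 1,N2,N1,N1,N0,N0), (-
    1,N2,N1,N1,N0,N1), (1,N2,N1,N1,N0,N2), (1,N2,N1,N1,N0,N3), (1,N2,N1,N2,N0,N0),
    (3,N2,N1,N2,N0,N1), (2,N2,N1,N3,N0,N1), (1,N2,N2,N0,N0,N0), (2,N2,N2,N0,N0,N1), (-
    7,N2,N2,N2,N0,N0), (4,N2,N2,N2,N0,N1), (1,N2,N3,N0,N0,N0), (1,N2,N3,N1,N0,N0), (-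
    1,N2,N3,N1,N0,N1), (- 6,N2,N3,N3,N0,N0), (3,N2,N3,N3,N0,N1), (- 3,N3,N0,N1,N0,N0), (-
    1,N3,N1,N0,N0,N0), (1,N3,N1,N0,N2,N0), (1,N3,N1,N0,N3,N0), (1,N3,N1,N1,N0,N0), (-
    1,N3,N1,N1,N1,N0), (- 7,N3,N2,N3,N1,N0), (2,N3,N3,N0,N0,N0), (1,N3,N3,N0,N2,N0),
    (1,N3,N3,N0,N3,N0), (2,N3,N3,N1,N0,N0), (1,N3,N3,N1,N2,N0), (1,N3,N3,N1,N3,N0), (-
    1,N3,N3,N3,N0,N0)], [(1,[N0,N1],[N0,N2],[N0,N1],[N0,N1]), (1,[N1,N3],[N0,N1],[N0,N2],[N0,N2]),
    (1,[N1,N3],[N0,N1],[N0,N2],[N0,N3]), (1,[N1,N3],[N0,N1],[N0,N3],[N0,N2]),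
    (1,[N1,N3],[N0,N1],[N0,N3],[N0,N3]), (3,[N1,N3],[N0,N3],[N0,N2],[N0,N1]),
    (3,[N1,N3],[N0,N3],[N0,N3],[N0,N1]), (6,[N0,N3],[N0,N2],[N0,N1],[N0,N1]),
    (4,[N1,N2],[N0,N2],[N0,N2],[N0,N1]), (4,[N1,N2],[N0,N2],[N0,N3],[N0,N1])]),
    ([(N0,N0,N0,N0), (N1,N0,N1,N1), (N2,N1,N2,N0), (N2,N2,N0,N1), (N2,N3,N0,N1), (N3,N0,N2,N1),
    (N3,N0,N3,N0), (N3,N1,N2,N0), (N3,N1,N2,N1)], 0, [(- 8,N0,N0,N0,N0,N1), (- 4,N0,N0,N0,N1,N0),
    (- 5,N0,N0,N0,N1,N1), (- 2,N0,N0,N0,N2,N0), (1,N0,N0,N0,N3,N0), (- 1,N0,N0,N1,N0,N0), (-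
    8,N0,N0,N1,N0,N1), (- 5,N0,N0,N1,N1,N0), (- 8,N0,N0,N1,N1,N1), (7,N0,N0,N1,N2,N0),
    (10,N1,N2,N0,N0,N1), (- 3,N1,N2,N0,N3,N0), (- 3,N1,N3,N0,N3,N1), (- 1,N2,N0,N0,N0,N0), (-
    7,N2,N0,N1,N0,N0), (- 4,N2,N1,N0,N0,N0), (- 3,N2,N1,N1,N0,N0), (4,N2,N2,N0,N0,N0),
    (2,N2,N2,N0,N0,N1), (5,N2,N2,N1,N0,N0), (2,N2,N2,N1,N0,N1), (4,N2,N3,N0,N0,N0),
    (5,N2,N3,N0,N0,N1), (5,N2,N3,N1,N0,N0), (8,N2,N3,N1,N0,N1), (- 3,N3,N0,N0,N1,N0),
    (2,N3,N1,N0,N0,N0), (2,N3,N1,N0,N2,N0), (2,N3,N1,N1,N0,N0), (2,N3,N1,N1,N2,N0),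
    (2,N3,N3,N0,N0,N0), (2,N3,N3,N0,N2,N0), (2,N3,N3,N1,N0,N0), (2,N3,N3,N1,N2,N0), (-
    3,N3,N3,N1,N3,N0)], [(2,[N2,N3],[N0,N1],[N0,N3],[N0,N1]), (2,[N1,N3],[N0,N1],[N0,N2],[N0,N2]),
    (2,[N1,N3],[N0,N1],[N0,N2],[N0,N3]), (2,[N1,N2],[N0,N1],[N0,N2],[N0,N1])]),
    ([(N0,N0,N0,N0), (N0,N0,N1,N1), (N0,N1,N1,N1), (N1,N0,N0,N1), (N1,N0,N1,N1), (N1,N1,N1,N0),
    (N2,N1,N3,N0), (N3,N0,N2,N0), (N3,N1,N2,N1), (N3,N2,N1,N0), (N3,N3,N1,N0)], 0,
    [(1,N0,N0,N0,N0,N1), (- 11,N0,N0,N0,N1,N0), (1,N0,N0,N0,N1,N1), (6,N0,N0,N0,N2,N0), (-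
    1,N0,N0,N0,N3,N0), (- 4,N0,N0,N1,N0,N0), (- 10,N0,N0,N1,N1,N0), (3,N0,N0,N1,N2,N1), (-
    1,N0,N0,N1,N3,N1), (- 8,N1,N0,N0,N0,N1), (- 5,N1,N1,N0,N0,N0), (- 3,N1,N2,N0,N2,N0),
    (11,N1,N3,N0,N1,N0), (- 1,N2,N0,N0,N0,N0), (1,N2,N0,N0,N0,N1), (- 2,N2,N0,N1,N0,N0),
    (2,N2,N0,N1,N0,N1), (- 2,N2,N1,N0,N0,N0), (2,N2,N1,N1,N0,N0), (- 13,N2,N1,N1,N0,N1),
    (2,N2,N2,N0,N0,N0), (- 1,N2,N2,N0,N0,N1), (10,N2,N2,N1,N0,N0), (1,N2,N3,N0,N0,N0),
    (1,N2,N3,N1,N0,N1), (3,N3,N1,N0,N0,N0), (2,N3,N1,N0,N2,N0), (1,N3,N1,N0,N3,N0),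
    (3,N3,N1,N1,N0,N0), (2,N3,N1,N1,N2,N0), (1,N3,N1,N1,N3,N0), (3,N3,N2,N0,N0,N0),
    (2,N3,N2,N0,N2,N0), (1,N3,N2,N0,N3,N0), (3,N3,N2,N1,N0,N0), (1,N3,N2,N1,N3,N0)],
    [(2,[N0,N1],[N0,N1],[N0,N2],[N0,N1]), (1,[N0,N1],[N0,N1],[N0,N3],[N0,N1]),
    (3,[N0,N2],[N0,N1],[N0,N2],[N0,N1]), (1,[N0,N3],[N0,N1],[N0,N1],[N0,N1]),
    (2,[N1,N2],[N0,N1],[N0,N2],[N0,N2]), (2,[N1,N2],[N0,N1],[N0,N2],[N0,N3]),
    (1,[N1,N2],[N0,N1],[N0,N3],[N0,N2]), (1,[N1,N2],[N0,N1],[N0,N3],[N0,N3])]),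
    ([(N2,N0,N2,N0), (N2,N1,N2,N0), (N2,N2,N0,N1), (N2,N2,N1,N1), (N3,N0,N2,N1), (N3,N1,N2,N1),
    (N3,N2,N0,N0), (N3,N2,N1,N0)], 1, [(- 1,N0,N0,N0,N0,N0), (- 1,N0,N0,N0,N0,N1), (-
    1,N0,N0,N0,N1,N0), (- 1,N0,N0,N0,N1,N1), (- 1,N0,N0,N1,N0,N0), (- 1,N0,N0,N1,N0,N1), (-
    1,N0,N0,N1,N1,N0), (- 1,N0,N0,N1,N1,N1), (1,N1,N2,N0,N0,N1), (1,N1,N2,N0,N1,N1), (-
    1,N1,N2,N0,N3,N0), (1,N1,N3,N0,N0,N0), (1,N1,N3,N0,N1,N0), (- 1,N1,N3,N0,N3,N1),
    (1,N2,N2,N0,N0,N0), (1,N2,N2,N1,N0,N0), (- 1,N2,N2,N3,N0,N1), (1,N2,N3,N0,N0,N1),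
    (1,N2,N3,N1,N0,N1), (- 1,N2,N3,N3,N0,N0)], []),
    ([(N0,N0,N1,N1), (N0,N1,N0,N1), (N0,N1,N1,N1), (N1,N0,N0,N1), (N1,N0,N1,N1), (N1,N1,N0,N1),
    (N1,N1,N1,N0), (N2,N2,N0,N0), (N2,N2,N1,N1), (N2,N3,N0,N1), (N2,N3,N1,N1), (N3,N2,N0,N1),
    (N3,N2,N1,N1), (N3,N3,N1,N0)], 1, [(- 2,N0,N0,N0,N1,N1), (- 2,N0,N0,N1,N0,N0), (-
    4,N0,N0,N1,N1,N1), (2,N0,N0,N2,N0,N0), (2,N0,N0,N2,N0,N1), (2,N0,N0,N2,N1,N0),
    (2,N0,N0,N2,N1,N1), (2,N0,N0,N3,N0,N1), (2,N0,N0,N3,N1,N0), (- 2,N1,N0,N0,N0,N1), (-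
    2,N1,N0,N0,N1,N0), (- 2,N1,N1,N0,N0,N0), (- 2,N1,N1,N0,N0,N1), (- 2,N1,N1,N0,N1,N0), (-
    2,N1,N1,N0,N1,N1), (2,N1,N2,N0,N0,N0), (4,N1,N2,N0,N1,N1), (2,N1,N3,N0,N1,N1), (-
    2,N2,N0,N1,N0,N0), (- 2,N2,N1,N0,N0,N0), (- 2,N2,N2,N3,N0,N0), (- 2,N2,N3,N2,N0,N0), (-
    2,N2,N3,N3,N0,N1), (- 1,N3,N0,N0,N0,N0), (1,N3,N0,N0,N1,N0), (1,N3,N0,N1,N0,N0),
    (1,N3,N0,N1,N1,N0), (1,N3,N1,N0,N0,N0), (1,N3,N1,N0,N1,N0), (1,N3,N1,N1,N0,N0),
    (1,N3,N1,N1,N1,N0)], [(1,[N0,N1],[N0,N1],[N0,N1],[N0,N2]),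
    (1,[N0,N1],[N0,N1],[N0,N1],[N0,N3]), (2,[N0,N2],[N0,N2],[N0,N1],[N0,N1])]),
    ([(N0,N0,N1,N1), (N1,N0,N0,N1), (N1,N0,N1,N0), (N1,N0,N1,N1), (N1,N1,N0,N1), (N1,N1,N1,N0),
    (N2,N0,N2,N0), (N2,N0,N3,N1), (N2,N1,N2,N0), (N2,N1,N3,N1), (N3,N0,N3,N0), (N3,N1,N2,N1)], 1,
    [(- 3,N0,N0,N0,N0,N0), (3,N0,N0,N0,N0,N1), (2,N0,N0,N0,N0,N2), (2,N0,N0,N0,N0,N3), (-
    10,N0,N0,N0,N1,N0), (4,N0,N0,N0,N2,N0), (7,N0,N0,N0,N3,N0), (3,N0,N0,N0,N3,N1), (-
    9,N0,N0,N1,N0,N0), (- 3,N0,N0,N1,N0,N1), (2,N0,N0,N1,N0,N2), (2,N0,N0,N1,N0,N3), (-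
    10,N0,N0,N1,N1,N0), (- 18,N0,N0,N1,N1,N1), (4,N0,N0,N1,N2,N0), (1,N0,N0,N1,N3,N0),
    (3,N0,N0,N1,N3,N1), (- 10,N1,N0,N0,N0,N1), (- 4,N1,N0,N0,N1,N0), (- 9,N1,N1,N0,N0,N0),
    (3,N1,N1,N0,N0,N1), (3,N1,N1,N0,N3,N0), (3,N1,N1,N0,N3,N1), (3,N1,N2,N0,N0,N0),
    (3,N1,N2,N0,N0,N1), (- 8,N1,N2,N0,N2,N1), (- 17,N1,N2,N0,N3,N0), (3,N1,N2,N0,N3,N1), (-
    10,N1,N3,N0,N2,N0), (- 4,N2,N0,N0,N0,N0), (- 4,N2,N0,N1,N0,N0), (2,N2,N1,N0,N0,N2),
    (2,N2,N1,N0,N0,N3), (- 6,N2,N1,N1,N0,N1), (2,N2,N1,N1,N0,N2), (2,N2,N1,N1,N0,N3),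
    (18,N2,N2,N0,N0,N0), (8,N2,N2,N0,N0,N1), (18,N2,N2,N1,N0,N0), (8,N2,N2,N1,N0,N1),
    (10,N2,N3,N0,N0,N0), (8,N2,N3,N1,N0,N0), (6,N2,N3,N1,N0,N1), (- 8,N3,N0,N0,N0,N0), (-
    2,N3,N0,N1,N0,N0), (- 2,N3,N1,N0,N1,N0), (- 2,N3,N1,N1,N1,N0), (2,N3,N2,N0,N3,N0),
    (2,N3,N2,N1,N3,N0), (2,N3,N3,N1,N2,N0), (- 6,N3,N3,N1,N3,N0)],
    [(8,[N0,N2],[N0,N1],[N0,N1],[N0,N1]), (2,[N1,N3],[N0,N1],[N0,N2],[N0,N2]),
    (2,[N1,N3],[N0,N1],[N0,N2],[N0,N3]), (3,[N0,N3],[N0,N1],[N0,N3],[N0,N1]),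
    (2,[N1,N2],[N0,N1],[N0,N3],[N0,N2]), (2,[N1,N2],[N0,N1],[N0,N3],[N0,N3]),
    (3,[N1,N2],[N0,N2],[N0,N3],[N0,N1]), (3,[N1,N2],[N0,N3],[N0,N3],[N0,N1])]),
    ([(N2,N0,N2,N1), (N2,N1,N3,N1), (N2,N3,N0,N0), (N2,N3,N0,N1), (N2,N3,N1,N1), (N3,N0,N2,N1),
    (N3,N0,N3,N0), (N3,N0,N3,N1), (N3,N1,N2,N0), (N3,N1,N2,N1), (N3,N2,N0,N1), (N3,N3,N1,N1)], 1,
    [(- 5,N0,N0,N0,N0,N1), (- 4,N0,N0,N0,N1,N0), (- 10,N0,N0,N0,N1,N1), (- 1,N0,N0,N0,N2,N0),
    (2,N0,N0,N0,N2,N1), (7,N0,N0,N0,N3,N0), (2,N0,N0,N0,N3,N1), (- 10,N0,N0,N1,N0,N0), (-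
    10,N0,N0,N1,N0,N1), (- 10,N0,N0,N1,N1,N0), (- 11,N0,N0,N1,N1,N1), (2,N0,N0,N1,N2,N0),
    (1,N0,N0,N2,N0,N0), (3,N0,N0,N2,N0,N1), (1,N0,N0,N2,N1,N0), (- 2,N0,N0,N2,N2,N1),
    (2,N0,N0,N3,N0,N0), (4,N0,N0,N3,N0,N1), (- 2,N0,N0,N3,N1,N0), (1,N0,N0,N3,N1,N1),
    (2,N0,N0,N3,N2,N0), (2,N0,N0,N3,N2,N1), (- 2,N0,N0,N3,N3,N0), (- 2,N1,N0,N0,N0,N1), (-
    1,N1,N0,N0,N1,N1), (2,N1,N0,N0,N3,N0), (- 2,N1,N1,N0,N0,N1), (- 1,N1,N1,N0,N1,N1),
    (2,N1,N1,N0,N3,N0), (6,N1,N2,N0,N0,N0), (6,N1,N2,N0,N0,N1), (4,N1,N2,N0,N1,N0),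
    (7,N1,N2,N0,N1,N1), (- 2,N1,N2,N0,N2,N1), (1,N1,N3,N0,N1,N1), (2,N1,N3,N0,N2,N1), (-
    7,N2,N0,N0,N0,N0), (- 2,N2,N0,N1,N0,N0), (2,N2,N0,N2,N0,N1), (- 7,N2,N1,N0,N0,N0), (-
    2,N2,N1,N1,N0,N0), (2,N2,N1,N2,N0,N1), (1,N2,N2,N0,N0,N0), (6,N2,N2,N0,N0,N1),
    (4,N2,N2,N1,N0,N1), (- 2,N2,N2,N2,N0,N1), (- 2,N2,N2,N3,N0,N0), (5,N2,N3,N0,N0,N0),
    (10,N2,N3,N0,N0,N1), (10,N2,N3,N1,N0,N0), (10,N2,N3,N1,N0,N1), (2,N2,N3,N3,N0,N0), (-
    4,N3,N2,N0,N3,N0), (- 2,N3,N2,N1,N2,N0), (- 2,N3,N2,N2,N1,N0), (- 10,N3,N3,N1,N3,N0)],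
    [(1,[N2,N3],[N0,N2],[N0,N1],[N0,N1]), (1,[N0,N2],[N0,N2],[N0,N1],[N0,N1]),
    (2,[N0,N2],[N0,N2],[N0,N3],[N0,N1]), (2,[N1,N3],[N0,N3],[N0,N2],[N0,N1]),
    (1,[N1,N2],[N0,N2],[N0,N1],[N0,N1]), (2,[N1,N2],[N0,N2],[N0,N3],[N0,N1]),
    (2,[N0,N3],[N0,N3],[N0,N2],[N0,N1])]),
    ([(N0,N0,N0,N0), (N0,N1,N1,N1), (N1,N0,N1,N0), (N1,N1,N0,N0), (N1,N1,N0,N1), (N2,N0,N3,N1),
    (N2,N2,N1,N1), (N2,N3,N0,N0), (N2,N3,N0,N1), (N2,N3,N1,N0), (N3,N0,N2,N0), (N3,N0,N3,N1),
    (N3,N1,N3,N1), (N3,N2,N0,N0), (N3,N3,N1,N0)], 1, [(2,N0,N0,N0,N1,N0), (- 4,N0,N0,N0,N1,N1),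
    (3,N0,N0,N0,N2,N0), (- 1,N0,N0,N0,N2,N1), (3,N0,N0,N0,N3,N0), (10,N0,N0,N0,N3,N1), (-
    6,N0,N0,N1,N0,N0), (- 4,N0,N0,N1,N0,N1), (- 4,N0,N0,N1,N1,N1), (4,N0,N0,N2,N0,N0),
    (3,N0,N0,N2,N0,N1), (3,N0,N0,N2,N1,N1), (4,N0,N0,N3,N0,N0), (7,N0,N0,N3,N0,N1),
    (16,N0,N0,N3,N1,N0), (- 4,N1,N0,N0,N0,N0), (- 7,N1,N0,N0,N0,N1), (- 16,N1,N0,N0,N1,N0), (-
    3,N1,N0,N0,N1,N1), (- 1,N1,N1,N0,N0,N0), (- 11,N1,N1,N0,N1,N0), (- 7,N1,N1,N0,N1,N1),
    (6,N1,N2,N0,N0,N0), (4,N1,N2,N0,N0,N1), (2,N1,N2,N0,N1,N1), (6,N1,N3,N0,N0,N0), (-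
    4,N1,N3,N0,N2,N1), (3,N1,N3,N0,N3,N1), (- 3,N2,N0,N0,N0,N0), (- 10,N2,N0,N0,N0,N1), (-
    1,N2,N0,N1,N0,N0), (- 3,N2,N1,N0,N0,N1), (3,N2,N1,N2,N0,N0), (3,N2,N1,N2,N0,N1),
    (4,N2,N2,N0,N0,N1), (3,N2,N2,N2,N0,N1), (1,N2,N3,N0,N0,N0), (5,N2,N3,N0,N0,N1),
    (4,N2,N3,N1,N0,N1), (- 3,N2,N3,N2,N0,N1), (1,N2,N3,N3,N0,N1), (- 6,N3,N0,N1,N0,N0),
    (1,N3,N1,N0,N1,N0), (- 6,N3,N1,N1,N1,N0), (1,N3,N1,N3,N0,N0), (1,N3,N1,N3,N1,N0), (-
    4,N3,N2,N2,N0,N0), (1,N3,N3,N0,N0,N0), (1,N3,N3,N0,N1,N0), (- 2,N3,N3,N3,N0,N0),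
    (1,N3,N3,N3,N1,N0)], [(2,[N1,N3],[N0,N3],[N0,N1],[N0,N1]),
    (1,[N1,N3],[N0,N3],[N0,N1],[N0,N2]), (1,[N1,N3],[N0,N3],[N0,N1],[N0,N3]),
    (4,[N1,N3],[N0,N3],[N0,N3],[N0,N1]), (3,[N1,N2],[N0,N2],[N0,N2],[N0,N1]),
    (3,[N1,N2],[N0,N2],[N0,N3],[N0,N1]), (2,[N1,N2],[N0,N3],[N0,N1],[N0,N1])]),
    ([(N0,N0,N0,N0), (N0,N1,N1,N1), (N1,N0,N1,N0), (N1,N1,N1,N0), (N2,N0,N2,N0), (N2,N0,N2,N1),
    (N2,N0,N3,N1), (N2,N1,N3,N0), (N2,N2,N1,N0), (N2,N2,N1,N1), (N2,N3,N0,N0), (N2,N3,N1,N1),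
    (N3,N0,N3,N0), (N3,N0,N3,N1), (N3,N1,N2,N1), (N3,N2,N0,N1), (N3,N3,N1,N1)], 1, [(-
    19,N0,N0,N0,N0,N1), (1,N0,N0,N0,N0,N2), (1,N0,N0,N0,N0,N3), (- 25,N0,N0,N0,N1,N0), (-
    43,N0,N0,N0,N1,N1), (5,N0,N0,N0,N2,N0), (5,N0,N0,N0,N2,N1), (16,N0,N0,N0,N3,N0),
    (17,N0,N0,N0,N3,N1), (- 21,N0,N0,N1,N0,N0), (- 34,N0,N0,N1,N0,N1), (- 1,N0,N0,N1,N1,N0), (-
    13,N0,N0,N1,N1,N1), (31,N0,N0,N1,N3,N0), (19,N0,N0,N2,N0,N1), (4,N0,N0,N2,N1,N0), (-
    22,N0,N0,N2,N2,N0), (- 22,N0,N0,N2,N2,N1), (1,N0,N0,N2,N3,N0), (18,N0,N0,N3,N0,N0),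
    (23,N0,N0,N3,N1,N1), (1,N0,N0,N3,N2,N0), (- 17,N1,N0,N0,N0,N0), (- 32,N1,N0,N0,N0,N1), (-
    40,N1,N0,N0,N1,N0), (- 22,N1,N0,N0,N1,N1), (1,N1,N0,N0,N3,N1), (- 17,N1,N1,N0,N0,N0), (-
    24,N1,N1,N0,N1,N1), (28,N1,N1,N0,N2,N0), (26,N1,N1,N0,N2,N1), (- 1,N1,N1,N0,N3,N1),
    (20,N1,N2,N0,N0,N0), (3,N1,N2,N0,N1,N1), (- 1,N1,N2,N0,N2,N0), (10,N1,N3,N0,N0,N0),
    (28,N1,N3,N0,N0,N1), (7,N1,N3,N0,N1,N1), (25,N1,N3,N0,N2,N0), (28,N1,N3,N0,N2,N1), (-
    4,N2,N0,N0,N0,N0), (- 6,N2,N0,N0,N0,N1), (- 28,N2,N0,N1,N0,N0), (22,N2,N0,N2,N0,N0),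
    (22,N2,N0,N2,N0,N1), (- 1,N2,N0,N3,N0,N1), (- 28,N2,N1,N1,N0,N0), (- 32,N2,N1,N1,N0,N1), (-
    2,N2,N1,N2,N0,N0), (1,N2,N1,N3,N0,N1), (8,N2,N2,N0,N0,N0), (43,N2,N2,N0,N0,N1),
    (1,N2,N2,N1,N0,N0), (23,N2,N2,N2,N0,N0), (20,N2,N2,N2,N0,N1), (30,N2,N3,N0,N0,N0),
    (27,N2,N3,N0,N0,N1), (- 25,N2,N3,N1,N0,N0), (6,N2,N3,N1,N0,N1), (1,N2,N3,N2,N0,N0), (-
    2,N2,N3,N2,N0,N1), (1,N3,N0,N0,N2,N0), (- 14,N3,N0,N2,N3,N0), (1,N3,N0,N3,N0,N0),
    (1,N3,N0,N3,N2,N0), (1,N3,N1,N0,N2,N0), (1,N3,N1,N3,N0,N0), (1,N3,N1,N3,N2,N0),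
    (1,N3,N2,N0,N0,N0), (2,N3,N2,N0,N3,N0), (- 14,N3,N2,N2,N0,N0), (2,N3,N2,N2,N3,N0),
    (1,N3,N3,N0,N0,N0), (- 28,N3,N3,N0,N2,N0), (2,N3,N3,N0,N3,N0), (- 6,N3,N3,N1,N3,N0),
    (2,N3,N3,N2,N0,N0), (2,N3,N3,N2,N3,N0)], [(3,[N0,N1],[N0,N1],[N0,N3],[N0,N1]),
    (3,[N2,N3],[N0,N2],[N0,N1],[N0,N1]), (2,[N2,N3],[N0,N2],[N0,N3],[N0,N2]),
    (2,[N2,N3],[N0,N2],[N0,N3],[N0,N3]), (1,[N0,N1],[N0,N3],[N0,N2],[N0,N2]),
    (1,[N0,N1],[N0,N3],[N0,N2],[N0,N3]), (2,[N1,N3],[N0,N2],[N0,N1],[N0,N1]),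
    (4,[N1,N3],[N0,N2],[N0,N2],[N0,N1]), (9,[N0,N2],[N0,N2],[N0,N3],[N0,N1]),
    (28,[N1,N3],[N0,N3],[N0,N2],[N0,N1]), (13,[N1,N2],[N0,N2],[N0,N3],[N0,N1])]),
    ([(N0,N0,N1,N1), (N1,N0,N1,N1), (N2,N2,N0,N1), (N2,N2,N1,N0), (N2,N3,N0,N1), (N2,N3,N1,N0),
    (N3,N0,N3,N0), (N3,N1,N2,N1)], 1, [(- 1,N0,N0,N0,N0,N0), (- 1,N0,N0,N0,N0,N1), (-
    1,N0,N0,N0,N1,N0), (- 1,N0,N0,N1,N0,N0), (- 1,N0,N0,N1,N0,N1), (- 1,N0,N0,N1,N1,N0), (-
    1,N0,N0,N1,N1,N1), (1,N1,N2,N0,N0,N1), (1,N1,N2,N0,N1,N0), (- 1,N1,N3,N0,N2,N0),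
    (1,N2,N3,N0,N0,N0), (1,N2,N3,N1,N0,N0), (1,N2,N3,N1,N0,N1), (- 1,N3,N3,N1,N3,N0)], []),
    ([(N0,N0,N1,N1), (N1,N0,N1,N0), (N1,N0,N1,N1), (N1,N1,N1,N0), (N2,N3,N0,N0), (N2,N3,N0,N1),
    (N3,N2,N0,N0), (N3,N2,N0,N1)], 1, [(- 1,N0,N0,N0,N0,N0), (- 1,N0,N0,N1,N0,N0), (-
    1,N0,N0,N1,N1,N1), (1,N0,N0,N2,N0,N1), (1,N0,N0,N3,N0,N1), (- 1,N1,N0,N0,N0,N1), (-
    1,N1,N0,N0,N1,N0), (- 1,N1,N1,N0,N0,N1), (1,N1,N2,N0,N0,N0), (1,N1,N3,N0,N0,N0), (-
    1,N3,N2,N2,N0,N0), (- 1,N3,N3,N3,N0,N0)], []),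
    ([(N2,N0,N2,N0), (N2,N2,N0,N1), (N2,N2,N1,N1), (N3,N0,N2,N0), (N3,N0,N2,N1), (N3,N0,N3,N1),
    (N3,N1,N2,N0), (N3,N1,N3,N0)], 1, [(- 1,N0,N0,N0,N0,N1), (- 1,N0,N0,N0,N1,N1),
    (1,N0,N0,N0,N2,N0), (- 1,N0,N0,N1,N0,N0), (- 1,N0,N0,N1,N0,N1), (- 1,N0,N0,N1,N1,N0), (-
    1,N0,N0,N1,N1,N1), (1,N1,N2,N0,N0,N1), (1,N1,N2,N0,N1,N1), (- 1,N2,N0,N0,N0,N0), (-
    1,N2,N1,N0,N0,N0), (- 1,N2,N2,N3,N0,N1), (1,N2,N3,N0,N0,N1), (1,N2,N3,N1,N0,N0)], []),
    ([(N0,N1,N1,N0), (N1,N1,N1,N0), (N2,N1,N3,N1), (N2,N2,N0,N1), (N2,N2,N1,N1), (N2,N3,N0,N0),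
    (N3,N0,N3,N0), (N3,N1,N2,N1), (N3,N1,N3,N1), (N3,N2,N1,N0)], 0, [(- 13,N0,N0,N0,N0,N0), (-
    23,N0,N0,N0,N0,N1), (2,N0,N0,N0,N0,N2), (2,N0,N0,N0,N0,N3), (- 13,N0,N0,N0,N1,N0), (-
    23,N0,N0,N0,N1,N1), (2,N0,N0,N0,N1,N2), (2,N0,N0,N0,N1,N3), (6,N0,N0,N0,N3,N0), (-
    36,N0,N0,N1,N0,N0), (- 36,N0,N0,N1,N0,N1), (- 4,N0,N0,N1,N1,N0), (- 36,N0,N0,N1,N1,N1),
    (1,N0,N0,N2,N0,N0), (13,N0,N0,N2,N0,N1), (13,N0,N0,N2,N1,N0), (13,N0,N0,N2,N1,N1),
    (4,N0,N0,N3,N0,N0), (2,N0,N0,N3,N0,N2), (2,N0,N0,N3,N0,N3), (4,N0,N0,N3,N1,N0),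
    (2,N0,N0,N3,N1,N2), (2,N0,N0,N3,N1,N3), (20,N1,N2,N0,N0,N0), (25,N1,N2,N0,N0,N1), (-
    2,N1,N2,N0,N1,N0), (25,N1,N2,N0,N1,N1), (- 5,N1,N2,N0,N2,N1), (- 6,N1,N2,N0,N3,N0),
    (5,N1,N2,N0,N3,N1), (4,N1,N3,N0,N0,N0), (4,N1,N3,N0,N1,N0), (2,N1,N3,N0,N2,N1),
    (2,N1,N3,N0,N3,N1), (- 6,N2,N0,N0,N0,N0), (- 6,N2,N1,N0,N0,N0), (5,N2,N2,N0,N0,N0),
    (6,N2,N2,N1,N0,N0), (11,N2,N2,N1,N0,N1), (- 11,N2,N2,N2,N0,N0), (- 23,N2,N2,N3,N0,N1),
    (15,N2,N3,N0,N0,N0), (3,N2,N3,N0,N0,N1), (36,N2,N3,N1,N0,N1), (5,N2,N3,N2,N0,N0), (-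
    13,N2,N3,N2,N0,N1), (2,N2,N3,N3,N0,N2), (2,N2,N3,N3,N0,N3), (3,N3,N2,N0,N0,N0), (-
    2,N3,N2,N0,N1,N0), (5,N3,N2,N0,N2,N0), (- 6,N3,N2,N1,N2,N0), (5,N3,N2,N2,N0,N0),
    (5,N3,N2,N2,N2,N0), (- 2,N3,N2,N3,N0,N0), (- 2,N3,N2,N3,N1,N0), (7,N3,N3,N0,N0,N0),
    (2,N3,N3,N0,N1,N0), (- 5,N3,N3,N0,N2,N0), (5,N3,N3,N2,N0,N0), (5,N3,N3,N2,N2,N0), (-
    2,N3,N3,N3,N2,N0), (- 2,N3,N3,N3,N3,N0)], [(13,[N0,N1],[N0,N2],[N0,N1],[N0,N1]),
    (5,[N2,N3],[N0,N2],[N0,N2],[N0,N2]), (5,[N2,N3],[N0,N2],[N0,N2],[N0,N3]),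
    (5,[N2,N3],[N0,N2],[N0,N3],[N0,N1]), (2,[N1,N3],[N0,N3],[N0,N1],[N0,N2]),
    (2,[N1,N3],[N0,N3],[N0,N1],[N0,N3]), (2,[N0,N3],[N0,N3],[N0,N1],[N0,N2]),
    (2,[N0,N3],[N0,N3],[N0,N1],[N0,N3])]),
    ([(N0,N0,N1,N1), (N1,N0,N1,N1), (N2,N1,N2,N1), (N2,N1,N3,N1), (N3,N2,N0,N1), (N3,N3,N0,N1)],
    0, [(- 3,N0,N0,N0,N0,N1), (- 3,N0,N0,N1,N0,N1), (- 3,N0,N0,N1,N1,N1), (- 1,N1,N0,N0,N0,N0), (-
    1,N1,N0,N0,N1,N0), (3,N1,N3,N0,N0,N1), (- 1,N2,N1,N0,N0,N0), (- 1,N2,N1,N1,N0,N0),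
    (3,N2,N2,N1,N0,N1), (1,N3,N0,N0,N0,N0), (1,N3,N0,N0,N1,N0), (1,N3,N0,N1,N0,N0),
    (1,N3,N0,N1,N1,N0), (1,N3,N1,N0,N0,N0), (1,N3,N1,N0,N1,N0), (1,N3,N1,N1,N0,N0),
    (1,N3,N1,N1,N1,N0)], [(1,[N0,N1],[N0,N1],[N0,N1],[N0,N2]),
    (1,[N0,N1],[N0,N1],[N0,N1],[N0,N3])]),
    ([(N0,N0,N1,N1), (N0,N1,N1,N0), (N1,N1,N0,N1), (N1,N1,N1,N0), (N2,N0,N3,N0), (N2,N1,N3,N1),
    (N2,N2,N0,N0), (N3,N1,N3,N1), (N3,N2,N0,N0), (N3,N2,N1,N1), (N3,N3,N0,N0)], 1, [(-
    26,N0,N0,N0,N0,N0), (- 28,N0,N0,N0,N1,N0), (12,N0,N0,N0,N2,N1), (2,N0,N0,N0,N3,N0), (-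
    36,N0,N0,N1,N0,N0), (- 6,N0,N0,N1,N0,N1), (2,N0,N0,N1,N1,N0), (- 22,N0,N0,N1,N1,N1),
    (14,N0,N0,N1,N3,N1), (8,N0,N0,N2,N0,N0), (8,N0,N0,N2,N0,N1), (6,N0,N0,N2,N1,N0),
    (8,N0,N0,N2,N1,N1), (- 2,N0,N0,N3,N1,N0), (- 16,N1,N0,N0,N0,N1), (2,N1,N0,N0,N1,N0),
    (2,N1,N1,N0,N1,N0), (16,N1,N2,N0,N0,N0), (- 4,N1,N2,N0,N0,N1), (- 2,N1,N2,N0,N1,N0), (-
    10,N1,N2,N0,N2,N1), (44,N1,N3,N0,N0,N0), (- 8,N1,N3,N0,N0,N1), (2,N1,N3,N0,N1,N1),
    (6,N1,N3,N0,N2,N0), (- 16,N1,N3,N0,N2,N1), (- 2,N1,N3,N0,N3,N0), (- 2,N2,N0,N0,N0,N0), (-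
    12,N2,N0,N0,N0,N1), (- 14,N2,N0,N1,N0,N1), (- 2,N2,N1,N0,N0,N0), (- 28,N2,N1,N0,N0,N1), (-
    14,N2,N1,N1,N0,N1), (26,N2,N2,N0,N0,N0), (16,N2,N2,N1,N0,N1), (- 4,N2,N2,N2,N0,N1),
    (22,N2,N3,N1,N0,N1), (- 6,N2,N3,N2,N0,N0), (2,N2,N3,N3,N0,N0), (- 2,N2,N3,N3,N0,N1),
    (10,N3,N2,N0,N0,N0), (- 4,N3,N2,N2,N1,N0), (4,N3,N2,N3,N0,N0), (10,N3,N2,N3,N2,N0),
    (10,N3,N3,N0,N0,N0), (10,N3,N3,N0,N2,N0), (10,N3,N3,N3,N0,N0), (10,N3,N3,N3,N2,N0)],
    [(6,[N2,N3],[N0,N1],[N0,N2],[N0,N1]), (8,[N0,N1],[N0,N2],[N0,N1],[N0,N1]),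
    (10,[N2,N3],[N0,N3],[N0,N2],[N0,N2]), (10,[N2,N3],[N0,N3],[N0,N2],[N0,N3]),
    (1,[N1,N3],[N0,N1],[N0,N1],[N0,N1]), (1,[N0,N3],[N0,N1],[N0,N1],[N0,N1])]),
    ([(N0,N0,N0,N0), (N0,N0,N1,N1), (N0,N1,N1,N1), (N1,N0,N1,N1), (N2,N0,N2,N0), (N2,N1,N2,N1),
    (N2,N3,N1,N0), (N3,N0,N2,N0), (N3,N1,N2,N1), (N3,N3,N1,N0)], 0, [(- 5,N0,N0,N0,N0,N1), (-
    1,N0,N0,N0,N1,N0), (5,N0,N0,N0,N2,N0), (- 1,N0,N0,N0,N3,N1), (- 2,N0,N0,N1,N0,N0), (-
    1,N0,N0,N1,N1,N1), (8,N0,N0,N1,N2,N1), (- 1,N0,N0,N1,N3,N0), (6,N0,N0,N3,N1,N0), (-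
    6,N1,N0,N0,N1,N0), (- 3,N1,N1,N0,N0,N0), (- 6,N1,N1,N0,N1,N0), (1,N1,N2,N0,N0,N0), (-
    1,N1,N2,N0,N0,N1), (2,N1,N2,N0,N3,N0), (1,N1,N2,N0,N3,N2), (1,N1,N2,N0,N3,N3),
    (2,N1,N3,N0,N0,N0), (1,N1,N3,N0,N0,N2), (1,N1,N3,N0,N0,N3), (1,N1,N3,N0,N3,N0), (-
    1,N1,N3,N0,N3,N1), (- 1,N2,N0,N0,N0,N0), (1,N2,N0,N0,N0,N1), (- 2,N2,N0,N1,N0,N0), (-
    4,N2,N0,N1,N0,N1), (- 1,N2,N1,N0,N0,N0), (1,N2,N1,N0,N0,N1), (1,N2,N1,N1,N0,N0), (-
    4,N2,N1,N1,N0,N1), (1,N2,N2,N0,N0,N0), (1,N2,N2,N1,N0,N1), (1,N2,N3,N0,N0,N0),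
    (1,N2,N3,N1,N0,N1), (- 3,N3,N1,N1,N1,N0), (2,N3,N2,N0,N0,N0), (1,N3,N2,N0,N3,N0), (-
    1,N3,N2,N1,N3,N0), (1,N3,N2,N2,N0,N0), (1,N3,N2,N3,N0,N0), (1,N3,N3,N0,N0,N0),
    (2,N3,N3,N0,N3,N0), (- 1,N3,N3,N1,N0,N0), (1,N3,N3,N2,N3,N0), (1,N3,N3,N3,N3,N0)],
    [(4,[N0,N1],[N0,N1],[N0,N2],[N0,N1]), (1,[N2,N3],[N0,N2],[N0,N3],[N0,N2]),
    (1,[N2,N3],[N0,N2],[N0,N3],[N0,N3]), (1,[N2,N3],[N0,N3],[N0,N3],[N0,N2]),
    (1,[N2,N3],[N0,N3],[N0,N3],[N0,N3])]),
    ([(N0,N0,N0,N0), (N0,N1,N1,N0), (N1,N1,N0,N1), (N1,N1,N1,N0), (N2,N2,N1,N1), (N2,N3,N1,N1),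
    (N3,N0,N2,N1), (N3,N0,N3,N1)], 1, [(- 1,N0,N0,N0,N0,N1), (- 1,N0,N0,N0,N1,N0), (-
    1,N0,N0,N0,N1,N1), (- 1,N0,N0,N1,N1,N1), (- 1,N1,N1,N0,N0,N0), (1,N1,N2,N0,N1,N1),
    (1,N2,N3,N0,N0,N1), (- 1,N3,N0,N1,N0,N0)], []),
    ([(N0,N0,N0,N0), (N1,N0,N0,N0), (N0,N1,N0,N0), (N1,N1,N0,N0), (N0,N0,N1,N0), (N1,N0,N1,N0),
    (N0,N1,N1,N0), (N1,N1,N1,N0)], 1, [(- 1,N1,N0,N0,N0,N1), (- 1,N1,N0,N0,N1,N1), (-
    1,N1,N1,N0,N0,N1), (- 1,N1,N1,N0,N1,N1)], []),
    ([(N0,N0,N0,N0), (N1,N0,N0,N0), (N0,N1,N0,N0), (N1,N1,N0,N0), (N0,N0,N1,N0), (N1,N0,N1,N0),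
    (N0,N1,N1,N0), (N0,N0,N0,N1)], 1, [(- 1,N0,N0,N1,N0,N1), (- 1,N1,N0,N0,N1,N1), (-
    1,N2,N1,N0,N0,N1), (- 1,N3,N1,N1,N1,N0)], []),
    ([(N0,N0,N0,N0), (N1,N0,N0,N0), (N0,N1,N0,N0), (N1,N1,N0,N0), (N0,N0,N1,N0), (N1,N0,N1,N0),
    (N0,N0,N0,N1), (N1,N0,N0,N1)], 1, [(- 1,N0,N0,N1,N0,N1), (- 1,N0,N0,N1,N1,N0), (-
    1,N1,N0,N0,N1,N1), (- 1,N1,N1,N0,N1,N1)], []),
    ([(N0,N0,N0,N0), (N1,N0,N0,N0), (N0,N1,N0,N0), (N1,N1,N0,N0), (N0,N0,N1,N0), (N1,N1,N1,N0),
    (N1,N0,N0,N1), (N0,N1,N0,N1)], 1, [(- 1,N2,N0,N0,N0,N1), (- 1,N2,N1,N1,N0,N1), (-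
    1,N3,N0,N1,N1,N0), (- 1,N3,N1,N0,N1,N0)], []),
    ([(N0,N0,N0,N0), (N1,N0,N0,N0), (N0,N1,N1,N0), (N1,N1,N1,N0), (N0,N1,N0,N1), (N1,N1,N0,N1),
    (N0,N0,N1,N1), (N1,N0,N1,N1)], 1, [(- 1,N0,N0,N0,N0,N1), (- 1,N0,N0,N0,N1,N0), (-
    1,N0,N0,N1,N0,N0), (- 1,N0,N0,N1,N1,N1)], [])]"

text \<open>The last item is the empty pattern. Its split yields the antipodal zeros (N1,N1,N0,N0)
  and (N0,N0,N1,N1); the relabelling in the second leaf, which exchanges the coordinates
  \<open>N1\<close> and \<open>N2\<close>, reduces the second zero to the first.\<close>

definition derivation :: "(v quad list \<times> tree) list" where
  "derivation = [
    ([(N0,N1,N0,N0), (N1,N1,N0,N0), (N1,N0,N1,N0), (N0,N0,N0,N1), (N1,N0,N0,N1), (N1,N1,N0,N1),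
    (N0,N1,N1,N1), (N1,N1,N1,N1), (N2,N2,N0,N0), (N2,N3,N0,N0), (N2,N2,N1,N0), (N3,N3,N1,N0),
    (N3,N2,N0,N1), (N2,N2,N1,N1), (N2,N0,N3,N0), (N3,N1,N3,N1)], Split (N3,N0,N2,N0) (Cut 2
    (N0,N1,N2,N3) ((N0,N2),(N1,N2),(N0,N3),(N0,N2))) (Split (N3,N0,N3,N0) (Cut 15 (N2,N0,N1,N3)
    ((N2,N1),(N2,N0),(N0,N3),(N1,N2))) (Split (N3,N1,N2,N0) (Cut 16 (N2,N0,N1,N3)
    ((N3,N0),(N2,N1),(N1,N3),(N0,N2))) (Cut 2 (N0,N2,N1,N3) ((N0,N2),(N1,N3),(N1,N3),(N1,N2)))))),
    ([(N0,N1,N0,N0), (N1,N1,N0,N0), (N0,N0,N0,N1), (N1,N0,N0,N1), (N1,N1,N0,N1), (N0,N1,N1,N1),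
    (N1,N1,N1,N1), (N2,N2,N0,N0), (N2,N2,N1,N0), (N3,N3,N1,N0), (N3,N2,N0,N1), (N2,N2,N1,N1),
    (N3,N2,N1,N1), (N2,N0,N3,N0), (N3,N1,N3,N1)], Split (N3,N0,N3,N0) (Cut 15 (N2,N0,N1,N3)
    ((N2,N1),(N2,N0),(N0,N3),(N1,N2))) (Split (N2,N1,N3,N1) (Cut 16 (N0,N1,N2,N3)
    ((N0,N3),(N0,N2),(N1,N2),(N0,N2))) (Cut 5 (N1,N2,N0,N3) ((N3,N0),(N0,N2),(N2,N0),(N0,N2))))),
    ([(N0,N1,N0,N0), (N1,N1,N0,N0), (N1,N0,N1,N0), (N0,N0,N0,N1), (N1,N0,N0,N1), (N1,N1,N0,N1),
    (N0,N1,N1,N1), (N1,N1,N1,N1), (N2,N2,N0,N0), (N2,N2,N1,N0), (N3,N3,N1,N0), (N3,N2,N0,N1),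
    (N2,N3,N0,N1), (N2,N2,N1,N1)], Split (N2,N3,N0,N0) (Split (N3,N2,N0,N0) (Cut 3 (N2,N1,N0,N3)
    ((N2,N0),(N0,N3),(N2,N1),(N1,N2))) (Split (N3,N1,N3,N1) (Split (N3,N1,N2,N1) (Cut 17
    (N0,N2,N1,N3) ((N0,N2),(N1,N2),(N0,N2),(N0,N2))) (Ref 0 (N0,N1,N2,N3)
    ((N0,N2),(N0,N2),(N0,N2),(N0,N2)))) (Split (N2,N0,N3,N0) (Cut 2 (N1,N2,N0,N3)
    ((N3,N1),(N0,N3),(N2,N0),(N1,N2))) (Ref 0 (N0,N1,N2,N3) ((N0,N2),(N0,N2),(N0,N3),(N0,N2))))))
    (Split (N2,N0,N3,N0) (Split (N2,N0,N2,N0) (Cut 2 (N1,N2,N0,N3)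
    ((N3,N1),(N0,N3),(N2,N0),(N1,N2))) (Ref 1 (N0,N1,N2,N3) ((N0,N2),(N0,N2),(N0,N2),(N0,N2))))
    (Split (N3,N1,N3,N1) (Cut 13 (N1,N2,N0,N3) ((N3,N0),(N0,N2),(N2,N0),(N0,N2))) (Ref 1
    (N0,N1,N2,N3) ((N0,N2),(N0,N2),(N0,N3),(N0,N2)))))),
    ([(N3,N2,N0,N0), (N3,N3,N0,N0), (N3,N3,N1,N0), (N3,N2,N0,N1), (N2,N3,N0,N1), (N3,N3,N0,N1),
    (N3,N3,N1,N1)], Split (N2,N3,N0,N0) (Cut 23 (N1,N2,N3,N0) ((N3,N0),(N3,N0),(N0,N2),(N0,N2)))
    (Cut 22 (N3,N0,N1,N2) ((N3,N0),(N3,N0),(N0,N2),(N1,N2)))),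
    ([(N3,N3,N0,N0), (N3,N3,N1,N0), (N3,N2,N0,N1), (N2,N3,N0,N1), (N3,N3,N0,N1), (N3,N3,N1,N1)],
    Split (N3,N2,N0,N0) (Ref 3 (N0,N1,N2,N3) ((N0,N2),(N0,N2),(N0,N2),(N0,N2))) (Split
    (N3,N2,N1,N1) (Cut 23 (N1,N2,N0,N3) ((N3,N0),(N3,N0),(N0,N2),(N1,N2))) (Cut 22 (N0,N3,N1,N2)
    ((N3,N0),(N3,N0),(N0,N2),(N1,N2))))),
    ([(N0,N1,N0,N0), (N1,N1,N0,N0), (N0,N1,N1,N1), (N1,N1,N1,N1), (N3,N3,N1,N0), (N3,N2,N0,N1),
    (N2,N3,N0,N1), (N3,N3,N0,N1), (N3,N3,N1,N1)], Split (N2,N2,N1,N1) (Cut 1 (N0,N1,N2,N3)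
    ((N0,N3),(N0,N2),(N1,N2),(N0,N2))) (Ref 4 (N0,N1,N2,N3) ((N0,N2),(N0,N2),(N0,N2),(N0,N2)))),
    ([(N0,N1,N0,N0), (N1,N1,N0,N0), (N0,N0,N0,N1), (N1,N0,N0,N1), (N1,N1,N0,N1), (N0,N1,N1,N1),
    (N1,N1,N1,N1), (N3,N3,N1,N0), (N3,N2,N0,N1), (N2,N3,N0,N1), (N3,N3,N0,N1), (N2,N2,N1,N1),
    (N3,N1,N2,N0), (N2,N0,N2,N1)], Split (N3,N0,N3,N0) (Cut 13 (N1,N0,N2,N3)
    ((N3,N0),(N2,N1),(N1,N2),(N0,N2))) (Split (N2,N0,N3,N0) (Cut 16 (N0,N2,N1,N3)
    ((N0,N2),(N0,N2),(N1,N2),(N0,N2))) (Split (N3,N1,N3,N1) (Cut 13 (N1,N2,N0,N3)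
    ((N3,N0),(N0,N2),(N2,N0),(N0,N2))) (Split (N3,N0,N2,N0) (Cut 15 (N2,N0,N1,N3)
    ((N2,N1),(N2,N0),(N0,N2),(N1,N2))) (Cut 2 (N0,N2,N1,N3) ((N0,N2),(N1,N3),(N1,N2),(N1,N2))))))),
    ([(N0,N1,N0,N0), (N1,N1,N0,N0), (N1,N0,N1,N0), (N0,N0,N0,N1), (N1,N0,N0,N1), (N1,N1,N0,N1),
    (N0,N1,N1,N1), (N1,N1,N1,N1), (N3,N3,N1,N0), (N3,N2,N0,N1), (N2,N3,N0,N1), (N3,N3,N0,N1)],
    Split (N3,N3,N1,N1) (Ref 5 (N0,N1,N2,N3) ((N0,N2),(N0,N2),(N0,N2),(N0,N2))) (Split
    (N3,N3,N0,N0) (Cut 1 (N0,N1,N3,N2) ((N0,N3),(N0,N2),(N1,N2),(N0,N2))) (Split (N2,N0,N2,N1)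
    (Split (N2,N0,N3,N1) (Cut 17 (N0,N1,N2,N3) ((N0,N2),(N1,N2),(N0,N2),(N0,N2))) (Ref 6
    (N0,N1,N2,N3) ((N0,N2),(N0,N2),(N0,N2),(N0,N2)))) (Split (N3,N1,N2,N0) (Cut 16 (N2,N1,N0,N3)
    ((N2,N0),(N0,N3),(N2,N0),(N0,N2))) (Ref 6 (N0,N1,N2,N3) ((N0,N2),(N0,N2),(N0,N3),(N0,N2))))))),
    ([(N0,N1,N0,N0), (N1,N1,N0,N0), (N1,N0,N1,N0), (N0,N0,N0,N1), (N1,N0,N0,N1), (N1,N1,N0,N1),
    (N0,N1,N1,N1), (N1,N1,N1,N1), (N3,N3,N1,N0), (N3,N2,N0,N1), (N3,N3,N0,N1)], Split
    (N3,N2,N1,N0) (Cut 7 (N1,N2,N0,N3) ((N0,N3),(N2,N1),(N2,N0),(N0,N2))) (Ref 7 (N0,N1,N2,N3)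
    ((N0,N2),(N0,N2),(N0,N2),(N0,N2)))),
    ([(N0,N1,N0,N0), (N1,N1,N0,N0), (N1,N0,N1,N0), (N0,N0,N0,N1), (N1,N0,N0,N1), (N1,N1,N0,N1),
    (N0,N1,N1,N1), (N1,N1,N1,N1), (N3,N3,N1,N0)], Split (N2,N3,N1,N0) (Cut 15 (N2,N1,N0,N3)
    ((N2,N1),(N1,N3),(N2,N1),(N1,N2))) (Split (N2,N2,N1,N0) (Split (N2,N2,N1,N1) (Split
    (N3,N3,N1,N1) (Cut 14 (N1,N0,N2,N3) ((N1,N3),(N0,N2),(N1,N2),(N0,N2))) (Split (N3,N2,N1,N0)
    (Cut 0 (N0,N2,N3,N1) ((N0,N2),(N1,N3),(N0,N2),(N0,N2))) (Ref 2 (N0,N1,N2,N3)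
    ((N0,N2),(N0,N2),(N0,N2),(N0,N2))))) (Split (N2,N2,N0,N0) (Cut 14 (N0,N1,N3,N2)
    ((N0,N3),(N1,N2),(N0,N2),(N0,N2))) (Split (N3,N2,N1,N0) (Cut 15 (N2,N1,N0,N3)
    ((N2,N1),(N1,N2),(N2,N1),(N1,N2))) (Ref 2 (N0,N1,N2,N3) ((N0,N3),(N0,N3),(N0,N2),(N0,N2))))))
    (Ref 8 (N0,N1,N2,N3) ((N0,N2),(N0,N2),(N0,N2),(N0,N2))))),
    ([(N3,N2,N0,N0), (N2,N3,N0,N0), (N3,N3,N0,N0), (N2,N2,N0,N1), (N3,N2,N0,N1), (N2,N3,N0,N1),
    (N3,N3,N0,N1)], Split (N3,N3,N1,N1) (Cut 22 (N0,N1,N3,N2) ((N3,N0),(N3,N0),(N0,N2),(N1,N2)))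
    (Cut 21 (N0,N1,N3,N2) ((N2,N0),(N2,N0),(N0,N2),(N0,N2)))),
    ([(N3,N2,N0,N0), (N2,N2,N0,N1), (N3,N2,N0,N1), (N2,N3,N0,N1), (N3,N3,N0,N1), (N2,N2,N1,N1),
    (N3,N3,N1,N1)], Split (N3,N2,N1,N1) (Cut 22 (N0,N1,N2,N3) ((N3,N0),(N2,N0),(N0,N2),(N1,N2)))
    (Cut 24 (N0,N1,N2,N3) ((N2,N0),(N2,N0),(N0,N2),(N1,N2)))),
    ([(N3,N2,N0,N0), (N2,N2,N0,N1), (N3,N2,N0,N1), (N2,N3,N0,N1), (N3,N3,N0,N1), (N2,N2,N1,N1)],
    Split (N3,N3,N1,N1) (Ref 11 (N0,N1,N2,N3) ((N0,N2),(N0,N2),(N0,N2),(N0,N2))) (Ref 4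
    (N2,N1,N0,N3) ((N2,N0),(N0,N3),(N2,N1),(N0,N2)))),
    ([(N3,N2,N0,N0), (N2,N2,N0,N1), (N3,N2,N0,N1), (N2,N3,N0,N1), (N3,N3,N0,N1)], Split
    (N3,N3,N0,N0) (Split (N2,N3,N0,N0) (Ref 10 (N0,N1,N2,N3) ((N0,N2),(N0,N2),(N0,N2),(N0,N2)))
    (Split (N2,N2,N0,N0) (Cut 22 (N0,N1,N3,N2) ((N3,N0),(N2,N0),(N0,N2),(N1,N2))) (Cut 23
    (N1,N0,N2,N3) ((N3,N0),(N2,N0),(N0,N2),(N1,N2))))) (Ref 12 (N0,N1,N2,N3)
    ((N0,N2),(N0,N2),(N0,N2),(N0,N2)))),
    ([(N2,N2,N0,N1), (N3,N2,N0,N1), (N2,N3,N0,N1), (N3,N3,N0,N1), (N2,N2,N1,N1), (N2,N3,N1,N1),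
    (N3,N3,N1,N1)], Split (N2,N3,N0,N0) (Cut 22 (N0,N1,N2,N3) ((N2,N0),(N3,N0),(N0,N2),(N1,N2)))
    (Cut 21 (N0,N1,N2,N3) ((N2,N0),(N2,N0),(N0,N2),(N1,N2)))),
    ([(N2,N2,N0,N1), (N3,N2,N0,N1), (N2,N3,N0,N1), (N3,N3,N0,N1), (N2,N3,N1,N1)], Split
    (N2,N2,N1,N1) (Split (N2,N2,N0,N0) (Ref 13 (N0,N1,N2,N3) ((N0,N3),(N0,N2),(N0,N2),(N0,N2)))
    (Ref 14 (N0,N1,N2,N3) ((N0,N2),(N0,N2),(N0,N2),(N0,N2)))) (Ref 12 (N0,N1,N2,N3)
    ((N0,N2),(N0,N3),(N0,N2),(N0,N2)))),
    ([(N2,N2,N0,N1), (N3,N2,N0,N1), (N2,N3,N0,N1), (N3,N3,N0,N1)], Split (N3,N2,N0,N0) (Ref 13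
    (N0,N1,N2,N3) ((N0,N2),(N0,N2),(N0,N2),(N0,N2))) (Ref 15 (N0,N1,N2,N3)
    ((N0,N2),(N0,N2),(N0,N2),(N0,N2)))),
    ([(N0,N1,N0,N0), (N1,N1,N0,N0), (N1,N0,N1,N0), (N0,N0,N0,N1), (N1,N0,N0,N1), (N1,N1,N0,N1),
    (N0,N1,N1,N1), (N1,N1,N1,N1)], Split (N3,N3,N1,N0) (Ref 9 (N0,N1,N2,N3)
    ((N0,N2),(N0,N2),(N0,N2),(N0,N2))) (Split (N3,N2,N1,N0) (Ref 9 (N0,N1,N2,N3)
    ((N0,N2),(N0,N3),(N0,N2),(N0,N2))) (Split (N2,N3,N1,N0) (Ref 8 (N0,N1,N2,N3)
    ((N0,N3),(N0,N2),(N0,N2),(N0,N2))) (Split (N3,N3,N0,N1) (Ref 16 (N0,N1,N2,N3)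
    ((N0,N2),(N0,N2),(N0,N2),(N0,N2))) (Ref 7 (N0,N1,N2,N3) ((N0,N3),(N0,N3),(N0,N2),(N0,N2))))))),
    ([(N0,N1,N0,N0), (N1,N1,N0,N0), (N0,N0,N0,N1), (N1,N0,N0,N1), (N1,N1,N0,N1), (N0,N1,N1,N1),
    (N1,N1,N1,N1)], Split (N0,N1,N0,N1) (Cut 23 (N0,N1,N2,N3) ((N0,N2),(N1,N2),(N0,N2),(N1,N2)))
    (Ref 17 (N0,N1,N2,N3) ((N0,N2),(N0,N2),(N0,N2),(N0,N2)))),
    ([(N0,N1,N0,N0), (N1,N1,N0,N0), (N1,N0,N1,N0), (N0,N0,N0,N1), (N1,N1,N0,N1), (N0,N1,N1,N1),
    (N1,N1,N1,N1), (N3,N2,N0,N0), (N3,N3,N0,N0), (N2,N2,N1,N0), (N2,N3,N1,N0), (N3,N3,N1,N0),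
    (N2,N3,N0,N1), (N3,N0,N2,N0), (N2,N1,N2,N1)], Split (N2,N0,N3,N1) (Cut 2 (N1,N0,N2,N3)
    ((N3,N1),(N2,N1),(N1,N2),(N1,N2))) (Split (N3,N0,N3,N1) (Cut 16 (N0,N2,N1,N3)
    ((N0,N3),(N0,N2),(N0,N2),(N1,N2))) (Split (N2,N1,N3,N0) (Cut 20 (N0,N2,N1,N3)
    ((N0,N2),(N0,N2),(N0,N2),(N1,N2))) (Split (N3,N1,N3,N0) (Cut 2 (N0,N2,N1,N3)
    ((N0,N3),(N1,N3),(N0,N2),(N0,N2))) (Split (N3,N1,N2,N1) (Cut 18 (N0,N1,N2,N3)
    ((N0,N3),(N0,N3),(N1,N3),(N0,N2))) (Cut 5 (N1,N0,N2,N3)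
    ((N2,N0),(N2,N1),(N1,N2),(N0,N2)))))))),
    ([(N0,N1,N1,N1), (N1,N1,N1,N1), (N2,N2,N1,N0), (N2,N3,N1,N0), (N3,N3,N1,N0), (N2,N3,N0,N1),
    (N3,N1,N2,N0), (N3,N0,N3,N0), (N3,N1,N3,N0), (N2,N1,N3,N1)], Split (N3,N0,N2,N1) (Cut 16
    (N0,N2,N1,N3) ((N0,N3),(N0,N2),(N0,N3),(N1,N2))) (Split (N3,N0,N3,N1) (Cut 2 (N0,N2,N1,N3)
    ((N0,N3),(N1,N3),(N0,N3),(N0,N2))) (Ref 12 (N0,N2,N1,N3) ((N0,N3),(N1,N2),(N0,N3),(N1,N2))))),
    ([(N1,N1,N0,N0), (N1,N1,N0,N1), (N0,N1,N1,N1), (N1,N1,N1,N1), (N2,N2,N1,N0), (N2,N3,N1,N0),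
    (N3,N3,N1,N0), (N2,N3,N0,N1), (N2,N2,N1,N1), (N3,N2,N1,N1), (N3,N0,N3,N0), (N2,N1,N3,N1)],
    Split (N2,N0,N2,N1) (Cut 2 (N1,N0,N2,N3) ((N3,N1),(N2,N1),(N1,N3),(N1,N2))) (Split
    (N2,N0,N3,N1) (Cut 1 (N3,N0,N1,N2) ((N3,N0),(N0,N2),(N2,N0),(N1,N2))) (Ref 20 (N0,N1,N2,N3)
    ((N0,N2),(N0,N2),(N0,N2),(N0,N2))))),
    ([(N0,N1,N0,N0), (N1,N1,N0,N0), (N0,N1,N1,N0), (N0,N0,N0,N1), (N1,N1,N0,N1), (N0,N1,N1,N1),
    (N1,N1,N1,N1), (N2,N2,N1,N0), (N2,N3,N1,N0), (N3,N3,N1,N0), (N2,N3,N0,N1), (N2,N2,N1,N1),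
    (N3,N2,N1,N1)], Split (N3,N0,N3,N0) (Split (N3,N0,N2,N0) (Cut 17 (N0,N2,N1,N3)
    ((N0,N2),(N0,N2),(N0,N2),(N1,N2))) (Ref 21 (N0,N1,N2,N3) ((N0,N2),(N0,N2),(N0,N2),(N0,N2))))
    (Split (N2,N1,N3,N1) (Cut 16 (N2,N1,N0,N3) ((N3,N1),(N0,N3),(N2,N1),(N1,N2))) (Ref 21
    (N0,N1,N2,N3) ((N0,N2),(N0,N2),(N0,N3),(N0,N2))))),
    ([(N0,N1,N0,N0), (N1,N1,N0,N0), (N1,N0,N1,N0), (N0,N1,N1,N0), (N0,N0,N0,N1), (N1,N1,N0,N1),
    (N0,N1,N1,N1), (N1,N1,N1,N1), (N2,N2,N1,N0), (N2,N3,N1,N0), (N3,N3,N1,N0), (N2,N3,N0,N1)],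
    Split (N2,N3,N0,N0) (Ref 5 (N0,N1,N2,N3) ((N0,N3),(N0,N2),(N1,N2),(N1,N2))) (Split
    (N2,N3,N1,N1) (Cut 1 (N0,N1,N3,N2) ((N0,N2),(N0,N2),(N0,N2),(N1,N2))) (Split (N3,N3,N0,N0)
    (Split (N3,N0,N2,N0) (Split (N3,N0,N3,N0) (Cut 17 (N0,N2,N1,N3)
    ((N0,N2),(N0,N2),(N0,N2),(N1,N2))) (Ref 19 (N0,N1,N2,N3) ((N0,N2),(N0,N2),(N0,N2),(N0,N2))))
    (Split (N2,N1,N2,N1) (Cut 16 (N2,N1,N0,N3) ((N3,N1),(N0,N3),(N2,N1),(N1,N2))) (Ref 19
    (N0,N1,N2,N3) ((N0,N2),(N0,N2),(N0,N3),(N0,N2))))) (Ref 22 (N0,N1,N2,N3)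
    ((N0,N2),(N0,N2),(N0,N2),(N0,N2)))))),
    ([(N1,N0,N1,N0), (N0,N0,N0,N1), (N3,N2,N0,N0), (N3,N2,N1,N0), (N3,N2,N1,N1), (N3,N3,N1,N1),
    (N2,N0,N2,N0), (N2,N1,N3,N0), (N2,N1,N3,N1)], Split (N2,N0,N2,N1) (Cut 14 (N2,N0,N1,N3)
    ((N2,N0),(N3,N1),(N1,N2),(N0,N2))) (Split (N2,N0,N3,N1) (Cut 5 (N0,N1,N2,N3)
    ((N1,N3),(N0,N2),(N1,N3),(N0,N2))) (Cut 2 (N2,N0,N1,N3) ((N3,N0),(N2,N1),(N0,N3),(N0,N2))))),
    ([(N0,N1,N0,N0), (N1,N1,N0,N0), (N1,N0,N1,N0), (N0,N1,N1,N0), (N0,N0,N0,N1), (N1,N1,N0,N1),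
    (N0,N1,N1,N1), (N1,N1,N1,N1), (N3,N2,N0,N0), (N3,N3,N0,N0), (N3,N2,N1,N0), (N2,N3,N1,N0),
    (N2,N2,N0,N1), (N3,N3,N0,N1), (N3,N2,N1,N1), (N3,N3,N1,N1), (N3,N0,N3,N0)], Split
    (N3,N0,N2,N0) (Cut 20 (N2,N0,N1,N3) ((N2,N0),(N2,N0),(N0,N2),(N1,N2))) (Split (N3,N0,N2,N1)
    (Split (N3,N1,N2,N1) (Cut 12 (N2,N1,N0,N3) ((N2,N1),(N1,N3),(N3,N0),(N1,N2))) (Split
    (N3,N0,N3,N1) (Cut 14 (N1,N2,N0,N3) ((N3,N0),(N1,N2),(N2,N0),(N0,N2))) (Split (N2,N0,N3,N1)
    (Cut 5 (N0,N1,N2,N3) ((N0,N3),(N1,N2),(N1,N3),(N0,N2))) (Cut 12 (N1,N2,N0,N3)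
    ((N3,N0),(N0,N2),(N3,N1),(N0,N2)))))) (Split (N2,N0,N2,N0) (Ref 24 (N0,N1,N2,N3)
    ((N0,N2),(N0,N2),(N0,N2),(N0,N2))) (Split (N2,N1,N2,N0) (Cut 20 (N0,N2,N1,N3)
    ((N0,N2),(N0,N2),(N0,N2),(N1,N2))) (Split (N3,N1,N2,N1) (Cut 2 (N0,N2,N1,N3)
    ((N0,N3),(N1,N3),(N1,N3),(N1,N2))) (Split (N2,N0,N2,N1) (Cut 5 (N0,N1,N2,N3)
    ((N0,N3),(N0,N2),(N0,N3),(N1,N2))) (Split (N3,N1,N2,N0) (Cut 2 (N0,N2,N1,N3)
    ((N0,N3),(N1,N2),(N0,N3),(N0,N2))) (Cut 21 (N0,N1,N3,N2)
    ((N2,N0),(N0,N2),(N3,N0),(N0,N2)))))))))),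
    ([(N0,N1,N0,N0), (N1,N1,N0,N0), (N1,N0,N1,N0), (N0,N1,N1,N0), (N0,N0,N0,N1), (N1,N1,N0,N1),
    (N0,N1,N1,N1), (N1,N1,N1,N1), (N3,N2,N1,N0), (N2,N3,N1,N0), (N2,N2,N0,N1), (N3,N3,N0,N1),
    (N3,N2,N1,N1), (N3,N3,N1,N1)], Split (N2,N3,N1,N1) (Cut 3 (N2,N1,N0,N3)
    ((N3,N1),(N0,N2),(N2,N0),(N0,N2))) (Split (N2,N2,N1,N1) (Cut 3 (N2,N1,N3,N0)
    ((N3,N0),(N0,N3),(N0,N2),(N2,N0))) (Split (N3,N0,N3,N0) (Ref 25 (N0,N1,N2,N3)
    ((N0,N2),(N0,N2),(N0,N2),(N0,N2))) (Ref 25 (N1,N0,N2,N3) ((N2,N1),(N3,N0),(N1,N3),(N1,N2)))))),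
    ([(N0,N1,N1,N1), (N1,N1,N1,N1), (N2,N3,N0,N0), (N2,N3,N1,N0), (N2,N2,N0,N1), (N3,N3,N1,N1),
    (N3,N0,N2,N0), (N3,N1,N2,N0), (N3,N1,N3,N0), (N2,N1,N2,N1)], Split (N3,N0,N2,N1) (Cut 2
    (N0,N2,N1,N3) ((N0,N3),(N1,N2),(N0,N2),(N0,N2))) (Split (N3,N0,N3,N1) (Cut 16 (N0,N1,N2,N3)
    ((N0,N2),(N0,N3),(N0,N2),(N1,N2))) (Ref 12 (N0,N2,N1,N3) ((N0,N3),(N1,N2),(N0,N2),(N1,N2))))),
    ([(N0,N1,N1,N1), (N1,N1,N1,N1), (N2,N3,N0,N0), (N2,N3,N1,N0), (N2,N2,N0,N1), (N3,N3,N0,N1),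
    (N3,N3,N1,N1), (N3,N0,N2,N0), (N3,N1,N2,N0), (N2,N1,N2,N1)], Split (N2,N0,N2,N1) (Cut 7
    (N0,N2,N1,N3) ((N0,N2),(N0,N3),(N0,N2),(N0,N2))) (Ref 27 (N0,N1,N2,N3)
    ((N0,N2),(N0,N2),(N0,N2),(N0,N2)))),
    ([(N0,N1,N0,N0), (N1,N1,N0,N0), (N1,N0,N1,N0), (N0,N1,N1,N0), (N0,N0,N0,N1), (N1,N1,N0,N1),
    (N0,N1,N1,N1), (N1,N1,N1,N1), (N2,N3,N0,N0), (N3,N3,N0,N0), (N3,N2,N1,N0), (N2,N3,N1,N0),
    (N2,N2,N0,N1), (N3,N3,N0,N1), (N2,N3,N1,N1), (N3,N3,N1,N1), (N3,N0,N2,N0)], Split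
    (N3,N0,N3,N0) (Cut 5 (N0,N2,N1,N3) ((N0,N3),(N0,N3),(N0,N2),(N1,N2))) (Split (N2,N0,N3,N1)
    (Split (N3,N0,N2,N1) (Ref 24 (N1,N0,N2,N3) ((N2,N1),(N3,N0),(N1,N3),(N1,N2))) (Split
    (N2,N0,N2,N1) (Cut 5 (N0,N2,N1,N3) ((N1,N2),(N0,N3),(N1,N2),(N0,N2))) (Split (N2,N0,N2,N0)
    (Split (N2,N1,N2,N0) (Cut 3 (N3,N1,N2,N0) ((N3,N0),(N2,N0),(N2,N1),(N2,N1))) (Cut 0
    (N0,N1,N2,N3) ((N2,N0),(N1,N2),(N3,N0),(N0,N2)))) (Split (N2,N1,N2,N0) (Cut 8 (N0,N3,N1,N2)
    ((N0,N2),(N0,N2),(N0,N3),(N1,N2))) (Cut 11 (N0,N2,N1,N3)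
    ((N1,N3),(N1,N2),(N0,N2),(N1,N2))))))) (Ref 28 (N0,N1,N2,N3)
    ((N0,N2),(N0,N2),(N0,N2),(N0,N2))))),
    ([(N0,N1,N0,N0), (N1,N1,N0,N0), (N1,N0,N1,N0), (N0,N1,N1,N0), (N0,N0,N0,N1), (N1,N1,N0,N1),
    (N0,N1,N1,N1), (N1,N1,N1,N1), (N3,N2,N1,N0), (N2,N3,N1,N0), (N2,N2,N0,N1), (N3,N3,N0,N1),
    (N3,N3,N1,N1)], Split (N3,N2,N1,N1) (Ref 26 (N0,N1,N2,N3) ((N0,N2),(N0,N2),(N0,N2),(N0,N2)))
    (Split (N3,N2,N0,N0) (Split (N3,N3,N0,N0) (Cut 3 (N2,N1,N3,N0)
    ((N3,N1),(N0,N2),(N1,N2),(N2,N1))) (Cut 25 (N1,N2,N0,N3) ((N3,N0),(N2,N0),(N0,N2),(N0,N2))))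
    (Split (N2,N2,N1,N1) (Cut 3 (N2,N1,N3,N0) ((N2,N0),(N0,N2),(N0,N2),(N2,N0))) (Split
    (N3,N0,N2,N0) (Ref 29 (N0,N1,N2,N3) ((N0,N2),(N0,N2),(N0,N2),(N0,N2))) (Split (N2,N0,N2,N1)
    (Ref 29 (N0,N1,N2,N3) ((N1,N3),(N0,N2),(N1,N2),(N1,N2))) (Split (N2,N1,N2,N1) (Split
    (N3,N1,N2,N0) (Cut 1 (N3,N1,N0,N2) ((N2,N0),(N0,N2),(N2,N0),(N0,N2))) (Ref 27 (N0,N1,N2,N3)
    ((N0,N3),(N0,N2),(N1,N3),(N1,N2)))) (Ref 28 (N0,N1,N2,N3)
    ((N0,N2),(N0,N2),(N0,N3),(N0,N2))))))))),
    ([(N0,N1,N0,N0), (N1,N1,N0,N0), (N1,N0,N1,N0), (N0,N1,N1,N0), (N0,N0,N0,N1), (N1,N1,N0,N1),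
    (N0,N1,N1,N1), (N1,N1,N1,N1), (N2,N3,N1,N0)], Split (N2,N2,N1,N0) (Split (N2,N3,N0,N1) (Split
    (N2,N2,N0,N1) (Cut 7 (N1,N2,N0,N3) ((N0,N2),(N2,N1),(N2,N0),(N0,N2))) (Ref 23 (N0,N1,N2,N3)
    ((N0,N2),(N0,N2),(N0,N2),(N0,N2)))) (Split (N3,N3,N1,N0) (Ref 16 (N0,N1,N2,N3)
    ((N0,N2),(N0,N2),(N1,N2),(N1,N2))) (Ref 23 (N0,N1,N2,N3) ((N0,N2),(N0,N3),(N0,N2),(N0,N2)))))
    (Split (N2,N3,N0,N1) (Split (N3,N3,N1,N0) (Cut 1 (N0,N1,N3,N2)
    ((N2,N0),(N2,N0),(N0,N2),(N0,N2))) (Ref 23 (N0,N1,N2,N3) ((N1,N2),(N0,N2),(N1,N2),(N1,N2))))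
    (Split (N3,N3,N1,N0) (Ref 23 (N0,N1,N2,N3) ((N0,N3),(N0,N2),(N0,N2),(N0,N2))) (Split
    (N3,N3,N1,N1) (Ref 30 (N0,N1,N2,N3) ((N0,N2),(N0,N2),(N0,N2),(N0,N2))) (Split (N2,N3,N0,N0)
    (Ref 26 (N0,N1,N2,N3) ((N1,N3),(N0,N2),(N1,N2),(N1,N2))) (Split (N3,N3,N0,N0) (Split
    (N3,N2,N0,N0) (Cut 3 (N2,N1,N0,N3) ((N3,N0),(N0,N3),(N2,N1),(N1,N2))) (Cut 25 (N1,N2,N3,N0)
    ((N2,N0),(N2,N0),(N0,N2),(N0,N2)))) (Ref 30 (N0,N1,N2,N3)
    ((N0,N3),(N0,N3),(N0,N2),(N0,N2))))))))),
    ([(N0,N1,N0,N0), (N1,N1,N0,N0), (N1,N1,N0,N1), (N0,N1,N1,N1), (N1,N1,N1,N1)], Split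
    (N1,N0,N0,N1) (Split (N1,N1,N1,N0) (Split (N0,N1,N0,N1) (Cut 22 (N0,N3,N1,N2)
    ((N1,N2),(N1,N2),(N0,N2),(N1,N2))) (Cut 24 (N2,N3,N0,N1) ((N1,N2),(N1,N2),(N0,N2),(N0,N2))))
    (Ref 18 (N0,N1,N2,N3) ((N0,N2),(N0,N2),(N0,N2),(N0,N2)))) (Split (N0,N1,N0,N1) (Ref 10
    (N1,N2,N0,N3) ((N2,N1),(N1,N2),(N2,N1),(N0,N2))) (Split (N1,N1,N1,N0) (Cut 22 (N0,N3,N1,N2)
    ((N1,N2),(N1,N2),(N1,N2),(N0,N2))) (Split (N2,N3,N1,N0) (Ref 31 (N0,N1,N2,N3)
    ((N0,N2),(N0,N2),(N0,N2),(N0,N2))) (Ref 31 (N0,N1,N2,N3)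
    ((N1,N3),(N0,N3),(N1,N2),(N1,N2))))))),
    ([(N0,N1,N0,N0), (N1,N1,N0,N0), (N0,N0,N1,N0), (N0,N1,N1,N1), (N1,N1,N1,N1)], Split
    (N1,N0,N1,N0) (Split (N1,N1,N1,N0) (Ref 18 (N0,N2,N1,N3) ((N0,N2),(N1,N2),(N0,N2),(N1,N2)))
    (Split (N1,N0,N0,N1) (Cut 25 (N0,N1,N2,N3) ((N0,N2),(N1,N2),(N0,N2),(N0,N2))) (Ref 17
    (N0,N2,N1,N3) ((N1,N2),(N1,N2),(N0,N2),(N1,N2))))) (Ref 32 (N0,N1,N2,N3)
    ((N1,N2),(N0,N2),(N0,N2),(N0,N2)))),
    ([(N0,N1,N0,N0), (N1,N1,N0,N0), (N1,N0,N0,N1), (N0,N1,N0,N1), (N0,N1,N1,N1), (N2,N3,N1,N0),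
    (N3,N3,N0,N1), (N2,N0,N2,N0), (N3,N0,N2,N0), (N3,N0,N2,N1), (N2,N1,N2,N1), (N3,N1,N2,N1),
    (N2,N0,N3,N1)], Split (N2,N2,N0,N1) (Cut 5 (N1,N0,N2,N3) ((N2,N0),(N2,N1),(N0,N2),(N1,N2)))
    (Split (N2,N3,N0,N1) (Cut 1 (N0,N1,N3,N2) ((N2,N0),(N2,N0),(N1,N2),(N1,N2))) (Cut 18
    (N0,N1,N2,N3) ((N1,N2),(N0,N3),(N1,N3),(N0,N2))))),
    ([(N0,N0,N0,N0), (N0,N1,N0,N0), (N1,N1,N0,N0), (N0,N0,N1,N0), (N1,N1,N1,N0), (N1,N0,N0,N1),
    (N0,N1,N0,N1), (N0,N1,N1,N1), (N3,N0,N2,N0), (N2,N1,N2,N0), (N3,N1,N3,N0), (N3,N0,N2,N1),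
    (N3,N1,N2,N1), (N2,N0,N3,N1)], Split (N2,N0,N2,N0) (Split (N3,N0,N3,N0) (Cut 3 (N1,N3,N2,N0)
    ((N1,N2),(N1,N2),(N2,N1),(N2,N1))) (Split (N3,N3,N0,N1) (Split (N3,N2,N0,N1) (Cut 16
    (N2,N0,N1,N3) ((N2,N1),(N2,N0),(N1,N2),(N1,N2))) (Ref 34 (N0,N1,N2,N3)
    ((N0,N2),(N0,N2),(N0,N2),(N0,N2)))) (Split (N2,N3,N1,N0) (Cut 5 (N2,N1,N0,N3)
    ((N2,N0),(N0,N2),(N3,N1),(N1,N2))) (Ref 34 (N0,N1,N2,N3) ((N0,N2),(N0,N3),(N0,N2),(N0,N2))))))
    (Split (N2,N1,N2,N1) (Cut 3 (N1,N0,N2,N3) ((N1,N2),(N2,N0),(N2,N1),(N0,N2))) (Ref 22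
    (N1,N2,N0,N3) ((N2,N0),(N0,N2),(N3,N0),(N0,N2))))),
    ([(N0,N0,N0,N0), (N0,N0,N1,N0), (N0,N1,N0,N1), (N0,N1,N1,N1), (N2,N1,N2,N0), (N2,N0,N3,N0),
    (N2,N1,N3,N0), (N3,N1,N3,N0), (N2,N0,N3,N1)], Split (N3,N0,N2,N0) (Cut 1 (N1,N2,N0,N3)
    ((N1,N3),(N0,N2),(N0,N3),(N1,N2))) (Ref 4 (N0,N2,N1,N3) ((N0,N3),(N1,N2),(N0,N2),(N1,N2)))),
    ([(N0,N0,N0,N0), (N0,N1,N0,N0), (N1,N1,N0,N0), (N0,N0,N1,N0), (N1,N1,N1,N0), (N1,N0,N0,N1),
    (N0,N1,N0,N1), (N0,N1,N1,N1), (N3,N3,N0,N0), (N2,N3,N1,N1), (N2,N0,N2,N0), (N3,N0,N2,N0),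
    (N2,N1,N2,N0), (N2,N1,N3,N0), (N3,N1,N3,N0), (N2,N1,N2,N1), (N3,N1,N2,N1), (N2,N0,N3,N1)],
    Split (N2,N3,N0,N1) (Cut 19 (N2,N1,N0,N3) ((N3,N0),(N1,N2),(N2,N0),(N1,N2))) (Split
    (N3,N3,N1,N0) (Cut 18 (N2,N1,N0,N3) ((N3,N1),(N0,N3),(N3,N0),(N0,N2))) (Split (N3,N2,N0,N1)
    (Cut 19 (N0,N1,N2,N3) ((N0,N2),(N1,N3),(N1,N2),(N1,N2))) (Split (N2,N2,N1,N0) (Cut 5
    (N2,N1,N0,N3) ((N2,N0),(N0,N2),(N3,N1),(N1,N2))) (Split (N3,N3,N1,N1) (Cut 11 (N0,N2,N1,N3)
    ((N1,N2),(N1,N2),(N1,N3),(N0,N2))) (Split (N2,N3,N0,N0) (Cut 12 (N0,N2,N1,N3)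
    ((N1,N2),(N0,N2),(N0,N2),(N1,N2))) (Cut 25 (N1,N2,N3,N0)
    ((N2,N0),(N2,N0),(N0,N2),(N0,N2))))))))),
    ([(N0,N0,N0,N0), (N0,N1,N0,N0), (N1,N1,N0,N0), (N0,N0,N1,N0), (N1,N1,N1,N0), (N1,N0,N0,N1),
    (N0,N1,N0,N1), (N0,N1,N1,N1), (N2,N0,N2,N0), (N3,N0,N2,N0), (N2,N1,N2,N0), (N2,N1,N3,N0),
    (N3,N1,N3,N0), (N2,N1,N2,N1), (N3,N1,N2,N1), (N2,N0,N3,N1)], Split (N2,N3,N1,N1) (Split
    (N2,N2,N1,N1) (Cut 16 (N1,N0,N2,N3) ((N3,N0),(N2,N0),(N0,N3),(N1,N2))) (Ref 37 (N0,N1,N2,N3)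
    ((N0,N2),(N0,N2),(N0,N2),(N0,N2)))) (Split (N3,N3,N0,N0) (Cut 5 (N0,N1,N2,N3)
    ((N1,N3),(N0,N2),(N0,N2),(N1,N2))) (Ref 37 (N0,N1,N2,N3) ((N0,N2),(N0,N3),(N0,N2),(N0,N2))))),
    ([(N0,N0,N0,N0), (N0,N1,N0,N0), (N1,N1,N0,N0), (N0,N0,N1,N0), (N1,N1,N1,N0), (N1,N0,N0,N1),
    (N0,N1,N0,N1), (N0,N1,N1,N1), (N2,N1,N2,N0), (N2,N1,N3,N0), (N3,N1,N3,N0), (N2,N0,N3,N1)],
    Split (N2,N0,N3,N0) (Ref 36 (N0,N1,N2,N3) ((N0,N2),(N0,N2),(N0,N2),(N0,N2))) (Split
    (N2,N1,N3,N1) (Cut 1 (N1,N3,N0,N2) ((N1,N3),(N0,N2),(N0,N3),(N1,N2))) (Split (N3,N1,N3,N1)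
    (Ref 32 (N2,N1,N0,N3) ((N3,N0),(N0,N2),(N2,N0),(N1,N2))) (Split (N3,N0,N3,N0) (Cut 4
    (N0,N3,N1,N2) ((N2,N0),(N0,N2),(N3,N0),(N1,N2))) (Ref 38 (N0,N1,N2,N3)
    ((N0,N2),(N0,N2),(N0,N2),(N0,N2))))))),
    ([(N0,N0,N0,N0), (N0,N1,N0,N0), (N1,N1,N0,N0), (N0,N0,N1,N0), (N1,N1,N1,N0), (N1,N0,N0,N1),
    (N0,N1,N0,N1), (N0,N1,N1,N1), (N2,N1,N3,N0), (N3,N1,N3,N0), (N2,N0,N3,N1)], Split
    (N3,N0,N3,N1) (Cut 7 (N2,N0,N1,N3) ((N2,N0),(N2,N0),(N0,N3),(N0,N2))) (Ref 39 (N0,N1,N2,N3)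
    ((N0,N2),(N0,N2),(N0,N2),(N0,N2)))),
    ([(N0,N0,N0,N0), (N0,N1,N0,N0), (N1,N1,N0,N0), (N0,N0,N1,N0), (N1,N1,N1,N0), (N1,N0,N0,N1),
    (N0,N1,N0,N1), (N0,N1,N1,N1), (N2,N0,N3,N1)], Split (N2,N0,N2,N1) (Cut 15 (N1,N0,N2,N3)
    ((N0,N2),(N2,N0),(N2,N0),(N0,N2))) (Split (N3,N0,N2,N1) (Split (N3,N0,N2,N0) (Split
    (N2,N0,N3,N0) (Cut 14 (N1,N2,N0,N3) ((N0,N2),(N0,N2),(N1,N2),(N0,N2))) (Split (N3,N0,N3,N1)
    (Cut 0 (N2,N1,N0,N3) ((N0,N2),(N0,N2),(N0,N2),(N0,N2))) (Ref 35 (N0,N1,N2,N3)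
    ((N0,N2),(N0,N2),(N0,N2),(N0,N2))))) (Split (N3,N1,N2,N1) (Cut 14 (N0,N3,N1,N2)
    ((N1,N2),(N0,N2),(N0,N2),(N1,N2))) (Split (N3,N0,N3,N1) (Cut 15 (N1,N0,N2,N3)
    ((N0,N3),(N2,N0),(N2,N0),(N0,N2))) (Ref 35 (N0,N1,N2,N3) ((N0,N3),(N0,N2),(N0,N3),(N0,N2))))))
    (Ref 40 (N0,N1,N2,N3) ((N0,N2),(N0,N2),(N0,N2),(N0,N2))))),
    ([(N0,N0,N0,N0), (N0,N1,N0,N0), (N1,N1,N0,N0), (N0,N0,N1,N0), (N1,N1,N1,N0), (N1,N0,N0,N1),
    (N0,N1,N0,N1), (N0,N1,N1,N1)], Split (N2,N0,N3,N1) (Ref 41 (N0,N1,N2,N3)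
    ((N0,N2),(N0,N2),(N0,N2),(N0,N2))) (Split (N3,N0,N3,N1) (Ref 41 (N0,N1,N2,N3)
    ((N0,N3),(N0,N2),(N0,N2),(N0,N2))) (Split (N2,N0,N2,N1) (Ref 40 (N0,N1,N2,N3)
    ((N0,N2),(N0,N2),(N0,N3),(N0,N2))) (Split (N3,N1,N2,N1) (Split (N3,N0,N2,N1) (Ref 39
    (N0,N1,N2,N3) ((N0,N3),(N0,N2),(N0,N3),(N0,N2))) (Ref 13 (N0,N2,N1,N3)
    ((N0,N2),(N1,N2),(N0,N2),(N1,N2)))) (Split (N3,N0,N2,N0) (Split (N3,N0,N2,N1) (Cut 1
    (N1,N2,N0,N3) ((N1,N2),(N0,N2),(N0,N2),(N1,N2))) (Ref 15 (N0,N2,N1,N3)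
    ((N0,N2),(N1,N2),(N0,N2),(N1,N2)))) (Split (N2,N1,N2,N1) (Ref 32 (N2,N1,N0,N3)
    ((N2,N0),(N0,N2),(N3,N0),(N1,N2))) (Split (N2,N0,N2,N0) (Cut 4 (N0,N3,N1,N2)
    ((N3,N0),(N0,N2),(N2,N0),(N1,N2))) (Split (N2,N1,N3,N0) (Cut 23 (N0,N1,N2,N3)
    ((N2,N0),(N1,N2),(N3,N0),(N0,N2))) (Ref 38 (N0,N1,N2,N3)
    ((N0,N3),(N0,N2),(N0,N3),(N0,N2))))))))))),
    ([(N0,N0,N0,N0), (N0,N1,N0,N0), (N1,N1,N0,N0), (N0,N0,N1,N0), (N1,N1,N1,N0), (N0,N1,N0,N1),
    (N0,N1,N1,N1)], Split (N0,N1,N1,N0) (Cut 23 (N1,N2,N0,N3) ((N0,N2),(N1,N2),(N0,N2),(N0,N2)))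
    (Ref 42 (N0,N1,N2,N3) ((N0,N2),(N0,N2),(N0,N2),(N0,N2)))),
    ([(N0,N0,N0,N0), (N0,N1,N0,N0), (N1,N1,N0,N0), (N1,N1,N1,N0), (N0,N1,N0,N1), (N0,N1,N1,N1)],
    Split (N1,N1,N0,N1) (Split (N1,N0,N0,N1) (Cut 24 (N0,N2,N3,N1)
    ((N0,N2),(N1,N2),(N0,N2),(N0,N2))) (Cut 22 (N0,N3,N1,N2) ((N0,N2),(N1,N2),(N0,N2),(N0,N2))))
    (Ref 43 (N0,N1,N2,N3) ((N0,N2),(N0,N2),(N0,N2),(N0,N2)))),
    ([(N0,N0,N0,N0), (N0,N1,N0,N0), (N1,N1,N0,N0), (N1,N0,N1,N0), (N1,N1,N1,N0), (N1,N1,N0,N1),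
    (N0,N1,N1,N1)], Split (N0,N1,N1,N0) (Cut 24 (N0,N2,N1,N3) ((N0,N2),(N1,N2),(N0,N2),(N0,N2)))
    (Ref 42 (N0,N2,N1,N3) ((N1,N2),(N1,N2),(N1,N2),(N0,N2)))),
    ([(N0,N1,N0,N0), (N1,N1,N0,N0), (N3,N2,N0,N0), (N2,N2,N0,N1), (N2,N2,N1,N1), (N3,N0,N3,N0),
    (N2,N1,N3,N0), (N2,N0,N2,N1), (N3,N1,N2,N1), (N2,N1,N3,N1), (N3,N1,N3,N1)], Split
    (N3,N2,N1,N0) (Cut 1 (N2,N1,N0,N3) ((N2,N0),(N3,N0),(N0,N3),(N0,N2))) (Ref 20 (N0,N2,N1,N3)
    ((N0,N3),(N0,N3),(N1,N2),(N1,N2)))),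
    ([(N0,N0,N0,N0), (N0,N1,N0,N0), (N1,N1,N0,N0), (N1,N1,N1,N0), (N1,N0,N0,N1), (N0,N1,N1,N1),
    (N3,N2,N0,N0), (N2,N2,N1,N1), (N3,N0,N3,N0), (N2,N1,N3,N0), (N2,N0,N2,N1), (N3,N1,N2,N1),
    (N3,N0,N3,N1), (N2,N1,N3,N1), (N3,N1,N3,N1)], Split (N2,N2,N0,N1) (Ref 46 (N0,N1,N2,N3)
    ((N0,N2),(N0,N2),(N0,N2),(N0,N2))) (Split (N3,N3,N0,N1) (Cut 6 (N0,N2,N1,N3)
    ((N1,N2),(N0,N3),(N0,N2),(N1,N2))) (Split (N3,N2,N1,N0) (Cut 2 (N2,N1,N0,N3)
    ((N3,N1),(N0,N2),(N2,N1),(N0,N2))) (Cut 2 (N0,N2,N1,N3) ((N0,N3),(N1,N2),(N1,N3),(N1,N2)))))),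
    ([(N0,N0,N0,N0), (N0,N1,N0,N0), (N1,N1,N0,N0), (N0,N0,N1,N0), (N1,N0,N1,N0), (N1,N1,N1,N0),
    (N1,N0,N0,N1), (N0,N1,N1,N1), (N3,N0,N3,N0), (N2,N1,N3,N0), (N2,N0,N2,N1), (N3,N1,N2,N1),
    (N3,N0,N3,N1), (N2,N1,N3,N1), (N3,N1,N3,N1)], Split (N2,N2,N1,N1) (Split (N2,N3,N1,N1) (Cut 20
    (N0,N1,N2,N3) ((N0,N2),(N1,N2),(N0,N2),(N0,N2))) (Ref 47 (N0,N1,N2,N3)
    ((N0,N2),(N0,N2),(N0,N2),(N0,N2)))) (Split (N3,N2,N0,N0) (Cut 2 (N2,N0,N1,N3)
    ((N3,N0),(N2,N1),(N1,N3),(N1,N2))) (Ref 47 (N0,N1,N2,N3) ((N0,N2),(N0,N3),(N0,N2),(N0,N2))))),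
    ([(N0,N1,N0,N0), (N1,N1,N0,N0), (N1,N1,N1,N0), (N1,N0,N0,N1), (N0,N1,N1,N1), (N2,N2,N1,N0),
    (N3,N2,N1,N0), (N3,N2,N0,N1), (N2,N0,N3,N0), (N2,N1,N3,N1), (N3,N1,N3,N1)], Split
    (N2,N2,N0,N1) (Cut 19 (N0,N2,N1,N3) ((N1,N2),(N0,N2),(N0,N2),(N1,N2))) (Cut 18 (N0,N1,N2,N3)
    ((N1,N2),(N0,N2),(N1,N2),(N0,N2)))),
    ([(N0,N0,N0,N0), (N0,N1,N0,N0), (N1,N1,N0,N0), (N0,N0,N1,N0), (N1,N1,N1,N0), (N1,N0,N0,N1),
    (N0,N1,N1,N1), (N2,N0,N3,N0), (N3,N0,N3,N0), (N2,N1,N3,N0), (N2,N0,N2,N1), (N3,N0,N3,N1),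
    (N2,N1,N3,N1), (N3,N1,N3,N1)], Split (N3,N2,N0,N1) (Split (N3,N3,N0,N1) (Cut 16 (N2,N0,N1,N3)
    ((N2,N1),(N2,N0),(N1,N3),(N1,N2))) (Split (N2,N3,N0,N1) (Cut 5 (N1,N0,N2,N3)
    ((N2,N0),(N3,N1),(N0,N3),(N1,N2))) (Ref 49 (N0,N1,N2,N3) ((N0,N2),(N0,N2),(N0,N2),(N0,N2)))))
    (Split (N2,N2,N0,N1) (Cut 5 (N1,N0,N2,N3) ((N2,N0),(N2,N1),(N0,N3),(N1,N2))) (Split
    (N2,N3,N0,N1) (Ref 49 (N0,N1,N2,N3) ((N0,N3),(N0,N3),(N0,N2),(N0,N2))) (Split (N2,N2,N1,N1)
    (Split (N3,N3,N0,N1) (Cut 18 (N0,N1,N2,N3) ((N1,N2),(N0,N3),(N1,N2),(N0,N2))) (Ref 13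
    (N0,N1,N2,N3) ((N0,N3),(N0,N2),(N1,N2),(N1,N2)))) (Split (N3,N2,N0,N0) (Cut 5 (N0,N1,N2,N3)
    ((N1,N3),(N0,N2),(N0,N3),(N1,N2))) (Ref 36 (N1,N2,N0,N3)
    ((N2,N0),(N0,N2),(N3,N1),(N0,N2)))))))),
    ([(N0,N0,N0,N0), (N0,N1,N0,N0), (N1,N1,N0,N0), (N0,N0,N1,N0), (N1,N0,N1,N0), (N1,N1,N1,N0),
    (N1,N0,N0,N1), (N0,N1,N1,N1), (N3,N0,N3,N0), (N2,N0,N2,N1), (N3,N0,N3,N1), (N3,N1,N3,N1)],
    Split (N2,N1,N3,N1) (Split (N3,N1,N2,N1) (Split (N3,N0,N2,N1) (Cut 0 (N2,N3,N0,N1)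
    ((N1,N2),(N0,N2),(N0,N2),(N1,N2))) (Ref 48 (N0,N1,N2,N3) ((N0,N2),(N0,N2),(N0,N2),(N0,N2))))
    (Split (N3,N0,N2,N1) (Cut 0 (N2,N3,N0,N1) ((N0,N2),(N1,N2),(N0,N3),(N1,N2))) (Ref 50
    (N0,N1,N2,N3) ((N0,N2),(N0,N2),(N0,N2),(N0,N2))))) (Split (N3,N1,N2,N1) (Ref 32 (N1,N2,N0,N3)
    ((N2,N0),(N0,N2),(N2,N0),(N0,N2))) (Split (N2,N0,N3,N1) (Cut 0 (N0,N3,N2,N1)
    ((N0,N3),(N1,N2),(N1,N2),(N1,N2))) (Ref 44 (N1,N2,N0,N3) ((N2,N0),(N0,N2),(N3,N0),(N0,N2)))))),
    ([(N0,N0,N0,N0), (N0,N1,N0,N0), (N1,N1,N0,N0), (N0,N0,N1,N0), (N1,N0,N1,N0), (N1,N1,N1,N0),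
    (N1,N0,N0,N1), (N0,N1,N1,N1), (N2,N0,N2,N1), (N3,N0,N3,N1), (N3,N1,N3,N1)], Split
    (N2,N1,N2,N1) (Cut 14 (N0,N3,N1,N2) ((N1,N3),(N0,N2),(N0,N2),(N1,N2))) (Ref 51 (N0,N1,N2,N3)
    ((N0,N2),(N0,N2),(N0,N2),(N0,N2)))),
    ([(N0,N0,N0,N0), (N0,N1,N0,N0), (N1,N1,N0,N0), (N0,N0,N1,N0), (N1,N0,N1,N0), (N1,N1,N1,N0),
    (N1,N0,N0,N1), (N0,N1,N1,N1), (N3,N0,N3,N1), (N3,N1,N3,N1)], Split (N2,N0,N2,N1) (Ref 52
    (N0,N1,N2,N3) ((N0,N2),(N0,N2),(N0,N2),(N0,N2))) (Split (N2,N0,N3,N1) (Split (N3,N1,N2,N1)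
    (Cut 14 (N1,N3,N0,N2) ((N3,N1),(N0,N2),(N2,N0),(N0,N2))) (Split (N2,N1,N3,N1) (Split
    (N2,N1,N2,N1) (Cut 0 (N0,N3,N2,N1) ((N0,N3),(N0,N2),(N0,N2),(N1,N2))) (Split (N3,N0,N2,N1)
    (Cut 0 (N0,N3,N2,N1) ((N0,N2),(N1,N2),(N1,N2),(N1,N2))) (Cut 21 (N0,N1,N3,N2)
    ((N2,N0),(N0,N2),(N3,N0),(N0,N2))))) (Split (N3,N0,N2,N1) (Split (N3,N0,N3,N0) (Cut 23
    (N1,N2,N3,N0) ((N3,N0),(N0,N2),(N3,N0),(N0,N2))) (Ref 48 (N0,N1,N2,N3)
    ((N1,N2),(N1,N2),(N1,N2),(N0,N2)))) (Split (N3,N0,N3,N0) (Cut 22 (N0,N1,N3,N2)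
    ((N3,N0),(N0,N2),(N3,N0),(N0,N2))) (Ref 50 (N0,N1,N2,N3)
    ((N1,N2),(N1,N2),(N1,N2),(N0,N2))))))) (Split (N3,N0,N2,N1) (Ref 32 (N1,N2,N0,N3)
    ((N2,N0),(N1,N2),(N2,N0),(N0,N2))) (Split (N2,N1,N3,N1) (Split (N2,N1,N2,N1) (Cut 0
    (N0,N3,N2,N1) ((N0,N3),(N0,N2),(N0,N2),(N1,N2))) (Ref 4 (N0,N2,N1,N3)
    ((N0,N2),(N1,N2),(N0,N2),(N1,N2)))) (Ref 44 (N1,N2,N0,N3)
    ((N2,N0),(N1,N2),(N3,N0),(N0,N2))))))),
    ([(N2,N2,N0,N0), (N3,N2,N0,N0), (N2,N3,N0,N0), (N2,N2,N1,N0), (N3,N3,N1,N0), (N3,N2,N0,N1),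
    (N2,N0,N2,N0), (N3,N0,N2,N0), (N3,N1,N2,N0), (N3,N0,N3,N0), (N2,N1,N3,N0), (N3,N1,N2,N1),
    (N3,N0,N3,N1)], Split (N2,N2,N1,N1) (Cut 10 (N0,N1,N2,N3) ((N0,N2),(N0,N3),(N1,N2),(N1,N2)))
    (Ref 11 (N0,N1,N2,N3) ((N0,N2),(N0,N2),(N0,N2),(N1,N2)))),
    ([(N0,N0,N0,N0), (N0,N1,N0,N0), (N1,N1,N0,N0), (N0,N0,N1,N0), (N1,N0,N1,N0), (N1,N1,N1,N0),
    (N1,N0,N0,N1), (N0,N1,N1,N1), (N2,N2,N1,N0), (N3,N2,N0,N1), (N2,N0,N2,N0), (N3,N0,N2,N0),
    (N3,N1,N2,N0), (N3,N0,N3,N0), (N2,N1,N3,N0), (N2,N0,N2,N1), (N3,N1,N2,N1), (N3,N0,N3,N1)],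
    Split (N2,N2,N0,N0) (Split (N3,N2,N1,N1) (Cut 1 (N2,N1,N0,N3)
    ((N2,N0),(N3,N1),(N0,N2),(N1,N2))) (Split (N2,N2,N0,N1) (Cut 18 (N0,N2,N1,N3)
    ((N0,N2),(N0,N3),(N1,N2),(N0,N2))) (Split (N2,N3,N1,N1) (Split (N2,N2,N1,N1) (Cut 0
    (N1,N0,N2,N3) ((N3,N0),(N2,N1),(N0,N3),(N1,N2))) (Cut 8 (N0,N1,N2,N3)
    ((N0,N2),(N1,N3),(N1,N2),(N1,N2)))) (Ref 54 (N0,N1,N2,N3)
    ((N0,N2),(N0,N2),(N0,N2),(N0,N2)))))) (Split (N2,N2,N0,N1) (Cut 18 (N0,N2,N1,N3)
    ((N0,N2),(N0,N3),(N1,N2),(N0,N2))) (Split (N3,N2,N1,N1) (Ref 53 (N0,N2,N1,N3)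
    ((N0,N2),(N0,N3),(N0,N2),(N0,N2))) (Split (N2,N3,N0,N1) (Cut 9 (N3,N0,N2,N1)
    ((N2,N0),(N1,N3),(N3,N0),(N0,N2))) (Split (N2,N3,N1,N1) (Cut 4 (N1,N0,N3,N2)
    ((N1,N3),(N0,N3),(N0,N2),(N1,N2))) (Split (N2,N2,N1,N1) (Cut 9 (N3,N0,N2,N1)
    ((N2,N0),(N3,N0),(N0,N2),(N0,N2))) (Cut 24 (N3,N0,N1,N2)
    ((N3,N0),(N2,N0),(N0,N2),(N0,N2))))))))),
    ([(N0,N0,N0,N0), (N0,N1,N0,N0), (N1,N1,N0,N0), (N0,N0,N1,N0), (N1,N0,N1,N0), (N1,N1,N1,N0),
    (N1,N0,N0,N1), (N0,N1,N1,N1), (N2,N0,N2,N0), (N3,N0,N2,N0), (N3,N1,N2,N0), (N3,N0,N3,N0),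
    (N2,N1,N3,N0), (N2,N0,N2,N1), (N3,N1,N2,N1), (N3,N0,N3,N1)], Split (N3,N2,N0,N1) (Split
    (N3,N3,N0,N1) (Cut 2 (N2,N0,N1,N3) ((N3,N0),(N2,N0),(N1,N2),(N0,N2))) (Ref 55 (N0,N1,N2,N3)
    ((N0,N2),(N0,N2),(N0,N2),(N0,N2)))) (Split (N2,N2,N1,N0) (Cut 17 (N0,N2,N1,N3)
    ((N0,N2),(N0,N2),(N0,N2),(N1,N2))) (Ref 55 (N0,N1,N2,N3) ((N0,N2),(N0,N3),(N0,N2),(N0,N2))))),
    ([(N0,N0,N0,N0), (N0,N1,N0,N0), (N1,N1,N0,N0), (N0,N0,N1,N0), (N1,N0,N1,N0), (N1,N1,N1,N0),
    (N1,N0,N0,N1), (N0,N1,N1,N1), (N3,N0,N3,N1)], Split (N3,N1,N3,N1) (Ref 53 (N0,N1,N2,N3)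
    ((N0,N2),(N0,N2),(N0,N2),(N0,N2))) (Split (N3,N1,N2,N1) (Split (N2,N1,N2,N1) (Split
    (N2,N0,N3,N1) (Cut 0 (N0,N3,N2,N1) ((N2,N1),(N1,N2),(N3,N0),(N0,N2))) (Split (N3,N0,N2,N1)
    (Cut 14 (N0,N3,N1,N2) ((N2,N1),(N0,N2),(N2,N0),(N0,N2))) (Split (N2,N1,N3,N1) (Split
    (N3,N1,N3,N0) (Cut 4 (N1,N3,N0,N2) ((N1,N3),(N0,N2),(N0,N2),(N1,N2))) (Ref 48 (N0,N1,N2,N3)
    ((N0,N3),(N0,N2),(N0,N3),(N0,N2)))) (Split (N3,N1,N3,N0) (Cut 4 (N1,N3,N0,N2)
    ((N1,N3),(N0,N2),(N0,N2),(N1,N2))) (Ref 50 (N0,N1,N2,N3)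
    ((N0,N3),(N0,N2),(N0,N3),(N0,N2))))))) (Split (N3,N0,N2,N0) (Split (N2,N0,N3,N1) (Cut 4
    (N1,N3,N0,N2) ((N0,N3),(N1,N2),(N1,N3),(N1,N2))) (Split (N3,N0,N2,N1) (Ref 3 (N0,N2,N1,N3)
    ((N0,N2),(N0,N2),(N0,N3),(N1,N2))) (Split (N3,N1,N3,N0) (Cut 24 (N2,N0,N1,N3)
    ((N3,N0),(N0,N2),(N2,N0),(N0,N2))) (Ref 56 (N0,N1,N2,N3) ((N0,N2),(N0,N2),(N0,N2),(N0,N2))))))
    (Split (N2,N0,N3,N1) (Ref 52 (N0,N1,N2,N3) ((N1,N3),(N1,N2),(N1,N2),(N0,N2))) (Split
    (N2,N1,N3,N0) (Split (N2,N0,N2,N1) (Cut 25 (N1,N2,N3,N0) ((N2,N0),(N0,N2),(N2,N0),(N0,N2)))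
    (Ref 56 (N0,N1,N2,N3) ((N1,N2),(N1,N2),(N1,N3),(N0,N2)))) (Ref 51 (N0,N1,N2,N3)
    ((N1,N2),(N1,N2),(N1,N3),(N0,N2))))))) (Split (N2,N1,N2,N1) (Split (N2,N1,N3,N1) (Ref 33
    (N1,N2,N0,N3) ((N3,N0),(N1,N2),(N3,N0),(N1,N2))) (Split (N2,N0,N3,N1) (Cut 4 (N1,N3,N0,N2)
    ((N0,N2),(N1,N2),(N1,N3),(N1,N2))) (Split (N3,N0,N2,N1) (Cut 4 (N0,N3,N1,N2)
    ((N0,N3),(N1,N2),(N1,N2),(N1,N2))) (Cut 8 (N0,N2,N1,N3) ((N0,N2),(N1,N2),(N1,N2),(N1,N2))))))
    (Split (N3,N0,N2,N1) (Ref 32 (N2,N1,N0,N3) ((N3,N0),(N1,N2),(N2,N0),(N1,N2))) (Split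
    (N2,N0,N3,N1) (Ref 4 (N2,N0,N1,N3) ((N2,N0),(N2,N1),(N0,N2),(N1,N2))) (Split (N3,N0,N2,N0)
    (Ref 11 (N0,N2,N1,N3) ((N0,N2),(N0,N2),(N0,N3),(N1,N2))) (Split (N3,N1,N3,N0) (Cut 24
    (N0,N1,N2,N3) ((N2,N0),(N0,N2),(N3,N0),(N0,N2))) (Ref 56 (N0,N1,N2,N3)
    ((N0,N3),(N0,N2),(N0,N3),(N0,N2)))))))))),
    ([(N0,N0,N0,N0), (N0,N1,N0,N0), (N1,N1,N0,N0), (N0,N0,N1,N0), (N1,N0,N1,N0), (N1,N1,N1,N0),
    (N0,N1,N1,N1)], Split (N0,N1,N1,N0) (Cut 22 (N0,N1,N2,N3) ((N0,N2),(N1,N2),(N1,N2),(N0,N2)))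
    (Split (N3,N0,N3,N1) (Ref 57 (N0,N1,N2,N3) ((N0,N2),(N0,N2),(N0,N2),(N0,N2))) (Split
    (N2,N1,N3,N0) (Split (N2,N0,N3,N1) (Ref 57 (N0,N1,N2,N3) ((N0,N3),(N0,N2),(N0,N2),(N0,N2)))
    (Split (N2,N0,N2,N1) (Ref 57 (N0,N1,N2,N3) ((N0,N3),(N0,N2),(N0,N3),(N0,N2))) (Ref 16
    (N0,N2,N1,N3) ((N0,N2),(N1,N2),(N0,N2),(N1,N2))))) (Ref 57 (N0,N1,N2,N3)
    ((N0,N2),(N0,N2),(N0,N3),(N0,N2)))))),
    ([(N0,N0,N0,N0), (N0,N1,N0,N0), (N1,N1,N0,N0), (N1,N1,N1,N0), (N0,N1,N1,N1)], Split
    (N0,N1,N0,N1) (Ref 44 (N0,N1,N2,N3) ((N0,N2),(N0,N2),(N0,N2),(N0,N2))) (Split (N1,N1,N0,N1)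
    (Ref 45 (N0,N1,N2,N3) ((N0,N2),(N0,N2),(N0,N2),(N0,N2))) (Ref 58 (N0,N1,N2,N3)
    ((N0,N2),(N0,N2),(N0,N2),(N0,N2))))),
    ([(N0,N0,N0,N0), (N0,N1,N0,N0), (N1,N1,N0,N0), (N0,N0,N0,N1), (N2,N2,N1,N0), (N2,N3,N1,N0),
    (N3,N3,N1,N0), (N3,N2,N1,N1)], Split (N3,N3,N1,N1) (Cut 0 (N2,N0,N1,N3)
    ((N2,N1),(N2,N0),(N0,N2),(N1,N2))) (Ref 59 (N2,N0,N1,N3) ((N2,N0),(N2,N0),(N0,N2),(N0,N2)))),
    ([(N0,N0,N0,N0), (N0,N1,N0,N0), (N1,N1,N0,N0), (N1,N0,N1,N0), (N0,N1,N1,N0), (N0,N0,N0,N1),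
    (N1,N1,N0,N1), (N2,N2,N1,N0), (N2,N3,N1,N0), (N3,N3,N1,N0), (N2,N3,N0,N1)], Split
    (N3,N2,N1,N1) (Ref 60 (N0,N1,N2,N3) ((N0,N2),(N0,N2),(N0,N2),(N0,N2))) (Split (N2,N3,N1,N1)
    (Ref 4 (N0,N1,N2,N3) ((N0,N3),(N0,N2),(N1,N2),(N1,N2))) (Ref 54 (N2,N1,N0,N3)
    ((N2,N0),(N1,N3),(N2,N1),(N0,N2))))),
    ([(N0,N1,N0,N0), (N1,N1,N0,N0), (N1,N0,N1,N0), (N0,N1,N1,N0), (N0,N1,N1,N1), (N3,N2,N0,N0),
    (N2,N2,N1,N0), (N2,N2,N0,N1), (N3,N2,N0,N1), (N2,N3,N0,N1), (N3,N3,N1,N1), (N3,N0,N3,N1)],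
    Split (N2,N0,N2,N0) (Cut 2 (N1,N0,N2,N3) ((N3,N0),(N2,N1),(N0,N3),(N0,N2))) (Split
    (N3,N0,N2,N1) (Cut 20 (N0,N1,N2,N3) ((N1,N2),(N0,N2),(N1,N2),(N0,N2))) (Ref 46 (N0,N2,N1,N3)
    ((N0,N3),(N1,N3),(N1,N3),(N0,N2))))),
    ([(N0,N1,N0,N0), (N1,N1,N0,N0), (N1,N0,N1,N0), (N0,N1,N1,N0), (N0,N1,N1,N1), (N2,N2,N1,N0),
    (N2,N2,N0,N1), (N3,N2,N0,N1), (N2,N3,N0,N1)], Split (N2,N2,N1,N1) (Split (N3,N3,N1,N1) (Split
    (N2,N3,N1,N1) (Cut 15 (N2,N1,N3,N0) ((N0,N2),(N2,N1),(N1,N2),(N2,N0))) (Split (N3,N0,N3,N1)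
    (Ref 62 (N0,N1,N2,N3) ((N0,N2),(N0,N2),(N0,N2),(N0,N2))) (Split (N2,N1,N3,N0) (Cut 2
    (N2,N1,N0,N3) ((N2,N1),(N0,N2),(N2,N0),(N1,N2))) (Ref 62 (N0,N1,N2,N3)
    ((N0,N2),(N0,N2),(N0,N3),(N0,N2)))))) (Ref 4 (N0,N1,N2,N3) ((N0,N3),(N0,N3),(N0,N2),(N0,N2))))
    (Split (N3,N2,N0,N0) (Ref 32 (N2,N0,N1,N3) ((N3,N0),(N3,N0),(N1,N2),(N0,N2))) (Ref 59
    (N1,N0,N2,N3) ((N3,N0),(N2,N0),(N0,N2),(N1,N2))))),
    ([(N0,N0,N0,N0), (N0,N1,N0,N0), (N1,N1,N0,N0), (N0,N1,N1,N0), (N0,N0,N0,N1), (N1,N1,N0,N1),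
    (N0,N1,N1,N1), (N2,N2,N1,N0), (N3,N3,N1,N0), (N3,N2,N0,N1), (N2,N3,N0,N1), (N2,N2,N1,N1)],
    Split (N3,N2,N0,N0) (Cut 9 (N2,N0,N3,N1) ((N1,N2),(N0,N2),(N1,N2),(N0,N2))) (Split
    (N2,N3,N0,N0) (Cut 9 (N0,N2,N3,N1) ((N1,N2),(N0,N2),(N1,N2),(N0,N2))) (Ref 45 (N2,N0,N1,N3)
    ((N2,N0),(N3,N0),(N0,N2),(N1,N2))))),
    ([(N2,N2,N0,N0), (N3,N3,N0,N0), (N2,N2,N1,N0), (N3,N3,N1,N0), (N3,N2,N0,N1), (N2,N3,N0,N1),
    (N3,N2,N1,N1)], Split (N2,N3,N1,N1) (Cut 25 (N1,N2,N0,N3) ((N2,N0),(N2,N0),(N0,N2),(N0,N2)))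
    (Ref 42 (N1,N0,N2,N3) ((N2,N0),(N2,N0),(N0,N2),(N0,N2)))),
    ([(N0,N0,N0,N0), (N0,N1,N0,N0), (N1,N1,N0,N0), (N1,N0,N1,N0), (N0,N1,N1,N0), (N0,N0,N0,N1),
    (N1,N1,N0,N1), (N0,N1,N1,N1), (N2,N2,N1,N0), (N3,N2,N0,N1)], Split (N2,N2,N0,N1) (Split
    (N3,N2,N1,N0) (Cut 1 (N0,N1,N2,N3) ((N2,N0),(N3,N0),(N1,N2),(N1,N2))) (Ref 63 (N0,N1,N2,N3)
    ((N0,N2),(N0,N2),(N0,N2),(N0,N2)))) (Split (N3,N2,N1,N0) (Ref 61 (N0,N1,N2,N3)
    ((N0,N3),(N0,N3),(N0,N2),(N0,N2))) (Split (N2,N2,N1,N1) (Ref 64 (N0,N1,N2,N3)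
    ((N0,N2),(N0,N2),(N0,N2),(N0,N2))) (Split (N3,N3,N1,N1) (Ref 64 (N0,N1,N2,N3)
    ((N0,N3),(N0,N3),(N0,N2),(N0,N2))) (Split (N2,N3,N0,N0) (Ref 45 (N2,N0,N1,N3)
    ((N2,N0),(N2,N0),(N1,N2),(N0,N2))) (Ref 65 (N0,N1,N2,N3)
    ((N0,N2),(N0,N2),(N0,N2),(N0,N2)))))))),
    ([(N0,N0,N0,N0), (N0,N1,N0,N0), (N1,N1,N0,N0), (N1,N0,N1,N0), (N0,N1,N1,N0), (N0,N0,N0,N1),
    (N1,N1,N0,N1), (N0,N1,N1,N1), (N2,N2,N1,N0)], Split (N2,N3,N1,N0) (Split (N2,N3,N0,N1) (Split
    (N2,N2,N0,N1) (Cut 1 (N1,N0,N2,N3) ((N3,N1),(N2,N1),(N1,N2),(N1,N2))) (Ref 61 (N0,N1,N2,N3)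
    ((N0,N2),(N0,N2),(N0,N2),(N0,N2)))) (Split (N3,N3,N1,N1) (Ref 60 (N0,N1,N2,N3)
    ((N0,N2),(N0,N3),(N0,N2),(N0,N2))) (Split (N2,N2,N1,N1) (Split (N2,N3,N1,N1) (Cut 14
    (N1,N0,N2,N3) ((N2,N1),(N3,N0),(N0,N2),(N0,N2))) (Split (N2,N3,N0,N0) (Cut 10 (N2,N1,N0,N3)
    ((N2,N0),(N1,N3),(N2,N1),(N1,N2))) (Cut 14 (N0,N1,N2,N3) ((N3,N1),(N2,N0),(N0,N2),(N0,N2)))))
    (Split (N2,N3,N1,N1) (Cut 10 (N1,N2,N0,N3) ((N0,N3),(N3,N1),(N2,N1),(N1,N2))) (Split
    (N3,N2,N1,N1) (Cut 10 (N2,N1,N0,N3) ((N3,N0),(N1,N3),(N2,N1),(N1,N2))) (Ref 14 (N0,N1,N2,N3)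
    ((N0,N2),(N0,N3),(N0,N2),(N1,N2)))))))) (Ref 66 (N0,N1,N2,N3)
    ((N0,N2),(N0,N2),(N0,N2),(N0,N2)))),
    ([(N0,N0,N0,N0), (N0,N1,N0,N0), (N1,N1,N0,N0), (N1,N0,N1,N0), (N0,N1,N1,N0), (N0,N0,N0,N1),
    (N1,N1,N0,N1), (N0,N1,N1,N1)], Split (N2,N2,N1,N0) (Ref 67 (N0,N1,N2,N3)
    ((N0,N2),(N0,N2),(N0,N2),(N0,N2))) (Split (N3,N2,N0,N1) (Split (N3,N3,N1,N0) (Ref 67
    (N0,N1,N2,N3) ((N0,N3),(N0,N3),(N0,N2),(N0,N2))) (Split (N2,N3,N0,N1) (Ref 16 (N0,N1,N2,N3)
    ((N0,N2),(N0,N2),(N0,N2),(N0,N2))) (Ref 63 (N0,N1,N2,N3) ((N0,N3),(N0,N2),(N0,N2),(N0,N2)))))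
    (Ref 66 (N0,N1,N2,N3) ((N0,N2),(N0,N3),(N0,N2),(N0,N2))))),
    ([(N0,N0,N0,N0), (N0,N1,N0,N0), (N1,N1,N0,N0), (N0,N1,N1,N0), (N0,N0,N0,N1), (N1,N1,N0,N1),
    (N0,N1,N1,N1)], Split (N0,N1,N0,N1) (Cut 23 (N1,N2,N3,N0) ((N0,N2),(N1,N2),(N0,N2),(N0,N2)))
    (Ref 68 (N0,N1,N2,N3) ((N0,N2),(N0,N2),(N0,N2),(N0,N2)))),
    ([(N0,N0,N0,N0), (N0,N1,N0,N0), (N1,N1,N0,N0), (N0,N0,N0,N1), (N0,N1,N1,N1)], Split
    (N0,N1,N1,N0) (Split (N0,N0,N1,N0) (Split (N1,N0,N1,N0) (Cut 24 (N3,N0,N1,N2)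
    ((N0,N2),(N0,N2),(N0,N2),(N0,N2))) (Cut 22 (N3,N0,N1,N2) ((N0,N2),(N1,N2),(N0,N2),(N0,N2))))
    (Ref 69 (N0,N1,N2,N3) ((N0,N2),(N0,N2),(N0,N2),(N0,N2)))) (Ref 32 (N0,N2,N1,N3)
    ((N1,N2),(N0,N2),(N1,N2),(N1,N2)))),
    ([(N0,N0,N0,N0), (N0,N1,N0,N0), (N1,N1,N0,N0), (N0,N1,N1,N1)], Split (N1,N1,N1,N0) (Ref 59
    (N0,N1,N2,N3) ((N0,N2),(N0,N2),(N0,N2),(N0,N2))) (Ref 70 (N0,N1,N2,N3)
    ((N0,N2),(N0,N2),(N0,N2),(N0,N2)))),
    ([(N0,N1,N0,N0), (N1,N1,N0,N0), (N0,N1,N1,N1)], Split (N1,N1,N1,N1) (Split (N1,N1,N0,N1) (Ref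
    32 (N0,N1,N2,N3) ((N0,N2),(N0,N2),(N0,N2),(N0,N2))) (Ref 33 (N0,N1,N2,N3)
    ((N0,N2),(N0,N2),(N0,N2),(N0,N2)))) (Ref 71 (N0,N1,N2,N3) ((N0,N2),(N0,N2),(N0,N2),(N0,N2)))),
    ([(N0,N1,N0,N0), (N1,N1,N0,N0)], Split (N0,N1,N1,N1) (Ref 72 (N0,N1,N2,N3)
    ((N0,N2),(N0,N2),(N0,N2),(N0,N2))) (Split (N1,N0,N1,N0) (Split (N1,N0,N0,N1) (Ref 72
    (N0,N2,N1,N3) ((N1,N2),(N1,N2),(N1,N2),(N0,N2))) (Split (N1,N1,N0,N1) (Split (N0,N0,N0,N0)
    (Ref 11 (N1,N0,N2,N3) ((N2,N1),(N2,N0),(N0,N2),(N1,N2))) (Ref 43 (N0,N1,N2,N3)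
    ((N1,N2),(N0,N2),(N0,N2),(N0,N2)))) (Split (N1,N1,N1,N0) (Ref 14 (N1,N0,N2,N3)
    ((N2,N0),(N2,N1),(N1,N2),(N1,N2))) (Ref 58 (N0,N1,N2,N3) ((N0,N2),(N1,N2),(N1,N2),(N0,N2))))))
    (Split (N0,N0,N0,N1) (Ref 72 (N0,N2,N1,N3) ((N0,N2),(N1,N2),(N1,N2),(N0,N2))) (Split
    (N1,N1,N0,N1) (Ref 72 (N0,N1,N2,N3) ((N1,N2),(N0,N2),(N0,N2),(N1,N2))) (Split (N0,N1,N1,N0)
    (Ref 11 (N1,N2,N0,N3) ((N2,N0),(N1,N2),(N2,N1),(N1,N2))) (Ref 71 (N0,N2,N1,N3)
    ((N1,N2),(N1,N2),(N1,N2),(N0,N2)))))))),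
    ([(N1,N0,N0,N0), (N1,N1,N0,N0), (N1,N0,N1,N1), (N1,N1,N1,N1), (N2,N2,N1,N0), (N2,N2,N0,N1),
    (N3,N2,N0,N1)], Split (N3,N2,N1,N0) (Cut 7 (N2,N1,N0,N3) ((N2,N1),(N0,N2),(N2,N0),(N0,N2)))
    (Ref 71 (N1,N0,N2,N3) ((N3,N0),(N2,N0),(N0,N2),(N1,N2)))),
    ([(N1,N0,N0,N0), (N1,N1,N0,N0), (N0,N0,N1,N0), (N1,N1,N1,N0), (N1,N0,N0,N1), (N0,N1,N0,N1),
    (N1,N0,N1,N1), (N1,N1,N1,N1), (N2,N2,N0,N0), (N3,N2,N0,N0), (N2,N2,N1,N0), (N3,N2,N0,N1),
    (N2,N3,N0,N1), (N2,N2,N1,N1), (N3,N2,N1,N1), (N3,N1,N3,N0)], Split (N3,N1,N2,N0) (Cut 5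
    (N0,N2,N1,N3) ((N0,N3),(N1,N2),(N0,N2),(N1,N2))) (Split (N3,N0,N3,N0) (Ref 74 (N2,N0,N1,N3)
    ((N3,N0),(N3,N0),(N0,N3),(N1,N2))) (Split (N2,N1,N3,N1) (Cut 19 (N2,N1,N0,N3)
    ((N3,N1),(N1,N3),(N3,N0),(N0,N2))) (Split (N3,N1,N3,N1) (Cut 11 (N1,N2,N0,N3)
    ((N2,N0),(N1,N3),(N2,N1),(N1,N2))) (Ref 74 (N0,N2,N1,N3)
    ((N0,N2),(N0,N2),(N0,N2),(N1,N2))))))),
    ([(N1,N0,N0,N0), (N1,N1,N0,N0), (N0,N0,N1,N0), (N1,N1,N1,N0), (N1,N0,N0,N1), (N0,N1,N0,N1),
    (N1,N0,N1,N1), (N1,N1,N1,N1), (N2,N2,N1,N0), (N3,N3,N1,N0), (N3,N2,N0,N1), (N2,N3,N0,N1),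
    (N2,N2,N1,N1), (N3,N2,N1,N1)], Split (N2,N3,N1,N1) (Cut 3 (N1,N2,N3,N0)
    ((N0,N3),(N2,N1),(N0,N2),(N2,N0))) (Split (N3,N3,N1,N1) (Cut 3 (N1,N2,N0,N3)
    ((N0,N2),(N2,N0),(N2,N0),(N0,N2))) (Split (N3,N1,N3,N0) (Ref 75 (N0,N1,N2,N3)
    ((N0,N2),(N0,N2),(N0,N2),(N0,N2))) (Ref 75 (N0,N1,N2,N3) ((N0,N3),(N1,N2),(N1,N3),(N1,N2)))))),
    ([(N1,N0,N0,N0), (N1,N1,N0,N0), (N0,N0,N1,N0), (N1,N1,N1,N0), (N1,N0,N0,N1), (N0,N1,N0,N1),
    (N1,N0,N1,N1), (N1,N1,N1,N1), (N2,N2,N1,N0)], Split (N2,N3,N1,N0) (Ref 73 (N2,N0,N1,N3)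
    ((N2,N0),(N2,N0),(N0,N2),(N0,N2))) (Split (N2,N2,N0,N1) (Ref 74 (N0,N1,N2,N3)
    ((N0,N2),(N0,N2),(N0,N2),(N0,N2))) (Split (N3,N2,N1,N1) (Split (N2,N2,N1,N1) (Split
    (N3,N2,N1,N0) (Ref 70 (N1,N0,N2,N3) ((N2,N0),(N2,N0),(N1,N2),(N0,N2))) (Ref 76 (N0,N1,N2,N3)
    ((N0,N2),(N0,N2),(N0,N2),(N0,N2)))) (Split (N2,N3,N1,N1) (Split (N3,N2,N1,N0) (Cut 1
    (N1,N0,N3,N2) ((N0,N2),(N0,N2),(N0,N2),(N1,N2))) (Ref 65 (N0,N1,N2,N3)
    ((N0,N2),(N0,N3),(N1,N2),(N1,N2)))) (Ref 72 (N1,N0,N2,N3) ((N2,N0),(N2,N0),(N0,N2),(N0,N2)))))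
    (Split (N3,N2,N1,N0) (Ref 71 (N1,N0,N2,N3) ((N2,N0),(N2,N0),(N1,N2),(N0,N2))) (Split
    (N3,N3,N0,N0) (Ref 76 (N0,N1,N2,N3) ((N0,N2),(N1,N3),(N1,N2),(N1,N2))) (Split (N3,N3,N1,N1)
    (Split (N2,N3,N1,N1) (Cut 3 (N1,N2,N0,N3) ((N0,N3),(N3,N0),(N2,N0),(N0,N2))) (Cut 25
    (N1,N2,N3,N0) ((N3,N0),(N2,N0),(N0,N2),(N0,N2)))) (Ref 70 (N2,N0,N1,N3)
    ((N2,N0),(N2,N0),(N1,N2),(N0,N2))))))))),
    ([(N1,N1,N0,N0), (N1,N1,N1,N0), (N1,N0,N0,N1), (N1,N0,N1,N1), (N1,N1,N1,N1)], Split
    (N1,N0,N1,N0) (Split (N0,N1,N1,N1) (Ref 70 (N0,N1,N2,N3) ((N1,N2),(N0,N2),(N1,N2),(N1,N2)))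
    (Split (N0,N0,N1,N0) (Cut 22 (N3,N0,N1,N2) ((N1,N2),(N0,N2),(N1,N2),(N0,N2))) (Cut 21
    (N3,N0,N1,N2) ((N1,N2),(N0,N2),(N0,N2),(N0,N2))))) (Split (N0,N1,N1,N1) (Ref 43 (N0,N1,N2,N3)
    ((N1,N2),(N0,N2),(N1,N2),(N1,N2))) (Split (N1,N1,N0,N1) (Cut 22 (N3,N0,N1,N2)
    ((N1,N2),(N1,N2),(N0,N2),(N1,N2))) (Split (N2,N2,N1,N0) (Ref 77 (N0,N1,N2,N3)
    ((N0,N2),(N0,N2),(N0,N2),(N0,N2))) (Ref 77 (N0,N1,N2,N3)
    ((N0,N3),(N1,N3),(N1,N2),(N1,N2))))))),
    ([(N1,N1,N0,N0), (N1,N1,N1,N0), (N1,N0,N1,N1)], Split (N0,N1,N1,N0) (Ref 71 (N0,N2,N1,N3)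
    ((N1,N2),(N1,N2),(N0,N2),(N0,N2))) (Split (N1,N1,N1,N1) (Ref 78 (N0,N1,N2,N3)
    ((N0,N2),(N0,N2),(N0,N2),(N0,N2))) (Split (N0,N0,N1,N0) (Split (N1,N0,N1,N0) (Ref 43
    (N0,N1,N2,N3) ((N1,N2),(N1,N2),(N1,N2),(N0,N2))) (Ref 65 (N1,N0,N2,N3)
    ((N2,N1),(N2,N1),(N0,N2),(N0,N2)))) (Ref 78 (N0,N1,N2,N3)
    ((N0,N2),(N0,N2),(N1,N2),(N0,N2)))))),
    ([(N1,N1,N0,N0)], Split (N0,N1,N0,N0) (Ref 73 (N0,N1,N2,N3) ((N0,N2),(N0,N2),(N0,N2),(N0,N2)))
    (Split (N1,N1,N1,N0) (Ref 79 (N0,N1,N2,N3) ((N0,N2),(N0,N2),(N0,N2),(N0,N2))) (Split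
    (N1,N1,N1,N1) (Ref 79 (N0,N2,N1,N3) ((N0,N2),(N0,N2),(N0,N2),(N1,N2))) (Split (N1,N1,N0,N1)
    (Split (N0,N1,N0,N1) (Ref 72 (N0,N2,N1,N3) ((N0,N2),(N1,N2),(N1,N2),(N1,N2))) (Split
    (N1,N0,N0,N1) (Ref 69 (N0,N1,N2,N3) ((N1,N2),(N1,N2),(N0,N2),(N1,N2))) (Split (N0,N1,N1,N1)
    (Cut 25 (N1,N2,N3,N0) ((N0,N2),(N0,N2),(N0,N2),(N0,N2))) (Ref 68 (N0,N1,N2,N3)
    ((N1,N2),(N1,N2),(N0,N2),(N0,N2)))))) (Split (N1,N0,N1,N0) (Ref 72 (N0,N1,N2,N3)
    ((N0,N2),(N1,N2),(N1,N2),(N0,N2))) (Ref 79 (N0,N1,N2,N3)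
    ((N1,N2),(N1,N2),(N1,N2),(N0,N2)))))))),
    ([], Split (N1,N1,N0,N0) (Ref 80 (N0,N1,N2,N3) ((N0,N2),(N0,N2),(N0,N2),(N0,N2))) (Ref 80
    (N0,N2,N1,N3) ((N1,N2),(N0,N2),(N0,N2),(N1,N2))))]"

lemma certs_ok: "list_all cert_ok certs"
  by code_simp

lemma derivation_ok: "check_all (map fst certs) [] derivation"
  by code_simp

section \<open>Existence of a positive diagonal\<close>

text \<open>The derivation reaches the empty pattern. Every function vanishes on it, so its
  exclusion leaves no heavy function with \<open>bad3\<close>.\<close>

lemma not_bad3:
  assumes "heavy f"
  shows "\<not> bad3 f"
proof -
  have "excluded (\<lambda>_. True) c" if "c \<in> set (map fst certs)" for c
    using that certs_ok cert_ok_sound unfolding excluded_def list_all_iff by fastforce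
  moreover have "[] \<in> set (map fst derivation)" by (simp add: derivation_def)
  ultimately have "excluded bad3 []"
    using check_all_sound[OF derivation_ok] by simp
  then show ?thesis using assms by (simp add: excluded_def)
qed

text \<open>The condition of \<open>bad3\<close> for a single box of the standard splitting.\<close>

definition bad_block :: "((v \<Rightarrow> v) \<Rightarrow> real) \<Rightarrow> (v \<Rightarrow> bool) \<Rightarrow> bool" where
  "bad_block f e \<longleftrightarrow> (\<forall>\<alpha>. (\<forall>i. high (\<alpha> i) = e i) \<longrightarrow> f \<alpha> = 0 \<or> f (flip \<circ> \<alpha>) = 0)"

text \<open>The triple of \<open>bad3\<close> in another position: \<open>p\<close> moves the
  coordinates, and \<open>q\<close> either keeps the two blocks or exchanges them in all four
  coordinates at once, which respects parity because four is even.\<close>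

lemma three_bad_blocks:
  assumes "heavy f" "valid_sym p (q, q, q, q)"
    and bad: "bad_block f (\<lambda>i. high (fst q))"
      "bad_block f (\<lambda>i. high (fst q) \<noteq> sel (True, True, False, False) (sel p i))"
      "bad_block f (\<lambda>i. high (fst q) \<noteq> sel (True, False, True, False) (sel p i))"
  shows False
proof -
  have q: "high (fst q) \<noteq> high (snd q)"
    using valid_symD(2)[OF assms(2), of N0] by simp
  have "bad3 (f \<circ> relabel p (q, q, q, q))"
    unfolding bad3_def
  proof (intro allI impI)
    fix t assume "bad_cell t"
    obtain a b c d where t: "t = (a, b, c, d)" by (cases t) auto
    define \<alpha> where "\<alpha> = relabel p (q, q, q, q) (sel t)"
    have q4: "sel (q, q, q, q) i = q" for i by (cases i) simp_all
    have hi: "high (\<alpha> i) = (high (fst q) \<noteq> high (sel t (sel p i)))" for i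
      using high_vperm[OF q, of "sel t (sel p i)"] by (auto simp: \<alpha>_def reindex_def q4)
    have fl: "relabel p (q, q, q, q) (sel (flip4 t)) = flip \<circ> \<alpha>"
    proof -
      have "sel (flip4 t) i = flip (sel t i)" for i by (cases t; cases i) simp_all
      then show ?thesis by (simp add: \<alpha>_def reindex_def fun_eq_iff vperm_flip)
    qed
    consider "\<forall>i. high (sel t i) = False" | "\<forall>i. high (sel t i) = sel (True, True, False, False) i"
      | "\<forall>i. high (sel t i) = sel (True, False, True, False) i"
      using \<open>bad_cell t\<close> by (auto simp: t all_v split: if_splits)
    then have "f \<alpha> = 0 \<or> f (flip \<circ> \<alpha>) = 0"
    proof cases
      case 1
      then show ?thesis using bad(1) hi unfolding bad_block_def by (metis (full_types))
    next
      case 2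
      then show ?thesis using bad(2) hi unfolding bad_block_def by (metis (full_types))
    next
      case 3
      then show ?thesis using bad(3) hi unfolding bad_block_def by (metis (full_types))
    qed
    then show "(f \<circ> relabel p (q, q, q, q)) (sel t) = 0
        \<or> (f \<circ> relabel p (q, q, q, q)) (sel (flip4 t)) = 0"
      by (simp add: fl \<alpha>_def[symmetric])
  qed
  then show False using not_bad3 heavy_relabel[OF assms(2,1)] by blast
qed

text \<open>The argument \<open>k\<close> numbers the four cells \<open>d k\<close>; injectivity for
  each \<open>i\<close> says that they pairwise differ in every coordinate.\<close>

definition has_diagonal :: "((v \<Rightarrow> v) \<Rightarrow> real) \<Rightarrow> bool" where
  "has_diagonal f \<longleftrightarrow> (\<exists>d :: v \<Rightarrow> v \<Rightarrow> v. (\<forall>i. inj (\<lambda>k. d k i)) \<and> (\<forall>k. 0 < f (d k)))"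

text \<open>Antipodal cells of one box differ everywhere by \<open>flip\<close>, and cells of
  opposite boxes differ everywhere by \<open>high\<close>. Positive antipodal pairs in two opposite
  boxes therefore form a full diagonal.\<close>

lemma bad_block_or_opposite:
  assumes "stoch f" "\<not> has_diagonal f"
  shows "bad_block f e \<or> bad_block f (\<lambda>i. \<not> e i)"
proof (rule ccontr)
  assume "\<not> ?thesis"
  then obtain \<alpha> \<beta> where \<alpha>: "\<forall>i. high (\<alpha> i) = e i" "f \<alpha> \<noteq> 0" "f (flip \<circ> \<alpha>) \<noteq> 0"
    and \<beta>: "\<forall>i. high (\<beta> i) = (\<not> e i)" "f \<beta> \<noteq> 0" "f (flip \<circ> \<beta>) \<noteq> 0"
    unfolding bad_block_def by blast
  define d where "d = sel (\<alpha>, flip \<circ> \<alpha>, \<beta>, flip \<circ> \<beta>)"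
  have "high (flip x) = high x" "flip x \<noteq> x" for x by (cases x; simp)+
  then have "inj (\<lambda>k. d k i)" for i
    using spec[OF \<alpha>(1), of i] spec[OF \<beta>(1), of i]
    unfolding inj_def all_v d_def sel.simps comp_def by (metis (full_types))
  moreover have "\<forall>k. 0 < f (d k)"
    using \<alpha> \<beta> assms(1) by (simp add: all_v d_def stoch_def less_le)
  ultimately show False using assms(2) unfolding has_diagonal_def by blast
qed

text \<open>One bad box is picked from each of three pairs of opposite boxes of even parity; each of
  the eight possible triples is a relabelling of the one in \<open>bad3\<close>.\<close>

lemma heavy_has_diagonal:
  assumes "heavy f"
  shows "has_diagonal f"
proof (rule ccontr)
  assume "\<not> has_diagonal f"
  moreover have "stoch f" using assms by (simp add: heavy_def)
  ultimately have pair: "bad_block f e \<or> bad_block f (\<lambda>i. \<not> e i)" for e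
    by (rule bad_block_or_opposite[rotated])
  have eqs: "(\<lambda>i. \<not> sel (a, b, c, d) i) = sel (\<not> a, \<not> b, \<not> c, \<not> d)" for a b c d
    by (simp add: fun_eq_iff all_v)
  have const: "(\<lambda>i :: v. b) = sel (b, b, b, b)" for b :: bool
    by (simp add: fun_eq_iff all_v)
  have comp: "(\<lambda>i. b \<noteq> sel x (sel (p0, p1, p2, p3) i)) =
      sel (b \<noteq> sel x p0, b \<noteq> sel x p1, b \<noteq> sel x p2, b \<noteq> sel x p3)" for b x p0 p1 p2 p3
    by (simp add: fun_eq_iff all_v)
  have three: False
    if "valid_sym (p0, p1, p2, p3) (q, q, q, q)" "b = high (fst q)" "bad_block f (sel (b, b, b, b))"
      "bad_block f (sel (b \<noteq> sel x p0, b \<noteq> sel x p1, b \<noteq> sel x p2, b \<noteq> sel x p3))"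
      "bad_block f (sel (b \<noteq> sel y p0, b \<noteq> sel y p1, b \<noteq> sel y p2, b \<noteq> sel y p3))"
      "x = (True, True, False, False)" "y = (True, False, True, False)"
    for p0 p1 p2 p3 q b x y
    using three_bad_blocks[OF assms that(1)] that unfolding comp const by blast
  \<comment> \<open>The permutations are the identity and the three double transpositions. They keep
    or complement the patterns (True, True, False, False) and (True, False, True, False)
    independently, which realises all four choices for the second and third box;
    \<open>(N0, N2)\<close> and \<open>(N2, N0)\<close> decide whether the first box is all low or
    all high.\<close>
  show False
    using pair[of "sel (False, False, False, False)"] pair[of "sel (True, True, False, False)"]
      pair[of "sel (True, False, True, False)"]
      three[of N0 N1 N2 N3 "(N0, N2)" False]
      three[of N0 N1 N2 N3 "(N2, N0)" True]
      three[of N1 N0 N3 N2 "(N0, N2)" False]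
      three[of N1 N0 N3 N2 "(N2, N0)" True]
      three[of N2 N3 N0 N1 "(N0, N2)" False]
      three[of N2 N3 N0 N1 "(N2, N0)" True]
      three[of N3 N2 N1 N0 "(N0, N2)" False]
      three[of N3 N2 N1 N0 "(N2, N0)" True]
    by (simp add: eqs) blast
qed

section \<open>Reduction of an arbitrary matrix to the heavy or the constant case\<close>

lemma exists_perm_low:
  assumes "card (Y :: v set) = 2"
  shows "\<exists>g. bij g \<and> g ` {x. \<not> high x} = Y"
proof -
  obtain a b where Y: "Y = {a, b}" "a \<noteq> b" using assms by (meson card_2_iff)
  have "card (- Y) = 2" using assms card_v by (simp add: Compl_eq_Diff_UNIV card_Diff_subset)
  then obtain c d where cd: "- Y = {c, d}" "c \<noteq> d" by (meson card_2_iff)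
  have "{c, d} \<inter> {a, b} = {}" using Y cd by blast
  then have "inj (sel (a, b, c, d))" using Y cd by (auto simp: inj_def all_v)
  then have "bij (sel (a, b, c, d))" by (rule bij_vI)
  moreover have "sel (a, b, c, d) ` {x. \<not> high x} = Y" by (simp add: high_sets Y)
  ultimately show ?thesis by blast
qed

text \<open>With three values available, the equal pairwise sums determine the summands: the
  equations for x, y and z force each share to be half of \<open>w\<close>.\<close>

lemma weight_singleton_half:
  assumes "\<And>S. card S = 2 \<Longrightarrow> weight f (Y(i := S)) = w"
  shows "weight f (Y(i := {x})) = w / 2"
proof -
  have "card (UNIV - {x}) = 3" using card_v by (simp add: card_Diff_singleton)
  then obtain y z where yz: "y \<noteq> z" "y \<noteq> x" "z \<noteq> x"
    by (auto simp: card_3_iff)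
  have "weight f (Y(i := {a, b})) = weight f (Y(i := {a})) + weight f (Y(i := {b}))" if "a \<noteq> b" for a b
    unfolding insert_is_Un[of a "{b}"] by (rule weight_union) (use that in simp)
  then have "weight f (Y(i := {x})) + weight f (Y(i := {y})) = w"
    "weight f (Y(i := {x})) + weight f (Y(i := {z})) = w"
    "weight f (Y(i := {y})) + weight f (Y(i := {z})) = w"
    using assms[of "{x, y}"] assms[of "{x, z}"] assms[of "{y, z}"] yz by (simp_all del: fun_upd_apply)
  then show ?thesis by simp
qed

text \<open>Shrinking the sides one at a time from two elements to one halves the weight at each
  step: 4, 2, 1, 1/2, 1/4.\<close>

lemma flat_constant:
  assumes cubes: "\<And>Y. (\<And>i. card (Y i) = 2) \<Longrightarrow> weight f Y = 4"
  shows "f \<alpha> = 1 / 4"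
proof -
  have w1: "weight f (Y(N0 := {\<alpha> N0})) = 2"
    if "card (Y N1) = 2" "card (Y N2) = 2" "card (Y N3) = 2" for Y
  proof -
    have "weight f (Y(N0 := S)) = 4" if "card S = 2" for S
    proof (rule cubes)
      show "card ((Y(N0 := S)) i) = 2" for i
        using that \<open>card (Y N1) = 2\<close> \<open>card (Y N2) = 2\<close> \<open>card (Y N3) = 2\<close> by (cases i) simp_all
    qed
    then show ?thesis using weight_singleton_half[of f Y N0 4] by simp
  qed
  have w2: "weight f (Y(N0 := {\<alpha> N0}, N1 := {\<alpha> N1})) = 1"
    if "card (Y N2) = 2" "card (Y N3) = 2" for Y
    using weight_singleton_half[of f "Y(N0 := {\<alpha> N0})" N1 2] w1[of "Y(N1 := _)"] that
    by (simp add: fun_upd_twist[where a = N1 and c = N0])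
  have w3: "weight f (Y(N0 := {\<alpha> N0}, N1 := {\<alpha> N1}, N2 := {\<alpha> N2})) = 1 / 2"
    if "card (Y N3) = 2" for Y
    using weight_singleton_half[of f "Y(N0 := {\<alpha> N0}, N1 := {\<alpha> N1})" N2 1] w2[of "Y(N2 := _)"] that
    by (simp add: fun_upd_twist[where a = N2 and c = N0] fun_upd_twist[where a = N2 and c = N1])
  have "weight f (Y(N0 := {\<alpha> N0}, N1 := {\<alpha> N1}, N2 := {\<alpha> N2}, N3 := {\<alpha> N3})) = 1 / 4" for Y
    using weight_singleton_half[of f "Y(N0 := {\<alpha> N0}, N1 := {\<alpha> N1}, N2 := {\<alpha> N2})" N3 "1/2"]
      w3[of "Y(N3 := _)"]
    by (simp add: fun_upd_twist[where a = N3 and c = N0] fun_upd_twist[where a = N3 and c = N1] fun_upd_twist[where a = N3 and c = N2])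
  moreover have "Y(N0 := {\<alpha> N0}, N1 := {\<alpha> N1}, N2 := {\<alpha> N2}, N3 := {\<alpha> N3}) = (\<lambda>i. {\<alpha> i})" for Y
    by (simp add: fun_eq_iff all_v)
  moreover have "PiE UNIV (\<lambda>i. {\<alpha> i}) = {\<alpha>}" by auto
  ultimately show ?thesis by (simp add: weight_def)
qed

lemma stoch_has_diagonal:
  assumes "stoch f"
  shows "has_diagonal f"
proof -
  let ?C = "{Y :: v \<Rightarrow> v set. \<forall>i. card (Y i) = 2}"
  have "block (\<lambda>_. False) \<in> ?C" by (simp add: card_block)
  then obtain Y where Y: "Y \<in> ?C" and max: "\<And>Z. Z \<in> ?C \<Longrightarrow> weight f Z \<le> weight f Y"
    using finite_has_maximal[of "weight f ` ?C"] by (smt (verit, best) empty_iff finite finite_imageI imageE imageI)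
  show ?thesis
  proof (cases "weight f Y \<le> 4")
    case True
    \<comment> \<open>\<open>Z\<close> and its complement in direction \<open>N0\<close> weigh 8
      together and at most 4 each.\<close>
    have "weight f Z = 4" if "\<And>i. card (Z i) = 2" for Z
    proof -
      have "card ((Z(N0 := - Z N0)) i) = 2" for i
        using that card_v by (simp add: Compl_eq_Diff_UNIV card_Diff_subset)
      then have "weight f (Z(N0 := - Z N0)) \<le> weight f Y" by (intro max) blast
      moreover have "weight f Z \<le> weight f Y" using that by (intro max) blast
      ultimately show ?thesis using True weight_complement_cube[where Y = Z and i = N0, OF assms that] by linarith
    qed
    then have "\<forall>\<alpha>. 0 < f \<alpha>" by (simp add: flat_constant)
    \<comment> \<open>In the constant matrix the cells with four equal coordinates serve as the
      diagonal.\<close>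
    then show ?thesis unfolding has_diagonal_def by (intro exI[of _ "\<lambda>k i. k"]) (simp add: inj_def)
  next
    case False
    have "\<forall>i. \<exists>g. bij g \<and> g ` {x. \<not> high x} = Y i" using Y exists_perm_low by blast
    then obtain q where q: "\<And>i. bij (q i)" "\<And>i. q i ` {x. \<not> high x} = Y i" by metis
    let ?g = "f \<circ> reindex id q"
    have base: "weight ?g (block (\<lambda>_. False)) = weight f Y"
      using weight_reindex[where f = f and Y = "block (\<lambda>_. False)", OF bij_id q(1)] q(2) by (simp add: block_def)
    have "weight ?g Z \<le> weight f Y" if "\<forall>i. card (Z i) = 2" for Z
    proof -
      have "(\<lambda>i. q i ` Z (id i)) \<in> ?C"
        using that q(1) by (simp add: card_image inj_on_subset[OF bij_is_inj])
      then show ?thesis unfolding weight_reindex[OF bij_id q(1)] by (rule max)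
    qed
    then have "heavy ?g"
      using False stoch_reindex[OF bij_id q(1) assms] by (simp add: heavy_def base)
    then have "has_diagonal ?g" by (rule heavy_has_diagonal)
    then obtain d :: "v \<Rightarrow> v \<Rightarrow> v" where d: "\<And>i. inj (\<lambda>k. d k i)" "\<And>k. 0 < ?g (d k)"
      unfolding has_diagonal_def by blast
    \<comment> \<open>The diagonal of the renamed matrix is carried back by \<open>q i\<close>,
      which keeps values at coordinate \<open>i\<close> distinct.\<close>
    have "inj (\<lambda>k. q i (d k i))" for i
      using inj_compose[OF bij_is_inj[OF q(1)[of i]] d(1)[of i]] by (simp add: comp_def)
    then show ?thesis
      unfolding has_diagonal_def using d(2) by (intro exI[of _ "\<lambda>k. reindex id q (d k)"]) (simp add: reindex_def)
  qed
qed

section \<open>Passage to the list-indexed matrices of the statement\<close>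

fun num :: "v \<Rightarrow> nat" where
  "num N0 = 0" | "num N1 = 1" | "num N2 = 2" | "num N3 = 3"

lemma inj_num: "inj num"
  by (simp add: inj_def all_v)

lemma range_num: "range num = {..<4}"
  by (auto simp: UNIV_v)

definition idx :: "(v \<Rightarrow> v) \<Rightarrow> nat list" where
  "idx \<alpha> = [num (\<alpha> N0), num (\<alpha> N1), num (\<alpha> N2), num (\<alpha> N3)]"

lemma idx_nth: "idx \<alpha> ! num i = num (\<alpha> i)"
  by (cases i) (simp_all add: idx_def)

lemma idx_upd: "(idx \<alpha>)[num i := num x] = idx (\<alpha>(i := x))"
  by (cases i) (simp_all add: idx_def)

lemma num_less: "num x < 4"
  using range_num by blast

lemma less_4_num: "n < 4 \<Longrightarrow> \<exists>x. n = num x"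
  using range_num by blast

lemma idx_in: "idx \<alpha> \<in> index_set 4 4"
proof -
  have "idx \<alpha> ! n < 4" if "n < 4" for n
    using less_4_num[OF that] num_less by (auto simp: idx_nth)
  then show ?thesis by (simp add: index_set_def) (simp add: idx_def)
qed

lemma stoch_of_polystochastic:
  assumes "polystochastic 4 4 M"
  shows "stoch (M \<circ> idx)"
proof -
  have "(\<Sum>x\<in>UNIV. M (idx (\<alpha>(i := x)))) = 1" for \<alpha> i
  proof -
    let ?l = "{(idx \<alpha>)[num i := k] | k. k < 4}"
    have "?l \<in> lines 4 4" using idx_in num_less unfolding lines_def by blast
    then have "sum M ?l = 1" using assms by (simp add: polystochastic_def)
    moreover have "?l = (\<lambda>x. idx (\<alpha>(i := x))) ` UNIV"
      using less_4_num num_less by (auto simp: idx_upd[symmetric])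
    \<comment> \<open>Distinct values give distinct cells, so the sum over the line as a set equals
      the sum over \<open>x\<close>.\<close>
    moreover have "inj (\<lambda>x. idx (\<alpha>(i := x)))"
      by (rule injI) (metis idx_nth fun_upd_same inj_num injD)
    ultimately show ?thesis by (simp add: sum.reindex)
  qed
  then show ?thesis
    using assms idx_in by (simp add: stoch_def polystochastic_def)
qed

text \<open>A sum over an infinite set is 0 by convention, so bounding \<open>per\<close> below by a
  single summand rests on this.\<close>

lemma finite_diagonals: "finite (diagonals d n)"
proof -
  have "index_set d n \<subseteq> {xs. set xs \<subseteq> {..<n} \<and> length xs = d}"
    by (auto simp: index_set_def in_set_conv_nth)
  then have "finite (index_set d n)" using finite_lists_length_eq[of "{..<n}" d] finite_subset by blast
  then show ?thesis by (rule finite_subset[rotated, OF finite_Pow_iff[THEN iffD2]]) (auto simp: diagonals_def)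
qed

theorem theorem2:
  fixes A :: "nat list \<Rightarrow> real"
  assumes "polystochastic 4 4 A"
  shows "per 4 4 A > 0"
proof -
  obtain d :: "v \<Rightarrow> v \<Rightarrow> v" where d: "\<And>i. inj (\<lambda>k. d k i)" "\<And>k. 0 < A (idx (d k))"
    using stoch_has_diagonal[OF stoch_of_polystochastic[OF assms]] unfolding has_diagonal_def by auto
  define D where "D = range (\<lambda>k. idx (d k))"
  have diff: "idx (d k) ! n \<noteq> idx (d l) ! n" if "k \<noteq> l" "n < 4" for k l n
    using less_4_num[OF that(2)] injD[OF d(1)] that(1) by (auto simp: idx_nth inj_eq[OF inj_num])
  \<comment> \<open>Coordinate 0 already tells the four cells apart;
    \<open>zero_less_numeral\<close> supplies this instance of \<open>diff\<close>.\<close>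
  have "inj (\<lambda>k. idx (d k))"
    by (rule injI) (metis diff zero_less_numeral)
  then have "card D = 4" by (simp add: D_def card_image card_v)
  have D: "D \<in> diagonals 4 4"
  proof -
    have "\<forall>\<beta>\<in>D. \<forall>\<gamma>\<in>D. \<beta> \<noteq> \<gamma> \<longrightarrow> (\<forall>i<4. \<beta> ! i \<noteq> \<gamma> ! i)"
      unfolding D_def using diff by (metis imageE)
    then show ?thesis using \<open>card D = 4\<close> idx_in by (auto simp: diagonals_def D_def)
  qed
  have nonneg: "0 \<le> (\<Prod>\<alpha>\<in>p. A \<alpha>)" if "p \<in> diagonals 4 4" for p
    using that assms by (intro prod_nonneg) (auto simp: diagonals_def polystochastic_def)
  \<comment> \<open>All summands of the permanent are nonnegative, so this one positive product
    bounds it from below.\<close>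
  have "0 < (\<Prod>\<alpha>\<in>D. A \<alpha>)" using d(2) by (intro prod_pos) (auto simp: D_def)
  also have "\<dots> \<le> per 4 4 A"
    unfolding per_def using D nonneg finite_diagonals by (intro member_le_sum) auto
  finally show ?thesis .
qed

end
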